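(* There exists a positive universal constant $C_0$ such that the following holds. Let $\mathsf X=\mathsf X_1\times\cdots\times\mathsf X_n$ with $\mathsf X_i=\mathbb R^{d_i}$, $d_i\ge1$, and let $\Pi$ be a probability distribution on $\mathsf X$ with density proportional to $e^{-\xi(x)}$ for some $\xi:\mathsf X\to\mathbb R$. For $i\in\{1,\dots,n\}$ and $y\in\mathsf X_{-i}$ let $\xi_{i,y}:\mathbb R^{d_i}\to\mathbb R$ be defined by $\xi_{i,x_{-i}}(x_i)=\xi(x)$. Suppose that there exists $k\in\{1,\dots,n\}$ such that, for every $i\le k$ and $y\in\mathsf X_{-i}$, there are positive numbers $m_{i,y}$ and $L_{i,y}$ with $$\frac{m_{i,y}}{2}\|u\|^2\le\xi_{i,y}(z+u)-\xi_{i,y}(z)-\langle\nabla\xi_{i,y}(z),u\rangle\le\frac{L_{i,y}}{2}\|u\|^2\qquad\text{for all }z,u\in\mathbb R^{d_i}.$$ For $i\le k$ and $y\in\mathsf X_{-i}$, let $Q_{i,y}$ be the Markov kernel on $\mathbb R^{d_i}$ of the random-walk Metropolis algorithm targeting $\Pi_{i,y}$ with proposal $N(z,\sigma_{i,y}^2I_{d_i})$ from current state $z$, where $\sigma_{i,y}^2=2^{-1}L_{i,y}^{-1}d_i^{-1}$. For $i>k$ and $y\in\mathsf X_{-i}$, let $Q_{i,y}(z,\cdot)=\Pi_{i,y}(\cdot)$ for all $z\in\mathbb R^{d_i}$. Let $T$ and $\hat T$ be the corresponding exact and hybrid random-scan Gibbs kernels (defined in the context). Then $$\Big(\min_{i\le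 k}\inf_{y\in\mathsf X_{-i}}\frac{C_0m_{i,y}}{d_iL_{i,y}}\Big)(1-\|T\|_\Pi)\le1-\|\hat T\|_\Pi\le1-\|T\|_\Pi.$$
   Context: For a probability measure $\omega$ and a Markov kernel $K$ reversible with respect to $\omega$, $\|K\|_\omega\in[0,1]$ is the operator norm of $K$ acting on $L_0^2(\omega)$, the real Hilbert space of square-integrable functions with $\omega$-mean zero. $\|\cdot\|$ and $\langle\cdot,\cdot\rangle$ on $\mathbb R^{d_i}$ are Euclidean. For $x\in\mathsf X$, $x_{-i}$ is $x$ with the $i$th component removed and $\mathsf X_{-i}=\{x_{-i}:x\in\mathsf X\}$; $\Pi_{i,y}$ is the conditional distribution of $X_i$ given $X_{-i}=y$ when $X\sim\Pi$, i.e. the distribution on $\mathbb R^{d_i}$ with density proportional to $e^{-\xi_{i,y}}$. The Metropolis algorithm accepts a proposal $z'$ from $z$ with probability $\min\{1,e^{\xi_{i,y}(z)-\xi_{i,y}(z')}\}$ and otherwise stays at $z$. It is a standing assumption that for every $i$ and Borel $A\subset\mathsf X_i$ the map $x\mapsto Q_{i,x_{-i}}(x_i,A)$ is measurable. Let $p_1,\dots,p_n\ge0$ with $\sum_ip_i=1$, let $\delta$ denote a point mass, and define $$T(x,dx')=\sum_{i=1}^n p_i\,\Pi_{i,x_{-i}}(dx_i')\,\delta_{x_{-i}}(dx_{-i}'),\qquad \hat T(x,dx')=\sum_{i=1}^n p_i\,Q_{i,x_{-i}}(x_i,dx_i')\,\delta_{x_{-i}}(dx_{-i}').$$ Both are reversible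 with respect to $\Pi$. *)

theory Defs
  imports "HOL-Probability.Probability"
begin

text \<open>The constant of the theorem must not depend on the dimensions, so these have to be terms and
  not types. Thus \<open>\<real>\<^sup>d\<close> is the set of extensional functions on \<open>{..<d}\<close> carrying the product
  Lebesgue measure, and a state \<open>x\<close> has components \<open>x i\<close> for \<open>i \<in> {1..n}\<close>.\<close>

definition euclid :: "nat \<Rightarrow> (nat \<Rightarrow> real) measure" where
  "euclid d = PiM {..<d} (\<lambda>_. lborel)"

definition state_space :: "nat \<Rightarrow> (nat \<Rightarrow> nat) \<Rightarrow> (nat \<Rightarrow> nat \<Rightarrow> real) measure" where
  "state_space n d = PiM {1..n} (\<lambda>i. euclid (d i))"

definition rest_space :: "nat \<Rightarrow> (nat \<Rightarrow> nat) \<Rightarrow> nat \<Rightarrow> (nat \<Rightarrow> nat \<Rightarrow> real) measure" where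
  "rest_space n d i = PiM ({1..n} - {i}) (\<lambda>j. euclid (d j))"

definition drop_comp :: "nat \<Rightarrow> nat \<Rightarrow> (nat \<Rightarrow> nat \<Rightarrow> real) \<Rightarrow> (nat \<Rightarrow> nat \<Rightarrow> real)" where
  "drop_comp n i x = restrict x ({1..n} - {i})"

definition vec_add :: "nat \<Rightarrow> (nat \<Rightarrow> real) \<Rightarrow> (nat \<Rightarrow> real) \<Rightarrow> (nat \<Rightarrow> real)" where
  "vec_add d z u = (\<lambda>j\<in>{..<d}. z j + u j)"

definition vec_inner :: "nat \<Rightarrow> (nat \<Rightarrow> real) \<Rightarrow> (nat \<Rightarrow> real) \<Rightarrow> real" where
  "vec_inner d u v = (\<Sum>j<d. u j * v j)"

definition vec_norm :: "nat \<Rightarrow> (nat \<Rightarrow> real) \<Rightarrow> real" where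
  "vec_norm d u = L2_set u {..<d}"

definition grad :: "nat \<Rightarrow> ((nat \<Rightarrow> real) \<Rightarrow> real) \<Rightarrow> (nat \<Rightarrow> real) \<Rightarrow> (nat \<Rightarrow> real)" where
  "grad d f z = (\<lambda>j\<in>{..<d}. deriv (\<lambda>t. f (z(j := t))) (z j))"

text \<open>Differentiability is not listed separately below. The two-sided bound implies it: if the
  bound holds with any vector in place of \<open>grad d f z\<close>, then \<open>f\<close> is Frechet differentiable at \<open>z\<close>
  and that vector is its gradient, so the arbitrary value of \<open>deriv\<close> at points of
  non-differentiability cannot make the predicate true.\<close>

definition strongly_convex_smooth ::
    "nat \<Rightarrow> real \<Rightarrow> real \<Rightarrow> ((nat \<Rightarrow> real) \<Rightarrow> real) \<Rightarrow> bool" where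
  "strongly_convex_smooth d m L f \<longleftrightarrow>
     (\<forall>z\<in>space (euclid d). \<forall>u\<in>space (euclid d).
        m / 2 * (vec_norm d u)\<^sup>2 \<le> f (vec_add d z u) - f z - vec_inner d (grad d f z) u \<and>
        f (vec_add d z u) - f z - vec_inner d (grad d f z) u \<le> L / 2 * (vec_norm d u)\<^sup>2)"

definition gibbs_measure :: "'a measure \<Rightarrow> ('a \<Rightarrow> real) \<Rightarrow> 'a measure" where
  "gibbs_measure M f = density M (\<lambda>x. ennreal (exp (- f x) / (\<integral>x. exp (- f x) \<partial>M)))"

definition cond_pot ::
    "((nat \<Rightarrow> nat \<Rightarrow> real) \<Rightarrow> real) \<Rightarrow> nat \<Rightarrow> (nat \<Rightarrow> nat \<Rightarrow> real) \<Rightarrow> (nat \<Rightarrow> real) \<Rightarrow> real" where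
  "cond_pot \<xi> i y z = \<xi> (y(i := z))"

text \<open>Integrability of \<open>exp (- \<xi>)\<close> only makes almost every section integrable. On the remaining
  null set of \<open>y\<close> the conditional distribution is arbitrary; a point mass keeps it a
  probability measure.\<close>

definition cond_dist ::
    "(nat \<Rightarrow> nat) \<Rightarrow> ((nat \<Rightarrow> nat \<Rightarrow> real) \<Rightarrow> real) \<Rightarrow> nat \<Rightarrow> (nat \<Rightarrow> nat \<Rightarrow> real) \<Rightarrow> (nat \<Rightarrow> real) measure"
  where
  "cond_dist d \<xi> i y =
     (if integrable (euclid (d i)) (\<lambda>z. exp (- cond_pot \<xi> i y z))
      then gibbs_measure (euclid (d i)) (cond_pot \<xi> i y)
      else return (euclid (d i)) (\<lambda>j\<in>{..<d i}. 0))"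

text \<open>Note that \<open>normal_density\<close> takes the standard deviation, not the variance.\<close>

definition gaussian :: "nat \<Rightarrow> (nat \<Rightarrow> real) \<Rightarrow> real \<Rightarrow> (nat \<Rightarrow> real) measure" where
  "gaussian d z \<sigma> = PiM {..<d} (\<lambda>j. density lborel (\<lambda>t. ennreal (normal_density (z j) \<sigma> t)))"

definition accept_prob :: "('a \<Rightarrow> real) \<Rightarrow> 'a \<Rightarrow> 'a \<Rightarrow> real" where
  "accept_prob f z z' = min 1 (exp (f z - f z'))"

definition rw_metropolis ::
    "nat \<Rightarrow> ((nat \<Rightarrow> real) \<Rightarrow> real) \<Rightarrow> real \<Rightarrow> (nat \<Rightarrow> real) \<Rightarrow> (nat \<Rightarrow> real) measure" where
  "rw_metropolis d f \<sigma> z = measure_of (space (euclid d)) (sets (euclid d))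
     (\<lambda>A. (\<integral>\<^sup>+z'. ennreal (accept_prob f z z') * indicator A z' \<partial>gaussian d z \<sigma>)
        + (\<integral>\<^sup>+z'. ennreal (1 - accept_prob f z z') \<partial>gaussian d z \<sigma>) * indicator A z)"

definition hybrid_cond_kernel ::
    "nat \<Rightarrow> (nat \<Rightarrow> nat) \<Rightarrow> ((nat \<Rightarrow> nat \<Rightarrow> real) \<Rightarrow> real) \<Rightarrow> (nat \<Rightarrow> (nat \<Rightarrow> nat \<Rightarrow> real) \<Rightarrow> real) \<Rightarrow>
     nat \<Rightarrow> (nat \<Rightarrow> nat \<Rightarrow> real) \<Rightarrow> (nat \<Rightarrow> real) \<Rightarrow> (nat \<Rightarrow> real) measure" where
  "hybrid_cond_kernel k d \<xi> L i y z =
     (if i \<le> k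
      then rw_metropolis (d i) (cond_pot \<xi> i y) (sqrt (1 / (2 * L i y * real (d i)))) z
      else cond_dist d \<xi> i y)"

text \<open>The kernel \<open>\<Sum>i. p i * Q i x\<^sub>-\<^sub>i (x i, dx'\<^sub>i) \<delta>(x\<^sub>-\<^sub>i, dx'\<^sub>-\<^sub>i)\<close>, where \<open>distr\<close> identifies
  \<open>(x'\<^sub>-\<^sub>i, x'\<^sub>i)\<close> with \<open>x'\<close>.\<close>

definition random_scan ::
    "nat \<Rightarrow> (nat \<Rightarrow> nat) \<Rightarrow> (nat \<Rightarrow> real) \<Rightarrow>
     (nat \<Rightarrow> (nat \<Rightarrow> nat \<Rightarrow> real) \<Rightarrow> (nat \<Rightarrow> real) \<Rightarrow> (nat \<Rightarrow> real) measure) \<Rightarrow>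
     (nat \<Rightarrow> nat \<Rightarrow> real) \<Rightarrow> (nat \<Rightarrow> nat \<Rightarrow> real) measure" where
  "random_scan n d p Q x = measure_of (space (state_space n d)) (sets (state_space n d))
     (\<lambda>A. \<Sum>i=1..n. ennreal (p i) *
        emeasure (distr (return (rest_space n d i) (drop_comp n i x) \<Otimes>\<^sub>M Q i (drop_comp n i x) (x i))
                        (state_space n d) (\<lambda>(y, z). y(i := z))) A)"

definition exact_gibbs ::
    "nat \<Rightarrow> (nat \<Rightarrow> nat) \<Rightarrow> (nat \<Rightarrow> real) \<Rightarrow> ((nat \<Rightarrow> nat \<Rightarrow> real) \<Rightarrow> real) \<Rightarrow>
     (nat \<Rightarrow> nat \<Rightarrow> real) \<Rightarrow> (nat \<Rightarrow> nat \<Rightarrow> real) measure" where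
  "exact_gibbs n d p \<xi> = random_scan n d p (\<lambda>i y z. cond_dist d \<xi> i y)"

definition hybrid_gibbs ::
    "nat \<Rightarrow> nat \<Rightarrow> (nat \<Rightarrow> nat) \<Rightarrow> (nat \<Rightarrow> real) \<Rightarrow> ((nat \<Rightarrow> nat \<Rightarrow> real) \<Rightarrow> real) \<Rightarrow>
     (nat \<Rightarrow> (nat \<Rightarrow> nat \<Rightarrow> real) \<Rightarrow> real) \<Rightarrow> (nat \<Rightarrow> nat \<Rightarrow> real) \<Rightarrow> (nat \<Rightarrow> nat \<Rightarrow> real) measure" where
  "hybrid_gibbs n k d p \<xi> L = random_scan n d p (hybrid_cond_kernel k d \<xi> L)"

definition L2_zero :: "'a measure \<Rightarrow> ('a \<Rightarrow> real) set" where
  "L2_zero \<omega> = {f \<in> borel_measurable \<omega>. integrable \<omega> (\<lambda>x. (f x)\<^sup>2) \<and> (\<integral>x. f x \<partial>\<omega>) = 0}"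

definition L2_norm :: "'a measure \<Rightarrow> ('a \<Rightarrow> real) \<Rightarrow> real" where
  "L2_norm \<omega> f = sqrt (\<integral>x. (f x)\<^sup>2 \<partial>\<omega>)"

text \<open>As for \<open>onorm\<close>, the quotient is \<open>0\<close> for functions of norm \<open>0\<close>.\<close>

definition kernel_norm :: "'a measure \<Rightarrow> ('a \<Rightarrow> 'a measure) \<Rightarrow> real" where
  "kernel_norm \<omega> K = (SUP f\<in>L2_zero \<omega>. L2_norm \<omega> (\<lambda>x. \<integral>x'. f x' \<partial>K x) / L2_norm \<omega> f)"

end

(* Random-walk Metropolis with a Gaussian proposal is a positive operator: the Gaussian kernel is the square of a
   Gaussian kernel of half the variance and min a b is the integral of the products of the indicators of t < a and
   t < b. If each conditional kernel satisfies 0 <= <f, Pi f> <= <f, Q f> and c Var f <= |f|^2 - <f, Q f>, integrating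
   over the frozen coordinates gives the same inequalities for T and T', and for positive self-adjoint operators the
   norm is the supremum of the Rayleigh quotient.

   The spectral gap of Metropolis for an m-convex, L-smooth potential U is derived from the Poincare inequality, which
   itself is the second-order expansion of the Prekopa-Leindler inequality. A given f is replaced by its average G
   against the proposal density multiplied by a cutoff that keeps only points y with
   U y <= U x + O(1) - (1 + sigma |grad U x|), where a proposal is accepted with probability bounded below. Then
   |f - G|^2 and sigma^2 |grad G|^2 are both bounded by the local Metropolis energy, uniformly in the dimension,
   because sigma^2 = 1 / (2 L d) keeps the mass of the cutoff bounded below. *)
theory Submission
  imports Defs
begin

section \<open>Prekopa--Leindler inequality\<close>

text \<open>Two obstacles shape the proof. The norm of a self-adjoint operator may come from either
  end of its spectrum, so without positivity of the Metropolis kernels a comparison of quadratic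
  forms would not control it. And a square-integrable function has no gradient, so the Poincare
  inequality is proved in a form without derivatives: increments over short distances are bounded by
  a coefficient \<open>A x\<close> that depends on one endpoint. The width of the cutoff is dictated
  by how the average G must vary. Moving the base point by \<open>\<rho> * \<sigma>\<close> with
  \<open>\<rho> \<le> 1\<close> changes U by at most \<open>\<rho> * scale x\<close>, where
  \<open>scale x = 1 + \<sigma> * grad_norm x\<close>. A sharp cutoff would not survive this; a ramp
  of height \<open>scale x\<close> changes by a multiple of \<open>\<rho>\<close> relative to its
  mean, provided that its mean is comparable to its height. It is, because the linear part of
  \<open>U y - U x\<close> is at most minus two of its standard deviations with a fixed probability,
  while the bound for the quadratic part has mean 1/4 in every dimension. No spectral theorem is
  used: norm and Rayleigh quotient are linked by positivity on the span of two vectors.\<close>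

lemma ennreal_amgm: "4 * (x * y) \<le> (x + y)^2" for x y :: ennreal
proof (cases x)
  case (real a)
  show ?thesis
  proof (cases y)
    case y: (real b)
    have "4 * (a * b) \<le> (a + b)^2"
      using sum_squares_ge_zero[of "a - b" 0] by (simp add: power2_eq_square algebra_simps)
    then have "ennreal (4 * (a * b)) \<le> ennreal ((a + b)^2)" by (rule ennreal_leI)
    also have "ennreal (4 * (a * b)) = 4 * (ennreal a * ennreal b)"
      using real y by (simp add: ennreal_mult)
    also have "ennreal ((a + b)^2) = (ennreal a + ennreal b)^2"
      using real y by (simp add: ennreal_power ennreal_plus[symmetric] del: ennreal_plus)
    finally show ?thesis using real y by simp
  qed (simp add: power2_eq_square ennreal_mult_top ennreal_top_mult)
qed (simp add: power2_eq_square ennreal_top_mult)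

text \<open>Brunn-Minkowski on the line. With \<open>a\<close> almost at the supremum of
  \<open>A\<close> and \<open>b\<close> almost at the infimum of \<open>B\<close>, the translates of
  \<open>A\<close> by \<open>b\<close> and of \<open>B\<close> by \<open>a\<close> both lie in twice
  \<open>C\<close> and overlap at most in an interval of length \<open>e\<close>, so their measures
  nearly add up. The set of midpoints enters only through a measurable superset \<open>C\<close>,
  because the sum of two Borel sets need not be Borel.\<close>

lemma emeasure_midpoint_bounded:
  assumes A: "A \<in> sets lborel" "A \<noteq> {}" "A \<subseteq> {-N..N}"
    and B: "B \<in> sets lborel" "B \<noteq> {}" "B \<subseteq> {-N..N::real}"
    and C: "C \<in> sets lborel"
    and mid: "\<And>x y. x \<in> A \<Longrightarrow> y \<in> B \<Longrightarrow> (x + y) / 2 \<in> C"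
  shows "emeasure lborel A + emeasure lborel B \<le> 2 * emeasure lborel C"
proof -
  define D where "D = {x. x / 2 \<in> C}"
  have [measurable]: "A \<in> sets borel" "B \<in> sets borel" "C \<in> sets borel" using A B C by auto
  have Dm [measurable]: "D \<in> sets borel" unfolding D_def by measurable
  have D: "emeasure lborel D = 2 * emeasure lborel C"
  proof -
    have "emeasure lborel D = (\<integral>\<^sup>+x. indicator D x \<partial>lborel)" by simp
    also have "\<dots> = ennreal \<bar>2\<bar> * (\<integral>\<^sup>+x. indicator D (0 + 2 * x) \<partial>lborel)"
      by (rule nn_integral_real_affine) auto
    also have "(\<lambda>x. indicator D (0 + 2 * x) :: ennreal) = indicator C"
      by (auto simp: D_def indicator_def fun_eq_iff)
    finally show ?thesis by simp
  qed
  have bA: "bdd_above A" and bB: "bdd_below B"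
    using A(3) B(3) by (auto intro!: bdd_aboveI[of _ N] bdd_belowI[of _ "-N"])
  have shift: "emeasure lborel ((\<lambda>x. x + c) ` X) = emeasure lborel X" "(\<lambda>x. x + c) ` X \<in> sets borel"
    if "X \<in> sets borel" for X and c :: real
  proof -
    have eq: "(\<lambda>x. x + c) ` X = {x. x - c \<in> X}" by (force simp: image_iff)
    show s: "(\<lambda>x. x + c) ` X \<in> sets borel" unfolding eq using that by measurable
    have "emeasure lborel ((\<lambda>x. x + c) ` X) = (\<integral>\<^sup>+x. indicator ((\<lambda>x. x + c) ` X) x \<partial>lborel)"
      using s by simp
    also have "\<dots> = ennreal \<bar>1\<bar> * (\<integral>\<^sup>+x. indicator ((\<lambda>x. x + c) ` X) (c + 1 * x) \<partial>lborel)"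
      using s by (intro nn_integral_real_affine) auto
    also have "(\<lambda>x. indicator ((\<lambda>x. x + c) ` X) (c + 1 * x) :: ennreal) = indicator X"
      by (auto simp: indicator_def fun_eq_iff)
    finally show "emeasure lborel ((\<lambda>x. x + c) ` X) = emeasure lborel X" using that by simp
  qed
  show ?thesis
  proof (rule ennreal_le_epsilon)
    fix e :: real assume e: "0 < e"
    obtain a where a: "a \<in> A" "Sup A - e / 4 < a"
      using less_cSup_iff[OF A(2) bA, of "Sup A - e / 4"] e by auto
    obtain b where b: "b \<in> B" "b < Inf B + e / 4"
      using cInf_less_iff[OF B(2) bB, of "Inf B + e / 4"] e by auto
    let ?A = "(\<lambda>x. x + b) ` A" and ?B = "(\<lambda>x. x + a) ` B" and ?I = "{Sup A + Inf B - e/2 .. Sup A + Inf B + e/2}"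
    have [measurable]: "?A \<in> sets borel" "?B \<in> sets borel" by (auto intro!: shift)
    have "?A \<subseteq> D" using mid b(1) by (auto simp: D_def)
    moreover have "?B \<subseteq> D" using mid[OF a(1)] by (auto simp: D_def add.commute[of _ a])
    ultimately have sub: "?A \<union> ?B \<subseteq> D" by auto
    have int: "?A \<inter> ?B \<subseteq> ?I"
    proof
      fix x assume "x \<in> ?A \<inter> ?B"
      then obtain u v where uv: "x = u + b" "u \<in> A" "x = v + a" "v \<in> B" by (elim IntE imageE) blast
      have "u \<le> Sup A" using bA uv by (simp add: cSup_upper)
      moreover have "Inf B \<le> v" using bB uv by (simp add: cInf_lower)
      ultimately show "x \<in> ?I" using uv a b e by auto
    qed
    have "emeasure lborel A + emeasure lborel B = emeasure lborel ?A + emeasure lborel ?B"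
      by (simp add: shift)
    also have "\<dots> \<le> emeasure lborel ((?A - ?I) \<union> ?B) + emeasure lborel ?I"
    proof -
      have "emeasure lborel ?A \<le> emeasure lborel ((?A - ?I) \<union> ?I)"
        by (intro emeasure_mono) auto
      also have "\<dots> \<le> emeasure lborel (?A - ?I) + emeasure lborel ?I"
        by (intro emeasure_subadditive) auto
      finally have "emeasure lborel ?A + emeasure lborel ?B
        \<le> (emeasure lborel (?A - ?I) + emeasure lborel ?B) + emeasure lborel ?I"
        by (simp add: add_ac add_mono)
      also have "emeasure lborel (?A - ?I) + emeasure lborel ?B = emeasure lborel ((?A - ?I) \<union> ?B)"
        using int by (intro plus_emeasure) auto
      finally show ?thesis .
    qed
    also have "\<dots> \<le> emeasure lborel D + emeasure lborel ?I"
      using sub by (intro add_mono emeasure_mono) auto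
    also have "emeasure lborel ?I = ennreal e" using e by simp
    finally show "emeasure lborel A + emeasure lborel B \<le> 2 * emeasure lborel C + ennreal e"
      by (simp add: D)
  qed
qed

lemma emeasure_midpoint:
  assumes [measurable]: "A \<in> sets borel" "B \<in> sets borel" "C \<in> sets borel"
    and ne: "A \<noteq> {}" "B \<noteq> {}"
    and mid: "\<And>x y::real. x \<in> A \<Longrightarrow> y \<in> B \<Longrightarrow> (x + y) / 2 \<in> C"
  shows "emeasure lborel A + emeasure lborel B \<le> 2 * emeasure lborel C"
proof -
  obtain a b where ab: "a \<in> A" "b \<in> B" using ne by auto
  \<comment> \<open>The offset puts the two chosen points into every truncation, so that the
    truncated sets are non-empty from the first index on.\<close>
  define N0 where "N0 = nat \<lceil>max \<bar>a\<bar> \<bar>b\<bar>\<rceil>"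
  have N0: "\<bar>a\<bar> \<le> real N0" "\<bar>b\<bar> \<le> real N0" unfolding N0_def by linarith+
  let ?T = "\<lambda>X n. X \<inter> {-real (n + N0)..real (n + N0)}"
  have lim: "(\<lambda>n. emeasure lborel (?T X n)) \<longlonglongrightarrow> emeasure lborel X" if [measurable]: "X \<in> sets borel" for X
  proof -
    have "(\<lambda>n. emeasure lborel (?T X n)) \<longlonglongrightarrow> emeasure lborel (\<Union>n. ?T X n)"
      by (intro Lim_emeasure_incseq) (auto simp: incseq_def)
    moreover have "(\<Union>n. ?T X n) = X"
    proof -
      have "\<exists>n. - real (n + N0) \<le> x \<and> x \<le> real (n + N0)" for x
        by (rule exI[of _ "nat \<lceil>\<bar>x\<bar>\<rceil>"]) linarith
      then show ?thesis by auto
    qed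
    ultimately show ?thesis by simp
  qed
  have "emeasure lborel (?T A n) + emeasure lborel (?T B n) \<le> 2 * emeasure lborel C" for n
  proof (rule emeasure_midpoint_bounded[where N = "real (n + N0)"])
    have "a \<in> ?T A n" "b \<in> ?T B n" using ab N0 by auto
    then show "?T A n \<noteq> {}" "?T B n \<noteq> {}" by blast+
  qed (use mid in auto)
  moreover have "(\<lambda>n. emeasure lborel (?T A n) + emeasure lborel (?T B n))
      \<longlonglongrightarrow> emeasure lborel A + emeasure lborel B"
    by (intro tendsto_add lim) measurable
  ultimately show ?thesis by (intro LIMSEQ_le_const2) auto
qed

text \<open>Levels are parametrised by the fraction \<open>t\<close> of the bound \<open>a\<close>,
  not by the level itself, so that level sets of different functions can be compared at equal
  fractions of their suprema.\<close>

lemma nn_integral_layer: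
  fixes u :: "real \<Rightarrow> real"
  assumes [measurable]: "u \<in> borel_measurable borel" and a: "0 < a"
    and u: "\<And>x. 0 \<le> u x" "\<And>x. u x \<le> a"
  shows "(\<integral>\<^sup>+x. ennreal (u x) \<partial>lborel) =
    ennreal a * (\<integral>\<^sup>+t. indicator {0<..<1} t * emeasure lborel {x. a * t < u x} \<partial>lborel)"
proof -
  have "ennreal (u x) = (\<integral>\<^sup>+t. ennreal a * (indicator {0<..<1} t * indicator {x. a * t < u x} x) \<partial>lborel)" for x
  proof -
    have "(\<integral>\<^sup>+t. ennreal a * (indicator {0<..<1} t * indicator {x. a * t < u x} x) \<partial>lborel)
      = ennreal a * (\<integral>\<^sup>+t. indicator {0<..<u x / a} t \<partial>lborel)"
    proof (subst nn_integral_cmult)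
      show "ennreal a * (\<integral>\<^sup>+t. indicator {0<..<1} t * indicator {x. a * t < u x} x \<partial>lborel)
        = ennreal a * (\<integral>\<^sup>+t. indicator {0<..<u x / a} t \<partial>lborel)"
      proof (intro arg_cong[where f = "(*) (ennreal a)"] nn_integral_cong)
        fix t :: real
        have "a * t < u x \<longleftrightarrow> t < u x / a" using a by (simp add: field_simps)
        moreover have "t < u x / a \<Longrightarrow> t < 1" using a u(2)[of x] by (simp add: field_simps) (smt (verit) mult_less_cancel_left2)
        ultimately show "indicator {0<..<1} t * indicator {x. a * t < u x} x = (indicator {0<..<u x / a} t :: ennreal)"
          by (auto simp: indicator_def)
      qed
    qed measurable
    also have "\<dots> = ennreal a * ennreal (u x / a)" using u(1)[of x] a by simp
    also have "\<dots> = ennreal (u x)" using u(1)[of x] a by (simp add: ennreal_mult[symmetric])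
    finally show ?thesis by simp
  qed
  then have "(\<integral>\<^sup>+x. ennreal (u x) \<partial>lborel) =
     (\<integral>\<^sup>+x. \<integral>\<^sup>+t. ennreal a * (indicator {0<..<1} t * indicator {x. a * t < u x} x) \<partial>lborel \<partial>lborel)"
    by simp
  also have "\<dots> = (\<integral>\<^sup>+t. \<integral>\<^sup>+x. ennreal a * (indicator {0<..<1} t * indicator {x. a * t < u x} x) \<partial>lborel \<partial>lborel)"
    by (intro lborel_pair.Fubini') measurable
  also have "\<dots> = (\<integral>\<^sup>+t. ennreal a * (indicator {0<..<1} t * emeasure lborel {x. a * t < u x}) \<partial>lborel)"
    by (intro nn_integral_cong) (simp add: nn_integral_cmult)
  also have "\<dots> = ennreal a * (\<integral>\<^sup>+t. indicator {0<..<1} t * emeasure lborel {x. a * t < u x} \<partial>lborel)"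
    by (intro nn_integral_cmult) measurable
  finally show ?thesis .
qed

text \<open>At equal fractions \<open>t < 1\<close> of the suprema \<open>a\<close> and
  \<open>b\<close> both level sets are non-empty, which the midpoint bound requires. Their midpoints
  lie in the level set of \<open>w\<close> at the same fraction of the geometric mean
  \<open>c\<close>, and the resulting additive bound becomes multiplicative by the
  arithmetic-geometric mean inequality.\<close>

lemma prekopa_leindler_bounded:
  fixes u v w :: "real \<Rightarrow> real"
  assumes [measurable]: "u \<in> borel_measurable borel" "v \<in> borel_measurable borel" "w \<in> borel_measurable borel"
    and nn: "\<And>x. 0 \<le> u x" "\<And>x. 0 \<le> v x" "\<And>x. 0 \<le> w x"
    and bd: "\<And>x. u x \<le> N" "\<And>x. v x \<le> N"
    and mid: "\<And>x y. u x * v y \<le> (w ((x + y) / 2))^2"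
  shows "(\<integral>\<^sup>+x. u x \<partial>lborel) * (\<integral>\<^sup>+x. v x \<partial>lborel) \<le> (\<integral>\<^sup>+x. w x \<partial>lborel)^2"
proof -
  define a b where "a = (SUP x. u x)" and "b = (SUP x. v x)"
  have bu: "bdd_above (range u)" "bdd_above (range v)" using bd by (auto intro!: bdd_aboveI)
  have ua: "u x \<le> a" "v x \<le> b" for x unfolding a_def b_def using bu by (auto intro: cSUP_upper)
  show ?thesis
  proof (cases "0 < a \<and> 0 < b")
    case False
    then have "(\<forall>x. u x = 0) \<or> (\<forall>x. v x = 0)" using ua nn by (meson antisym not_less order_trans)
    then show ?thesis by auto
  next
    case True
    then have a: "0 < a" and b: "0 < b" by auto
    define c where "c = sqrt (a * b)"
    have c: "0 < c" "c^2 = a * b" using a b by (auto simp: c_def)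
    let ?J = "\<lambda>f a. \<integral>\<^sup>+t. indicator {0<..<1} t * emeasure lborel {x. a * t < (f x :: real)} \<partial>lborel"
    have J: "?J u a + ?J v b \<le> 2 * ?J w c"
    proof -
      have "?J u a + ?J v b = (\<integral>\<^sup>+t. indicator {0<..<1} t *
          (emeasure lborel {x. a * t < u x} + emeasure lborel {x. b * t < v x}) \<partial>lborel)"
        by (subst nn_integral_add[symmetric]) (auto simp: distrib_left)
      also have "\<dots> \<le> (\<integral>\<^sup>+t. indicator {0<..<1} t * (2 * emeasure lborel {x. c * t < w x}) \<partial>lborel)"
      proof (intro nn_integral_mono)
        fix t :: real
        show "indicator {0<..<1} t * (emeasure lborel {x. a * t < u x} + emeasure lborel {x. b * t < v x})
          \<le> indicator {0<..<1} t * (2 * emeasure lborel {x. c * t < w x})"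
        proof (cases "0 < t \<and> t < 1")
          case True
          have "a * t < a" "b * t < b" using True a b by auto
          then have ne: "{x. a * t < u x} \<noteq> {}" "{x. b * t < v x} \<noteq> {}"
            using less_cSUP_iff[OF _ bu(1), of "a * t"] less_cSUP_iff[OF _ bu(2), of "b * t"]
            by (auto simp: a_def b_def)
          have "emeasure lborel {x. a * t < u x} + emeasure lborel {x. b * t < v x} \<le> 2 * emeasure lborel {x. c * t < w x}"
          proof (rule emeasure_midpoint[OF _ _ _ ne])
            fix x y assume "x \<in> {x. a * t < u x}" "y \<in> {x. b * t < v x}"
            then have "0 < u x" "0 < v y" "a * t < u x" "b * t < v y"
              using a b True by (auto intro: less_trans[OF mult_pos_pos])
            then have "(a * t) * (b * t) < u x * v y"
              using a b True nn(1)[of x] by (intro mult_strict_mono) auto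
            also have "\<dots> \<le> (w ((x + y) / 2))^2" by (rule mid)
            finally have "(c * t)^2 < (w ((x + y) / 2))^2" using c(2) by (simp add: power_mult_distrib) (simp add: power2_eq_square mult_ac)
            then show "(x + y) / 2 \<in> {x. c * t < w x}" using nn(3) power_less_imp_less_base by blast
          qed measurable
          then show ?thesis using True by simp
        qed simp
      qed
      also have "\<dots> = 2 * ?J w c"
        by (subst nn_integral_cmult[symmetric]) (auto simp: mult_ac)
      finally show ?thesis .
    qed
    \<comment> \<open>\<open>w\<close> may exceed \<open>c\<close>, but only its levels below
      \<open>c\<close> occur, and truncation at \<open>c\<close> leaves these unchanged.\<close>
    have wc: "ennreal c * ?J w c \<le> (\<integral>\<^sup>+x. w x \<partial>lborel)"
    proof -
      have "(\<integral>\<^sup>+x. ennreal (min c (w x)) \<partial>lborel) = ennreal c * ?J (\<lambda>x. min c (w x)) c"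
        using c nn by (intro nn_integral_layer) auto
      also have "?J (\<lambda>x. min c (w x)) c = ?J w c"
      proof (intro nn_integral_cong)
        fix t :: real
        have "0 < t \<and> t < 1 \<Longrightarrow> {x. c * t < min c (w x)} = {x. c * t < w x}" using c by auto
        then show "indicator {0<..<1} t * emeasure lborel {x. c * t < min c (w x)}
          = indicator {0<..<1} t * emeasure lborel {x. c * t < w x}"
          by (cases "0 < t \<and> t < 1") auto
      qed
      finally show ?thesis by (metis (no_types, lifting) ennreal_leI min.cobounded2 nn_integral_mono)
    qed
    have "(\<integral>\<^sup>+x. u x \<partial>lborel) * (\<integral>\<^sup>+x. v x \<partial>lborel) = ennreal a * ennreal b * (?J u a * ?J v b)"
      unfolding nn_integral_layer[OF assms(1) a nn(1) ua(1)] nn_integral_layer[OF assms(2) b nn(2) ua(2)]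
      by (simp only: mult_ac)
    also have "ennreal a * ennreal b = (ennreal c)^2"
      using a b c by (simp add: ennreal_mult[symmetric] ennreal_power)
    also have "?J u a * ?J v b \<le> (?J w c)^2"
    proof -
      have "4 * (?J u a * ?J v b) \<le> (2 * ?J w c)^2"
        using ennreal_amgm J by (meson order_trans power_mono zero_le)
      also have "\<dots> = 4 * (?J w c)^2" by (simp add: power_mult_distrib)
      finally show ?thesis
        by (subst (asm) ennreal_mult_le_mult_iff) auto
    qed
    then have "(ennreal c)^2 * (?J u a * ?J v b) \<le> (ennreal c * ?J w c)^2"
      by (simp add: power_mult_distrib mult_left_mono)
    also have "\<dots> \<le> (\<integral>\<^sup>+x. w x \<partial>lborel)^2" using wc by (intro power_mono) auto
    finally show ?thesis .
  qed
qed

text \<open>Truncating all three functions at the same \<open>n\<close> preserves the hypothesis: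
  where \<open>w\<close> is cut down to \<open>n\<close>, both factors on the left are at most
  \<open>n\<close>. The values are extended because the induction over the dimension inserts inner
  integrals that may be infinite.\<close>

lemma prekopa_leindler_1:
  fixes u v w :: "real \<Rightarrow> ennreal"
  assumes [measurable]: "u \<in> borel_measurable borel" "v \<in> borel_measurable borel" "w \<in> borel_measurable borel"
    and mid: "\<And>x y. u x * v y \<le> (w ((x + y) / 2))^2"
  shows "(\<integral>\<^sup>+x. u x \<partial>lborel) * (\<integral>\<^sup>+x. v x \<partial>lborel) \<le> (\<integral>\<^sup>+x. w x \<partial>lborel)^2"
proof -
  let ?T = "\<lambda>f n x. min (f x) (of_nat n) :: ennreal"
  have lim: "(\<lambda>n. \<integral>\<^sup>+x. ?T f n x \<partial>lborel) \<longlonglongrightarrow> (\<integral>\<^sup>+x. f x \<partial>lborel)"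
    if [measurable]: "f \<in> borel_measurable borel" for f :: "real \<Rightarrow> ennreal"
  proof (rule nn_integral_LIMSEQ)
    show "incseq (?T f)" by (auto simp: incseq_def le_fun_def min_le_iff_disj intro: order_trans)
    fix x
    have "(\<lambda>n. min (f x) (of_nat n)) \<longlonglongrightarrow> min (f x) top"
      by (intro tendsto_min tendsto_const of_nat_tendsto_top_ennreal)
    then show "(\<lambda>n. ?T f n x) \<longlonglongrightarrow> f x" by simp
  qed measurable
  have b: "(\<integral>\<^sup>+x. ?T u n x \<partial>lborel) * (\<integral>\<^sup>+x. ?T v n x \<partial>lborel) \<le> (\<integral>\<^sup>+x. w x \<partial>lborel)^2" for n
  proof -
    let ?r = "\<lambda>f x. enn2real (?T f n x)"
    have fin: "?T f n x < top" for f and x :: real by (simp add: min_less_iff_disj of_nat_less_top)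
    have r: "ennreal (?r f x) = ?T f n x" for f and x :: real using fin[of f x] by simp
    have "(\<integral>\<^sup>+x. ?r u x \<partial>lborel) * (\<integral>\<^sup>+x. ?r v x \<partial>lborel) \<le> (\<integral>\<^sup>+x. ?r w x \<partial>lborel)^2"
    proof (rule prekopa_leindler_bounded[where N = "real n"])
      fix x y
      show "?r u x \<le> real n" "?r v x \<le> real n"
        by (rule enn2real_leI; simp add: ennreal_of_nat_eq_real_of_nat[symmetric])+
      have "?T u n x * ?T v n y \<le> (?T w n ((x + y) / 2))^2"
      proof (cases "w ((x + y) / 2) \<le> of_nat n")
        case True
        then have "?T w n ((x + y) / 2) = w ((x + y) / 2)" by simp
        moreover have "?T u n x * ?T v n y \<le> u x * v y" by (intro mult_mono) auto
        ultimately show ?thesis using mid[of x y] by simp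
      next
        case False
        then have "?T w n ((x + y) / 2) = of_nat n" by simp
        moreover have "?T u n x * ?T v n y \<le> of_nat n * of_nat n" by (intro mult_mono) auto
        ultimately show ?thesis by (simp only: power2_eq_square)
      qed
      then have "ennreal (?r u x) * ennreal (?r v y) \<le> (ennreal (?r w ((x + y) / 2)))^2" by (simp only: r)
      then show "?r u x * ?r v y \<le> (?r w ((x + y) / 2))^2"
        by (simp add: ennreal_mult[symmetric] ennreal_power del: ennreal_enn2real_if)
    qed auto
    then have "(\<integral>\<^sup>+x. ?T u n x \<partial>lborel) * (\<integral>\<^sup>+x. ?T v n x \<partial>lborel) \<le> (\<integral>\<^sup>+x. ?T w n x \<partial>lborel)^2"
      by (simp only: r)
    also have "\<dots> \<le> (\<integral>\<^sup>+x. w x \<partial>lborel)^2" by (intro power_mono nn_integral_mono) auto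
    finally show ?thesis .
  qed
  show ?thesis
  \<comment> \<open>Multiplication in \<open>ennreal\<close> is discontinuous at zero times
    infinity, so passing to the limit in the product needs both limits nonzero; otherwise the
    left-hand side is 0.\<close>
  proof (cases "(\<integral>\<^sup>+x. u x \<partial>lborel) = 0 \<or> (\<integral>\<^sup>+x. v x \<partial>lborel) = 0")
    case False
    then have "(\<lambda>n. (\<integral>\<^sup>+x. ?T u n x \<partial>lborel) * (\<integral>\<^sup>+x. ?T v n x \<partial>lborel)) \<longlonglongrightarrow>
       (\<integral>\<^sup>+x. u x \<partial>lborel) * (\<integral>\<^sup>+x. v x \<partial>lborel)"
      by (intro tendsto_mult_ennreal lim) auto
    then show ?thesis using b by (intro LIMSEQ_le_const2) auto
  qed auto
qed

text \<open>Tensorisation: for fixed values \<open>s\<close> and \<open>t\<close> of the new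
  coordinate, the induction hypothesis for the sections is exactly the one-dimensional hypothesis
  for the functions obtained by integrating the sections.\<close>

lemma prekopa_leindler:
  fixes u v w :: "('i \<Rightarrow> real) \<Rightarrow> ennreal"
  assumes "finite I"
    and "u \<in> borel_measurable (PiM I (\<lambda>_. lborel))" "v \<in> borel_measurable (PiM I (\<lambda>_. lborel))"
      "w \<in> borel_measurable (PiM I (\<lambda>_. lborel))"
    and "\<And>x y. x \<in> extensional I \<Longrightarrow> y \<in> extensional I \<Longrightarrow> u x * v y \<le> (w (\<lambda>i\<in>I. (x i + y i) / 2))^2"
  shows "(\<integral>\<^sup>+x. u x \<partial>PiM I (\<lambda>_. lborel)) * (\<integral>\<^sup>+x. v x \<partial>PiM I (\<lambda>_. lborel))
    \<le> (\<integral>\<^sup>+x. w x \<partial>PiM I (\<lambda>_. lborel))^2"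
  using assms
proof (induction I arbitrary: u v w rule: finite_induct)
  case empty
  have "(\<lambda>i\<in>{}. (undefined i + undefined i) / 2) = (\<lambda>x::'i. undefined :: real)" by auto
  with empty(4)[of "\<lambda>_. undefined" "\<lambda>_. undefined"] show ?case
    by (simp add: PiM_empty nn_integral_count_space_finite restrict_def)
next
  case (insert i I)
  interpret product_sigma_finite "\<lambda>_::'i. lborel :: real measure" ..
  let ?P = "PiM I (\<lambda>_. lborel :: real measure)"
  have m [measurable]: "(\<lambda>(s, x). f (x(i := s))) \<in> borel_measurable (lborel \<Otimes>\<^sub>M ?P)"
    if "f \<in> borel_measurable (PiM (insert i I) (\<lambda>_. lborel))" for f :: "('i \<Rightarrow> real) \<Rightarrow> ennreal"
  proof -
    have "(\<lambda>(s, x). x(i := s)) \<in> lborel \<Otimes>\<^sub>M ?P \<rightarrow>\<^sub>M PiM (insert i I) (\<lambda>_. lborel :: real measure)"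
      unfolding split_beta by (rule measurable_fun_upd[where J = I]) auto
    from measurable_compose[OF this that] show ?thesis by (simp add: split_beta)
  qed
  interpret P: sigma_finite_measure ?P using insert by (intro sigma_finite) auto
  have m2: "(\<lambda>s::real. \<integral>\<^sup>+x. f (x(i := s)) \<partial>?P) \<in> borel_measurable borel"
    if "f \<in> borel_measurable (PiM (insert i I) (\<lambda>_. lborel))" for f :: "('i \<Rightarrow> real) \<Rightarrow> ennreal"
    using P.borel_measurable_nn_integral[OF m[OF that]] by simp
  have m3: "(\<lambda>x. f (x(i := s))) \<in> borel_measurable ?P"
    if "f \<in> borel_measurable (PiM (insert i I) (\<lambda>_. lborel))" for f :: "('i \<Rightarrow> real) \<Rightarrow> ennreal" and s :: real
    using measurable_compose[OF measurable_Pair1'[of s] m[OF that]] by simp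
  have "(\<integral>\<^sup>+(s::real). (\<integral>\<^sup>+x. u (x(i := s)) \<partial>?P) \<partial>lborel) * (\<integral>\<^sup>+(s::real). (\<integral>\<^sup>+x. v (x(i := s)) \<partial>?P) \<partial>lborel)
    \<le> (\<integral>\<^sup>+(s::real). (\<integral>\<^sup>+x. w (x(i := s)) \<partial>?P) \<partial>lborel)^2"
  proof (rule prekopa_leindler_1)
    fix s t :: real
    show "(\<integral>\<^sup>+x. u (x(i := s)) \<partial>?P) * (\<integral>\<^sup>+x. v (x(i := t)) \<partial>?P) \<le> (\<integral>\<^sup>+x. w (x(i := (s + t) / 2)) \<partial>?P)^2"
    proof (rule insert.IH)
      fix x y :: "'i \<Rightarrow> real" assume xy: "x \<in> extensional I" "y \<in> extensional I"
      have "u (x(i := s)) * v (y(i := t)) \<le> (w (\<lambda>j\<in>insert i I. ((x(i := s)) j + (y(i := t)) j) / 2))^2"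
        using xy by (intro insert.prems) (auto simp: extensional_def)
      also have "(\<lambda>j\<in>insert i I. ((x(i := s)) j + (y(i := t)) j) / 2) = (\<lambda>j\<in>I. (x j + y j) / 2)(i := (s + t) / 2)"
        using insert.hyps by (auto simp: fun_eq_iff restrict_def)
      finally show "u (x(i := s)) * v (y(i := t)) \<le> (w ((\<lambda>j\<in>I. (x j + y j) / 2)(i := (s + t) / 2)))^2" .
    qed (intro m3 insert.prems)+
  qed (intro m2 insert.prems)+
  then show ?case
    using insert by (simp add: product_nn_integral_insert_rev)
qed

section \<open>Reversible kernels\<close>

text \<open>A \<open>measure_of\<close> takes the prescribed values only if these form a measure.
  Finite weighted sums of measures do, and this covers both kernels that are built in this way:
  accepted proposals plus an atom for Metropolis, and the sum over coordinates for the random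
  scan.\<close>

lemma
  assumes fin: "finite I" and sets: "\<And>i. i \<in> I \<Longrightarrow> sets (N i) = sets M"
    and F: "\<And>A. A \<in> sets M \<Longrightarrow> F A = (\<Sum>i\<in>I. c i * emeasure (N i) A)"
  shows emeasure_mixture: "A \<in> sets M \<Longrightarrow> emeasure (measure_of (space M) (sets M) F) A = (\<Sum>i\<in>I. c i * emeasure (N i) A)"
    and nn_integral_mixture: "f \<in> borel_measurable M \<Longrightarrow>
      (\<integral>\<^sup>+x. f x \<partial>measure_of (space M) (sets M) F) = (\<Sum>i\<in>I. c i * (\<integral>\<^sup>+x. f x \<partial>N i))"
proof -
  let ?M = "measure_of (space M) (sets M) F"
  show em: "emeasure ?M A = (\<Sum>i\<in>I. c i * emeasure (N i) A)" if A: "A \<in> sets M" for A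
  proof -
    have "emeasure ?M A = F A"
    proof (rule emeasure_measure_of)
      show "positive (sets ?M) F" using F by (auto simp: positive_def sets.sets_measure_of_eq)
      show "countably_additive (sets ?M) F"
      proof (rule countably_additiveI)
        fix B :: "nat \<Rightarrow> _" assume B: "range B \<subseteq> sets ?M" "disjoint_family B" "(\<Union>i. B i) \<in> sets ?M"
        then have B': "range B \<subseteq> sets M" "(\<Union>i. B i) \<in> sets M" by (auto simp: sets.sets_measure_of_eq)
        then have Bi: "B j \<in> sets M" for j by auto
        have "(\<Sum>j. F (B j)) = (\<Sum>j. \<Sum>i\<in>I. c i * emeasure (N i) (B j))"
          using F Bi by simp
        also have "\<dots> = (\<Sum>i\<in>I. \<Sum>j. c i * emeasure (N i) (B j))"
          by (rule suminf_sum) auto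
        also have "\<dots> = (\<Sum>i\<in>I. c i * emeasure (N i) (\<Union>j. B j))"
        proof (rule sum.cong)
          fix i assume i: "i \<in> I"
          have "(\<Sum>j. emeasure (N i) (B j)) = emeasure (N i) (\<Union>j. B j)"
            using B B' sets[OF i] by (intro suminf_emeasure) auto
          then show "(\<Sum>j. c i * emeasure (N i) (B j)) = c i * emeasure (N i) (\<Union>j. B j)"
            by simp
        qed simp
        finally show "(\<Sum>j. F (B j)) = F (\<Union>j. B j)" using F B' by simp
      qed
    qed (use A sets.sets_into_space in \<open>auto simp: sets.sets_measure_of_eq\<close>)
    then show ?thesis using F A by simp
  qed
  show "(\<integral>\<^sup>+x. f x \<partial>?M) = (\<Sum>i\<in>I. c i * (\<integral>\<^sup>+x. f x \<partial>N i))" if "f \<in> borel_measurable M"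
    using that
  proof (induction rule: borel_measurable_induct)
    case (cong f g)
    have "(\<integral>\<^sup>+x. f x \<partial>?M) = (\<integral>\<^sup>+x. g x \<partial>?M)" using cong by (intro nn_integral_cong) auto
    moreover have "(\<integral>\<^sup>+x. f x \<partial>N i) = (\<integral>\<^sup>+x. g x \<partial>N i)" if "i \<in> I" for i
      using cong sets_eq_imp_space_eq[OF sets[OF that]] by (intro nn_integral_cong) auto
    ultimately show ?case using cong by simp
  next
    case (set A) then show ?case using em sets by (simp add: sets.sets_measure_of_eq)
  next
    case (mult u k)
    note m = measurable_cong_sets[OF sets refl] measurable_cong_sets[OF sets.sets_measure_of_eq refl, of M]
    show ?case using mult
      by (simp add: nn_integral_cmult m sum_distrib_left mult_ac)
  next
    case (add u v)
    note m = measurable_cong_sets[OF sets refl] measurable_cong_sets[OF sets.sets_measure_of_eq refl, of M]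
    show ?case using add
      by (simp add: nn_integral_add m distrib_left sum.distrib)
  next
    case (seq U)
    note m = measurable_cong_sets[OF sets refl] measurable_cong_sets[OF sets.sets_measure_of_eq refl, of M]
    have U: "(SUP i. U i) = (\<lambda>x. SUP i. U i x)" by (auto simp: fun_eq_iff image_image)
    have mono: "incseq (\<lambda>j. c i * (\<integral>\<^sup>+x. U j x \<partial>N i))" for i
      using \<open>incseq U\<close> by (auto simp: incseq_def le_fun_def intro!: mult_left_mono nn_integral_mono)
    have "(\<integral>\<^sup>+x. (SUP i. U i x) \<partial>?M) = (SUP j. \<Sum>i\<in>I. c i * (\<integral>\<^sup>+x. U j x \<partial>N i))"
      using seq by (subst nn_integral_monotone_convergence_SUP) (auto simp: m)
    also have "\<dots> = (\<Sum>i\<in>I. SUP j. c i * (\<integral>\<^sup>+x. U j x \<partial>N i))"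
      by (rule ennreal_SUP_sum[OF mono])
    also have "\<dots> = (\<Sum>i\<in>I. c i * (\<integral>\<^sup>+x. (SUP j. U j x) \<partial>N i))"
      using seq by (intro sum.cong refl, subst nn_integral_monotone_convergence_SUP)
        (auto simp: m SUP_mult_left_ennreal)
    finally show ?case unfolding U .
  qed
qed

lemma prob_algebra_kernelD:
  assumes "K \<in> M \<rightarrow>\<^sub>M prob_algebra N" "x \<in> space M"
  shows "prob_space (K x)" "sets (K x) = sets N" "space (K x) = space N"
proof -
  show "prob_space (K x)" and s: "sets (K x) = sets N"
    using measurable_space[OF assms] by (auto simp: space_prob_algebra)
  show "space (K x) = space N" by (rule sets_eq_imp_space_eq[OF s])
qed

text \<open>The Bochner integral is rewritten as a difference of two nonnegative integrals where the
  absolute integral is finite, and as 0 elsewhere. The 0 is the value that the integral of a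
  non-integrable function has by default, so no exceptional set has to be removed.\<close>

lemma measurable_kernel_integral:
  fixes F :: "'a \<Rightarrow> 'b \<Rightarrow> real"
  assumes K: "K \<in> M \<rightarrow>\<^sub>M prob_algebra N"
    and F [measurable]: "(\<lambda>(x, y). F x y) \<in> borel_measurable (M \<Otimes>\<^sub>M N)"
  shows "(\<lambda>x. \<integral>y. F x y \<partial>K x) \<in> borel_measurable M"
proof -
  note Ks = measurable_prob_algebraD[OF K]
  have mF: "F x \<in> borel_measurable (K x)" if "x \<in> space M" for x
  proof -
    have "F x \<in> borel_measurable N" using measurable_compose[OF measurable_Pair1'[OF that] F] by simp
    then show ?thesis using prob_algebra_kernelD(2)[OF K that] by (simp cong: measurable_cong_sets)
  qed
  have m: "(\<lambda>x. \<integral>\<^sup>+y. ennreal (h (F x y)) \<partial>K x) \<in> borel_measurable M"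
    if [measurable]: "h \<in> borel_measurable borel" for h
    by (rule nn_integral_measurable_subprob_algebra2[OF _ Ks]) measurable
  have "(\<lambda>x. if (\<integral>\<^sup>+y. ennreal \<bar>F x y\<bar> \<partial>K x) < \<infinity>
      then enn2real (\<integral>\<^sup>+y. ennreal (F x y) \<partial>K x) - enn2real (\<integral>\<^sup>+y. ennreal (- F x y) \<partial>K x) else 0)
    \<in> borel_measurable M"
    using m[of abs] m[of "\<lambda>x. x"] m[of uminus] by measurable
  also have "?this \<longleftrightarrow> ?thesis"
  proof (rule measurable_cong)
    fix x assume x: "x \<in> space M"
    show "(if (\<integral>\<^sup>+y. ennreal \<bar>F x y\<bar> \<partial>K x) < \<infinity>
      then enn2real (\<integral>\<^sup>+y. ennreal (F x y) \<partial>K x) - enn2real (\<integral>\<^sup>+y. ennreal (- F x y) \<partial>K x) else 0)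
      = (\<integral>y. F x y \<partial>K x)"
      using mF[OF x]
      by (auto simp: real_lebesgue_integral_def integrable_iff_bounded not_integrable_integral_eq)
  qed
  finally show ?thesis .
qed

lemma abs_mult_le_squares: "\<bar>a * b\<bar> \<le> a\<^sup>2 + b\<^sup>2" for a b :: real
  using sum_squares_bound[of "\<bar>a\<bar>" "\<bar>b\<bar>"] mult_nonneg_nonneg[of "\<bar>a\<bar>" "\<bar>b\<bar>"]
  unfolding abs_mult power2_abs by linarith

text \<open>The third claim reduces signed iterated integrals to iterated integrals of nonnegative
  functions, the only ones about which reversibility and disintegration are stated.\<close>

lemma kernel_fubini:
  fixes F :: "'a \<Rightarrow> 'b \<Rightarrow> real"
  assumes K: "K \<in> M \<rightarrow>\<^sub>M prob_algebra N"
    and F [measurable]: "(\<lambda>(x, y). F x y) \<in> borel_measurable (M \<Otimes>\<^sub>M N)"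
    and fin: "(\<integral>\<^sup>+x. \<integral>\<^sup>+y. ennreal \<bar>F x y\<bar> \<partial>K x \<partial>M) < \<infinity>"
  shows "AE x in M. integrable (K x) (F x)"
    and "integrable M (\<lambda>x. \<integral>y. F x y \<partial>K x)"
    and "(\<integral>x. \<integral>y. F x y \<partial>K x \<partial>M) = enn2real (\<integral>\<^sup>+x. \<integral>\<^sup>+y. ennreal (F x y) \<partial>K x \<partial>M)
      - enn2real (\<integral>\<^sup>+x. \<integral>\<^sup>+y. ennreal (- F x y) \<partial>K x \<partial>M)"
proof -
  note Ks = measurable_prob_algebraD[OF K]
  have mF: "F x \<in> borel_measurable (K x)" if "x \<in> space M" for x
  proof -
    have "F x \<in> borel_measurable N" using measurable_compose[OF measurable_Pair1'[OF that] F] by simp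
    then show ?thesis using prob_algebra_kernelD(2)[OF K that] by (simp cong: measurable_cong_sets)
  qed
  have [measurable]: "(\<lambda>x. \<integral>\<^sup>+y. ennreal \<bar>F x y\<bar> \<partial>K x) \<in> borel_measurable M"
    "(\<lambda>x. \<integral>\<^sup>+y. ennreal (F x y) \<partial>K x) \<in> borel_measurable M"
    "(\<lambda>x. \<integral>\<^sup>+y. ennreal (- F x y) \<partial>K x) \<in> borel_measurable M"
    using nn_integral_measurable_subprob_algebra2[OF _ Ks, of "\<lambda>x y. ennreal \<bar>F x y\<bar>"]
      nn_integral_measurable_subprob_algebra2[OF _ Ks, of "\<lambda>x y. ennreal (F x y)"]
      nn_integral_measurable_subprob_algebra2[OF _ Ks, of "\<lambda>x y. ennreal (- F x y)"]
    by measurable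
  have "AE x in M. (\<integral>\<^sup>+y. ennreal \<bar>F x y\<bar> \<partial>K x) \<noteq> \<infinity>"
    using fin by (intro nn_integral_PInf_AE) auto
  with AE_space show ae: "AE x in M. integrable (K x) (F x)"
    by eventually_elim (simp add: integrable_iff_bounded mF less_top)
  let ?P = "\<lambda>x. \<integral>\<^sup>+y. ennreal (F x y) \<partial>K x" and ?N = "\<lambda>x. \<integral>\<^sup>+y. ennreal (- F x y) \<partial>K x"
  have le: "?P x \<le> (\<integral>\<^sup>+y. ennreal \<bar>F x y\<bar> \<partial>K x)" "?N x \<le> (\<integral>\<^sup>+y. ennreal \<bar>F x y\<bar> \<partial>K x)" for x
    by (auto intro!: nn_integral_mono ennreal_leI)
  have finPN: "(\<integral>\<^sup>+x. ?P x \<partial>M) < \<infinity>" "(\<integral>\<^sup>+x. ?N x \<partial>M) < \<infinity>"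
    using le_less_trans[OF nn_integral_mono[OF le(1)] fin] le_less_trans[OF nn_integral_mono[OF le(2)] fin]
    by simp_all
  have aePN: "AE x in M. ?P x \<noteq> \<infinity>" "AE x in M. ?N x \<noteq> \<infinity>"
    using finPN by (intro nn_integral_PInf_AE; simp)+
  have eqPN: "(\<integral>\<^sup>+x. ennreal (enn2real (?P x)) \<partial>M) = (\<integral>\<^sup>+x. ?P x \<partial>M)"
     "(\<integral>\<^sup>+x. ennreal (enn2real (?N x)) \<partial>M) = (\<integral>\<^sup>+x. ?N x \<partial>M)"
    by (rule nn_integral_cong_AE, use aePN(1) in eventually_elim, simp add: less_top)
      (rule nn_integral_cong_AE, use aePN(2) in eventually_elim, simp add: less_top)
  have intPN: "integrable M (\<lambda>x. enn2real (?P x))" "integrable M (\<lambda>x. enn2real (?N x))"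
    using finPN eqPN by (auto simp: integrable_iff_bounded)
  have val: "AE x in M. (\<integral>y. F x y \<partial>K x) = enn2real (?P x) - enn2real (?N x)"
    using ae by eventually_elim (rule real_lebesgue_integral_def)
  have meas: "(\<lambda>x. \<integral>y. F x y \<partial>K x) \<in> borel_measurable M"
    by (rule measurable_kernel_integral[OF K F])
  show "integrable M (\<lambda>x. \<integral>y. F x y \<partial>K x)"
    by (rule integrable_cong_AE_imp[OF Bochner_Integration.integrable_diff[OF intPN] meas])
      (use val in eventually_elim, simp)
  have "(\<integral>x. \<integral>y. F x y \<partial>K x \<partial>M) = (\<integral>x. enn2real (?P x) - enn2real (?N x) \<partial>M)"
    using val meas by (intro integral_cong_AE) auto
  also have "\<dots> = (\<integral>x. enn2real (?P x) \<partial>M) - (\<integral>x. enn2real (?N x) \<partial>M)"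
    using intPN by simp
  also have "(\<integral>x. enn2real (?P x) \<partial>M) = enn2real (\<integral>\<^sup>+x. ?P x \<partial>M)"
    by (subst integral_eq_nn_integral) (auto simp: eqPN)
  also have "(\<integral>x. enn2real (?N x) \<partial>M) = enn2real (\<integral>\<^sup>+x. ?N x \<partial>M)"
    by (subst integral_eq_nn_integral) (auto simp: eqPN)
  finally show "(\<integral>x. \<integral>y. F x y \<partial>K x \<partial>M) = enn2real (\<integral>\<^sup>+x. ?P x \<partial>M) - enn2real (\<integral>\<^sup>+x. ?N x \<partial>M)" .
qed

section \<open>Square-integrable functions and the operators of reversible kernels\<close>

definition square_integrable :: "'a measure \<Rightarrow> ('a \<Rightarrow> real) \<Rightarrow> bool" where
  "square_integrable M f \<longleftrightarrow> f \<in> borel_measurable M \<and> integrable M (\<lambda>x. (f x)\<^sup>2)"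

lemma square_integrable_mult:
  assumes "square_integrable M f" "square_integrable M g"
  shows "integrable M (\<lambda>x. f x * g x)"
proof (rule Bochner_Integration.integrable_bound)
  show "integrable M (\<lambda>x. (f x)\<^sup>2 + (g x)\<^sup>2)" using assms by (auto simp: square_integrable_def)
  show "AE x in M. norm (f x * g x) \<le> norm ((f x)\<^sup>2 + (g x)\<^sup>2)"
    using abs_mult_le_squares by auto
qed (use assms in \<open>auto simp: square_integrable_def\<close>)

lemma square_integrable_lincomb:
  assumes f: "square_integrable M f" and g: "square_integrable M g"
  shows "square_integrable M (\<lambda>x. a * f x + b * g x)"
proof -
  have "integrable M (\<lambda>x. a\<^sup>2 * (f x)\<^sup>2 + (2 * a * b) * (f x * g x) + b\<^sup>2 * (g x)\<^sup>2)"
    using f g square_integrable_mult[OF f g] by (auto simp: square_integrable_def)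
  then show ?thesis using f g
    by (auto simp: square_integrable_def power2_sum power_mult_distrib algebra_simps)
qed

lemma (in finite_measure) square_integrable_const: "square_integrable M (\<lambda>_. c)"
  by (simp add: square_integrable_def)

lemma (in finite_measure) square_integrable_imp_integrable: "square_integrable M f \<Longrightarrow> integrable M f"
  using square_integrable_mult[OF _ square_integrable_const[of 1], of f] by simp

lemma (in prob_space) integral_square_le:
  assumes "square_integrable M f"
  shows "(\<integral>x. f x \<partial>M)\<^sup>2 \<le> (\<integral>x. (f x)\<^sup>2 \<partial>M)"
proof -
  have "0 \<le> variance f" by (rule variance_positive)
  also have "\<dots> = (\<integral>x. (f x)\<^sup>2 \<partial>M) - (\<integral>x. f x \<partial>M)\<^sup>2"
    using assms square_integrable_imp_integrable[OF assms] by (intro variance_eq) (auto simp: square_integrable_def)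
  finally show ?thesis by simp
qed

lemma Cauchy_Schwarz_integral:
  assumes f: "square_integrable M f" and g: "square_integrable M g"
  shows "(\<integral>x. f x * g x \<partial>M)\<^sup>2 \<le> (\<integral>x. (f x)\<^sup>2 \<partial>M) * (\<integral>x. (g x)\<^sup>2 \<partial>M)"
proof -
  let ?a = "\<integral>x. (f x)\<^sup>2 \<partial>M" and ?b = "\<integral>x. f x * g x \<partial>M" and ?c = "\<integral>x. (g x)\<^sup>2 \<partial>M"
  have q: "0 \<le> s\<^sup>2 * ?a + 2 * s * t * ?b + t\<^sup>2 * ?c" for s t
  proof -
    have "0 \<le> (\<integral>x. (s * f x + t * g x)\<^sup>2 \<partial>M)" by simp
    also have "\<dots> = (\<integral>x. s\<^sup>2 * (f x)\<^sup>2 + (2 * s * t) * (f x * g x) + t\<^sup>2 * (g x)\<^sup>2 \<partial>M)"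
      by (intro Bochner_Integration.integral_cong) (auto simp: power2_eq_square algebra_simps)
    also have "\<dots> = s\<^sup>2 * ?a + 2 * s * t * ?b + t\<^sup>2 * ?c"
      using f g square_integrable_mult[OF f g] by (auto simp: square_integrable_def)
    finally show ?thesis .
  qed
  have nn: "0 \<le> ?a" "0 \<le> ?c" by auto
  show ?thesis
  proof (cases "?a = 0")
    case True
    have "?b = 0"
    proof (rule ccontr)
      assume b: "?b \<noteq> 0"
      \<comment> \<open>With \<open>?a = 0\<close> the quadratic form is affine in the first
        parameter; this parameter gives it the value -1.\<close>
      have "0 \<le> 2 * (- (?c + 1) / (2 * ?b)) * ?b + ?c" using q[of "- (?c + 1) / (2 * ?b)" 1] True by simp
      then show False using b by (simp add: field_simps)
    qed
    then show ?thesis using nn by simp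
  next
    case False
    with nn(1) have a: "0 < ?a" by linarith
    \<comment> \<open>The parameters \<open>?b\<close> and \<open>- ?a\<close> are, up to scaling,
      those that minimise the form.\<close>
    have "0 \<le> ?b\<^sup>2 * ?a + 2 * ?b * (- ?a) * ?b + (- ?a)\<^sup>2 * ?c" by (rule q)
    also have "\<dots> = ?a * (?a * ?c - ?b\<^sup>2)" by (simp add: power2_eq_square algebra_simps)
    finally show ?thesis using a by (simp add: zero_le_mult_iff)
  qed
qed

text \<open>Detailed balance is required for nonnegative functions of two variables and not only for
  rectangles; exchanging the two arguments then is a single rewriting step wherever it is
  needed.\<close>

locale reversible_kernel = prob_space M for M :: "'a measure" +
  fixes K :: "'a \<Rightarrow> 'a measure"
  assumes kernel [measurable]: "K \<in> M \<rightarrow>\<^sub>M prob_algebra M"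
    and reversible: "\<And>F. (\<lambda>(x, y). F x y) \<in> borel_measurable (M \<Otimes>\<^sub>M M) \<Longrightarrow>
      (\<integral>\<^sup>+x. \<integral>\<^sup>+y. F x y \<partial>K x \<partial>M) = (\<integral>\<^sup>+x. \<integral>\<^sup>+y. (F y x :: ennreal) \<partial>K x \<partial>M)"
begin

definition apply_kernel :: "('a \<Rightarrow> real) \<Rightarrow> 'a \<Rightarrow> real" where
  "apply_kernel f x = (\<integral>y. f y \<partial>K x)"

lemmas kernelD = prob_algebra_kernelD[OF kernel]

lemma nn_integral_kernel_const: "x \<in> space M \<Longrightarrow> (\<integral>\<^sup>+y. c \<partial>K x) = c"
  using kernelD(1) by (simp add: prob_space.emeasure_space_1)

lemma integral_kernel_const: "x \<in> space M \<Longrightarrow> (\<integral>y. (c::real) \<partial>K x) = c"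
  using prob_space.prob_space[OF kernelD(1)] by simp

lemma nn_integral_invariant:
  assumes [measurable]: "g \<in> borel_measurable M"
  shows "(\<integral>\<^sup>+x. \<integral>\<^sup>+y. g y \<partial>K x \<partial>M) = (\<integral>\<^sup>+x. g x \<partial>M)"
proof -
  have "(\<integral>\<^sup>+x. \<integral>\<^sup>+y. g y \<partial>K x \<partial>M) = (\<integral>\<^sup>+x. \<integral>\<^sup>+y. g x \<partial>K x \<partial>M)"
    using reversible[of "\<lambda>x y. g y"] by simp
  also have "\<dots> = (\<integral>\<^sup>+x. g x \<partial>M)" by (intro nn_integral_cong nn_integral_kernel_const)
  finally show ?thesis .
qed

lemma fubini_reversible:
  fixes F :: "'a \<Rightarrow> 'a \<Rightarrow> real"
  assumes F: "(\<lambda>(x, y). F x y) \<in> borel_measurable (M \<Otimes>\<^sub>M M)"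
    and fin: "(\<integral>\<^sup>+x. \<integral>\<^sup>+y. ennreal \<bar>F x y\<bar> \<partial>K x \<partial>M) < \<infinity>"
  shows "(\<integral>x. \<integral>y. F x y \<partial>K x \<partial>M) = (\<integral>x. \<integral>y. F y x \<partial>K x \<partial>M)"
proof -
  have F': "(\<lambda>(x, y). F y x) \<in> borel_measurable (M \<Otimes>\<^sub>M M)"
    using measurable_compose[OF measurable_pair_swap' F] by (simp add: split_beta')
  have e: "(\<integral>\<^sup>+x. \<integral>\<^sup>+y. ennreal (h (F x y)) \<partial>K x \<partial>M) = (\<integral>\<^sup>+x. \<integral>\<^sup>+y. ennreal (h (F y x)) \<partial>K x \<partial>M)"
    if [measurable]: "h \<in> borel_measurable borel" for h
    using F by (intro reversible) (auto simp: split_beta')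
  show ?thesis
    unfolding kernel_fubini(3)[OF kernel F fin] kernel_fubini(3)[OF kernel F' fin[unfolded e[of abs, simplified]]]
    using e[of "\<lambda>x. x"] e[of uminus] by simp
qed

lemma square_integrable_fubini:
  assumes f: "square_integrable M f" and g: "square_integrable M g"
  shows "(\<integral>\<^sup>+x. \<integral>\<^sup>+y. ennreal \<bar>f x * g y\<bar> \<partial>K x \<partial>M) < \<infinity>"
proof -
  have [measurable]: "f \<in> borel_measurable M" "g \<in> borel_measurable M"
    using f g by (auto simp: square_integrable_def)
  have fin: "(\<integral>\<^sup>+x. ennreal ((f x)\<^sup>2) \<partial>M) < \<infinity>" "(\<integral>\<^sup>+x. ennreal ((g x)\<^sup>2) \<partial>M) < \<infinity>"
    using f g by (auto simp: square_integrable_def integrable_iff_bounded)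
  have "(\<integral>\<^sup>+x. \<integral>\<^sup>+y. ennreal \<bar>f x * g y\<bar> \<partial>K x \<partial>M) \<le> (\<integral>\<^sup>+x. \<integral>\<^sup>+y. ennreal ((f x)\<^sup>2) + ennreal ((g y)\<^sup>2) \<partial>K x \<partial>M)"
    using abs_mult_le_squares by (intro nn_integral_mono) (simp add: ennreal_plus[symmetric] del: ennreal_plus)
  also have "\<dots> = (\<integral>\<^sup>+x. ennreal ((f x)\<^sup>2) + (\<integral>\<^sup>+y. ennreal ((g y)\<^sup>2) \<partial>K x) \<partial>M)"
  proof (intro nn_integral_cong)
    fix x assume x: "x \<in> space M"
    have [measurable]: "g \<in> borel_measurable (K x)" using kernelD(2)[OF x] by (simp cong: measurable_cong_sets)
    show "(\<integral>\<^sup>+y. ennreal ((f x)\<^sup>2) + ennreal ((g y)\<^sup>2) \<partial>K x) = ennreal ((f x)\<^sup>2) + (\<integral>\<^sup>+y. ennreal ((g y)\<^sup>2) \<partial>K x)"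
      using nn_integral_kernel_const[OF x, of "ennreal ((f x)\<^sup>2)"] by (subst nn_integral_add) auto
  qed
  also have "\<dots> = (\<integral>\<^sup>+x. ennreal ((f x)\<^sup>2) \<partial>M) + (\<integral>\<^sup>+x. \<integral>\<^sup>+y. ennreal ((g y)\<^sup>2) \<partial>K x \<partial>M)"
    using nn_integral_measurable_subprob_algebra2[OF _ measurable_prob_algebraD[OF kernel], of "\<lambda>x y. ennreal ((g y)\<^sup>2)"]
    by (intro nn_integral_add) auto
  also have "\<dots> < \<infinity>" using fin by (simp add: nn_integral_invariant)
  finally show ?thesis .
qed

lemma AE_square_integrable_kernel:
  assumes f: "square_integrable M f"
  shows "AE x in M. square_integrable (K x) f"
proof -
  have [measurable]: "f \<in> borel_measurable M" and fin: "(\<integral>\<^sup>+x. ennreal ((f x)\<^sup>2) \<partial>M) < \<infinity>"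
    using f by (auto simp: square_integrable_def integrable_iff_bounded)
  have "AE x in M. integrable (K x) (\<lambda>y. (f y)\<^sup>2)"
    using fin by (intro kernel_fubini(1)[OF kernel]) (auto simp: nn_integral_invariant)
  then show ?thesis
    by (rule AE_mp) (auto intro!: AE_I2 simp: square_integrable_def kernelD(2) cong: measurable_cong_sets)
qed

lemma measurable_apply_kernel:
  assumes [measurable]: "f \<in> borel_measurable M"
  shows "apply_kernel f \<in> borel_measurable M"
  unfolding apply_kernel_def
  by (rule measurable_kernel_integral[OF kernel]) measurable

text \<open>Jensen's inequality under \<open>K x\<close>, valid for almost every \<open>x\<close>,
  followed by invariance of \<open>M\<close>.\<close>

lemma
  assumes f: "square_integrable M f"
  shows square_integrable_apply_kernel: "square_integrable M (apply_kernel f)"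
    and apply_kernel_contraction: "(\<integral>x. (apply_kernel f x)\<^sup>2 \<partial>M) \<le> (\<integral>x. (f x)\<^sup>2 \<partial>M)"
proof -
  have [measurable]: "f \<in> borel_measurable M" and fin: "(\<integral>\<^sup>+x. ennreal ((f x)\<^sup>2) \<partial>M) < \<infinity>"
    using f by (auto simp: square_integrable_def integrable_iff_bounded)
  note [measurable] = measurable_apply_kernel
  have i: "integrable M (\<lambda>x. \<integral>y. (f y)\<^sup>2 \<partial>K x)"
    using fin by (intro kernel_fubini(2)[OF kernel]) (auto simp: nn_integral_invariant)
  have le: "AE x in M. (apply_kernel f x)\<^sup>2 \<le> (\<integral>y. (f y)\<^sup>2 \<partial>K x)"
    using AE_square_integrable_kernel[OF f]
    by (rule AE_mp) (auto intro!: AE_I2 prob_space.integral_square_le kernelD simp: apply_kernel_def)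
  have s: "integrable M (\<lambda>x. (apply_kernel f x)\<^sup>2)"
    by (rule Bochner_Integration.integrable_bound[OF i]) (use le in \<open>auto\<close>)
  then show "square_integrable M (apply_kernel f)" by (simp add: square_integrable_def)
  have "(\<integral>x. (apply_kernel f x)\<^sup>2 \<partial>M) \<le> (\<integral>x. \<integral>y. (f y)\<^sup>2 \<partial>K x \<partial>M)"
    using s i le by (intro integral_mono_AE)
  also have "\<dots> = (\<integral>x. \<integral>y. (f x)\<^sup>2 \<partial>K x \<partial>M)"
    using fin by (intro fubini_reversible) (auto simp: nn_integral_invariant)
  also have "\<dots> = (\<integral>x. (f x)\<^sup>2 \<partial>M)"
    by (intro Bochner_Integration.integral_cong) (auto simp: integral_kernel_const simp del: lebesgue_integral_const)
  finally show "(\<integral>x. (apply_kernel f x)\<^sup>2 \<partial>M) \<le> (\<integral>x. (f x)\<^sup>2 \<partial>M)" .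
qed

lemma integral_mult_apply_kernel:
  "(\<integral>x. \<integral>y. f x * g y \<partial>K x \<partial>M) = (\<integral>x. f x * apply_kernel g x \<partial>M)"
  by (simp add: apply_kernel_def)

lemma apply_kernel_symmetric:
  assumes f: "square_integrable M f" and g: "square_integrable M g"
  shows "(\<integral>x. f x * apply_kernel g x \<partial>M) = (\<integral>x. g x * apply_kernel f x \<partial>M)"
proof -
  have [measurable]: "f \<in> borel_measurable M" "g \<in> borel_measurable M"
    using f g by (auto simp: square_integrable_def)
  have "(\<integral>x. \<integral>y. f x * g y \<partial>K x \<partial>M) = (\<integral>x. \<integral>y. f y * g x \<partial>K x \<partial>M)"
    by (intro fubini_reversible square_integrable_fubini f g) measurable
  then show ?thesis by (simp add: integral_mult_apply_kernel[symmetric] mult.commute)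
qed

lemma integral_apply_kernel:
  assumes f: "square_integrable M f"
  shows "(\<integral>x. apply_kernel f x \<partial>M) = (\<integral>x. f x \<partial>M)"
proof -
  have "(\<integral>x. apply_kernel f x \<partial>M) = (\<integral>x. f x * apply_kernel (\<lambda>_. 1) x \<partial>M)"
    using apply_kernel_symmetric[OF square_integrable_const[of 1] f] by simp
  also have "\<dots> = (\<integral>x. f x \<partial>M)"
    by (intro Bochner_Integration.integral_cong) (auto simp: integral_kernel_const apply_kernel_def simp del: lebesgue_integral_const)
  finally show ?thesis .
qed

text \<open>Expanding the square gives two square terms with equal integrals, by invariance. The
  form on the right is the one that the gap estimate bounds from below, since it involves increments
  only.\<close>

lemma dirichlet_form:
  assumes f: "square_integrable M f"
  shows "(\<integral>x. (f x)\<^sup>2 \<partial>M) - (\<integral>x. f x * apply_kernel f x \<partial>M) = (\<integral>x. \<integral>y. (f x - f y)\<^sup>2 \<partial>K x \<partial>M) / 2"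
    and "integrable M (\<lambda>x. \<integral>y. (f x - f y)\<^sup>2 \<partial>K x)"
proof -
  have [measurable]: "f \<in> borel_measurable M" and fin: "(\<integral>\<^sup>+x. ennreal ((f x)\<^sup>2) \<partial>M) < \<infinity>"
    using f by (auto simp: square_integrable_def integrable_iff_bounded)
  have i1: "integrable M (\<lambda>x. \<integral>y. (f y)\<^sup>2 \<partial>K x)"
    using fin by (intro kernel_fubini(2)[OF kernel]) (auto simp: nn_integral_invariant)
  have i2: "integrable M (\<lambda>x. f x * apply_kernel f x)"
    using f square_integrable_apply_kernel[OF f] by (rule square_integrable_mult)
  have i3: "integrable M (\<lambda>x. (f x)\<^sup>2)" using f by (simp add: square_integrable_def)
  have e: "AE x in M. (\<integral>y. (f x - f y)\<^sup>2 \<partial>K x) = (f x)\<^sup>2 - 2 * (f x * apply_kernel f x) + (\<integral>y. (f y)\<^sup>2 \<partial>K x)"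
    using AE_square_integrable_kernel[OF f]
  proof (rule AE_mp, intro AE_I2 impI)
    fix x assume x: "x \<in> space M" and sq: "square_integrable (K x) f"
    interpret Kx: prob_space "K x" by (rule kernelD[OF x])
    have "(\<integral>y. (f x - f y)\<^sup>2 \<partial>K x) = (\<integral>y. (f x)\<^sup>2 - 2 * f x * f y + (f y)\<^sup>2 \<partial>K x)"
      by (intro Bochner_Integration.integral_cong) (auto simp: power2_diff)
    also have "\<dots> = (f x)\<^sup>2 - 2 * f x * (\<integral>y. f y \<partial>K x) + (\<integral>y. (f y)\<^sup>2 \<partial>K x)"
      using sq Kx.square_integrable_imp_integrable[OF sq] by (simp add: square_integrable_def Kx.prob_space)
    finally show "(\<integral>y. (f x - f y)\<^sup>2 \<partial>K x) = (f x)\<^sup>2 - 2 * (f x * apply_kernel f x) + (\<integral>y. (f y)\<^sup>2 \<partial>K x)"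
      by (simp add: apply_kernel_def)
  qed
  have m: "(\<lambda>x. \<integral>y. (f x - f y)\<^sup>2 \<partial>K x) \<in> borel_measurable M"
    by (rule measurable_kernel_integral[OF kernel]) measurable
  note i = Bochner_Integration.integrable_add[OF Bochner_Integration.integrable_diff[OF i3 integrable_mult_right[OF i2, of 2]] i1]
  show "integrable M (\<lambda>x. \<integral>y. (f x - f y)\<^sup>2 \<partial>K x)"
    by (rule integrable_cong_AE_imp[OF i m]) (use e in auto)
  have "(\<integral>x. \<integral>y. (f x - f y)\<^sup>2 \<partial>K x \<partial>M) =
      (\<integral>x. (f x)\<^sup>2 - 2 * (f x * apply_kernel f x) + (\<integral>y. (f y)\<^sup>2 \<partial>K x) \<partial>M)"
    using e m i by (intro integral_cong_AE) auto
  also have "\<dots> = (\<integral>x. (f x)\<^sup>2 \<partial>M) - 2 * (\<integral>x. f x * apply_kernel f x \<partial>M) + (\<integral>x. \<integral>y. (f y)\<^sup>2 \<partial>K x \<partial>M)"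
    using i1 i2 i3 by simp
  also have "(\<integral>x. \<integral>y. (f y)\<^sup>2 \<partial>K x \<partial>M) = (\<integral>x. \<integral>y. (f x)\<^sup>2 \<partial>K x \<partial>M)"
    using fin by (intro fubini_reversible) (auto simp: nn_integral_invariant)
  also have "\<dots> = (\<integral>x. (f x)\<^sup>2 \<partial>M)"
    by (intro Bochner_Integration.integral_cong) (auto simp: integral_kernel_const simp del: lebesgue_integral_const)
  finally show "(\<integral>x. (f x)\<^sup>2 \<partial>M) - (\<integral>x. f x * apply_kernel f x \<partial>M) = (\<integral>x. \<integral>y. (f x - f y)\<^sup>2 \<partial>K x \<partial>M) / 2"
    by simp
qed

lemma L2_zero_iff: "f \<in> L2_zero M \<longleftrightarrow> square_integrable M f \<and> (\<integral>x. f x \<partial>M) = 0"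
  by (auto simp: L2_zero_def square_integrable_def)

lemma kernel_norm_quotient:
  "L2_norm M (\<lambda>x. \<integral>y. f y \<partial>K x) / L2_norm M f = sqrt (\<integral>x. (apply_kernel f x)\<^sup>2 \<partial>M) / sqrt (\<integral>x. (f x)\<^sup>2 \<partial>M)"
  by (simp add: L2_norm_def apply_kernel_def)

lemma bdd_above_kernel_norm:
  "bdd_above ((\<lambda>f. L2_norm M (\<lambda>x. \<integral>y. f y \<partial>K x) / L2_norm M f) ` L2_zero M)"
proof -
  have "sqrt (\<integral>x. (apply_kernel g x)\<^sup>2 \<partial>M) / sqrt (\<integral>x. (g x)\<^sup>2 \<partial>M) \<le> 1" if "g \<in> L2_zero M" for g
      proof -
    have "sqrt (\<integral>x. (apply_kernel g x)\<^sup>2 \<partial>M) \<le> sqrt (\<integral>x. (g x)\<^sup>2 \<partial>M)"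
      using apply_kernel_contraction[of g] that by (simp add: L2_zero_iff)
    then show ?thesis by (cases "sqrt (\<integral>x. (g x)\<^sup>2 \<partial>M) = 0") (auto simp: divide_le_eq less_le)
  qed
  then show "bdd_above ((\<lambda>f. L2_norm M (\<lambda>x. \<integral>y. f y \<partial>K x) / L2_norm M f) ` L2_zero M)"
    by (intro bdd_aboveI[of _ 1]) (auto simp: kernel_norm_quotient)
qed

lemma kernel_norm_upper:
  assumes "f \<in> L2_zero M"
  shows "sqrt (\<integral>x. (apply_kernel f x)\<^sup>2 \<partial>M) \<le> kernel_norm M K * sqrt (\<integral>x. (f x)\<^sup>2 \<partial>M)"
proof -
  have f: "square_integrable M f" using assms by (simp add: L2_zero_iff)
  then have q: "sqrt (\<integral>x. (apply_kernel f x)\<^sup>2 \<partial>M) / sqrt (\<integral>x. (f x)\<^sup>2 \<partial>M) \<le> kernel_norm M K"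
    unfolding kernel_norm_def kernel_norm_quotient[symmetric] using assms bdd_above_kernel_norm by (intro cSUP_upper)
  show ?thesis
  proof (cases "(\<integral>x. (f x)\<^sup>2 \<partial>M) = 0")
    case True
    then show ?thesis using apply_kernel_contraction[OF f] by (simp add: antisym)
  next
    case False
    moreover have "0 \<le> (\<integral>x. (f x)\<^sup>2 \<partial>M)" by simp
    ultimately have "0 < (\<integral>x. (f x)\<^sup>2 \<partial>M)" by linarith
    then show ?thesis using q by (simp add: divide_le_eq)
  qed
qed

lemma rayleigh_le_kernel_norm:
  assumes "f \<in> L2_zero M"
  shows "(\<integral>x. f x * apply_kernel f x \<partial>M) \<le> kernel_norm M K * (\<integral>x. (f x)\<^sup>2 \<partial>M)"
proof -
  have f: "square_integrable M f" using assms by (simp add: L2_zero_iff)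
  have "(\<integral>x. f x * apply_kernel f x \<partial>M)\<^sup>2 \<le> (\<integral>x. (f x)\<^sup>2 \<partial>M) * (\<integral>x. (apply_kernel f x)\<^sup>2 \<partial>M)"
    by (rule Cauchy_Schwarz_integral[OF f square_integrable_apply_kernel[OF f]])
  then have "(\<integral>x. f x * apply_kernel f x \<partial>M) \<le> sqrt (\<integral>x. (f x)\<^sup>2 \<partial>M) * sqrt (\<integral>x. (apply_kernel f x)\<^sup>2 \<partial>M)"
    by (metis real_le_rsqrt real_sqrt_mult)
  also have "\<dots> \<le> sqrt (\<integral>x. (f x)\<^sup>2 \<partial>M) * (kernel_norm M K * sqrt (\<integral>x. (f x)\<^sup>2 \<partial>M))"
    using kernel_norm_upper[OF assms] by (intro mult_left_mono) auto
  also have "\<dots> = kernel_norm M K * (\<integral>x. (f x)\<^sup>2 \<partial>M)" by simp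
  finally show ?thesis .
qed

lemma kernel_norm_nonneg: "0 \<le> kernel_norm M K"
proof -
  have 0: "(\<lambda>_. 0) \<in> L2_zero M" by (simp add: L2_zero_iff square_integrable_def)
  from cSUP_upper[OF 0 bdd_above_kernel_norm] show ?thesis by (simp add: kernel_norm_def L2_norm_def)
qed

text \<open>Positivity is applied to the combinations of \<open>f\<close> and its image
  \<open>g\<close>. The mixed coefficient of the resulting quadratic form is the squared norm
  \<open>B\<close> of \<open>g\<close>, by symmetry. The parameters \<open>l\<close> and
  \<open>- 1\<close>, together with the Rayleigh bounds for \<open>f\<close> and for
  \<open>g\<close>, which is again of mean zero, give \<open>B \<le> l\<^sup>2 * D\<close>.\<close>

lemma kernel_norm_le:
  assumes l: "0 \<le> l" and pos: "\<And>f. square_integrable M f \<Longrightarrow> 0 \<le> (\<integral>x. f x * apply_kernel f x \<partial>M)"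
    and le: "\<And>f. f \<in> L2_zero M \<Longrightarrow> (\<integral>x. f x * apply_kernel f x \<partial>M) \<le> l * (\<integral>x. (f x)\<^sup>2 \<partial>M)"
  shows "kernel_norm M K \<le> l"
proof -
  have "L2_norm M (\<lambda>x. \<integral>y. f y \<partial>K x) / L2_norm M f \<le> l" if fz: "f \<in> L2_zero M" for f
  proof -
  from fz have f: "square_integrable M f" by (simp add: L2_zero_iff)
  define g where "g = apply_kernel f"
  have g: "square_integrable M g" unfolding g_def by (rule square_integrable_apply_kernel[OF f])
  have gz: "g \<in> L2_zero M" using g integral_apply_kernel[OF f] fz by (auto simp: L2_zero_iff g_def)
  define A B C where "A = (\<integral>x. f x * apply_kernel f x \<partial>M)" and "B = (\<integral>x. (g x)\<^sup>2 \<partial>M)"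
    and "C = (\<integral>x. g x * apply_kernel g x \<partial>M)"
  \<comment> \<open>Linearity holds only almost everywhere: it needs \<open>f\<close> and
    \<open>g\<close> to be integrable under \<open>K x\<close>.\<close>
  have lin: "AE x in M. apply_kernel (\<lambda>x. s * f x + t * g x) x = s * apply_kernel f x + t * apply_kernel g x" for s t
    using AE_space AE_square_integrable_kernel[OF f] AE_square_integrable_kernel[OF g]
  proof eventually_elim
    fix x assume x: "x \<in> space M" and "square_integrable (K x) f" "square_integrable (K x) g"
    then have "integrable (K x) f" "integrable (K x) g"
      using finite_measure.square_integrable_imp_integrable[OF prob_space.finite_measure[OF kernelD(1)[OF x]]] by auto
    then show "apply_kernel (\<lambda>x. s * f x + t * g x) x = s * apply_kernel f x + t * apply_kernel g x"
      by (simp add: apply_kernel_def)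
  qed
  have q: "0 \<le> s\<^sup>2 * A + 2 * s * t * B + t\<^sup>2 * C" for s t
  proof -
    have "0 \<le> (\<integral>x. (s * f x + t * g x) * apply_kernel (\<lambda>x. s * f x + t * g x) x \<partial>M)"
      by (intro pos square_integrable_lincomb f g)
    also have "\<dots> = (\<integral>x. s\<^sup>2 * (f x * apply_kernel f x) + s * t * (f x * apply_kernel g x)
        + s * t * (g x * apply_kernel f x) + t\<^sup>2 * (g x * apply_kernel g x) \<partial>M)"
    proof (intro integral_cong_AE)
      show "AE x in M. (s * f x + t * g x) * apply_kernel (\<lambda>x. s * f x + t * g x) x =
         s\<^sup>2 * (f x * apply_kernel f x) + s * t * (f x * apply_kernel g x)
        + s * t * (g x * apply_kernel f x) + t\<^sup>2 * (g x * apply_kernel g x)"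
        using lin[of s t] by eventually_elim (simp add: power2_eq_square algebra_simps)
    qed (use f g in \<open>auto simp: square_integrable_def
        intro!: measurable_apply_kernel borel_measurable_times borel_measurable_add\<close>)
    also have "\<dots> = s\<^sup>2 * A + s * t * (\<integral>x. f x * apply_kernel g x \<partial>M)
      + s * t * (\<integral>x. g x * apply_kernel f x \<partial>M) + t\<^sup>2 * C"
      using square_integrable_mult[OF f square_integrable_apply_kernel[OF f]]
        square_integrable_mult[OF f square_integrable_apply_kernel[OF g]]
        square_integrable_mult[OF g square_integrable_apply_kernel[OF f]]
        square_integrable_mult[OF g square_integrable_apply_kernel[OF g]]
      by (simp add: A_def C_def)
    also have "\<dots> = s\<^sup>2 * A + 2 * s * t * B + t\<^sup>2 * C"
      using apply_kernel_symmetric[OF f g] by (simp add: B_def g_def power2_eq_square)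
    finally show ?thesis .
  qed
  define D where "D = (\<integral>x. (f x)\<^sup>2 \<partial>M)"
  have nn: "0 \<le> B" "0 \<le> D" by (auto simp: B_def D_def)
  have C: "C \<le> l * B" using le[OF gz] by (simp add: C_def B_def)
  have A: "A \<le> l * D" using le[OF fz] by (simp add: A_def D_def)
  have "B \<le> l\<^sup>2 * D"
  proof (cases "l = 0")
    case True
    have "0 \<le> 1\<^sup>2 * A + 2 * 1 * (-1) * B + (-1)\<^sup>2 * C" by (rule q)
    then show ?thesis using A C True nn by simp
  next
    case False
    have "0 \<le> l\<^sup>2 * A + 2 * l * (-1) * B + (-1)\<^sup>2 * C" by (rule q)
    also have "\<dots> \<le> l\<^sup>2 * (l * D) - 2 * l * B + l * B"
      using mult_left_mono[OF A, of "l\<^sup>2"] C by (simp add: mult.commute[of l B])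
    finally have "0 \<le> l * (l\<^sup>2 * D - B)" by (simp add: algebra_simps)
    then show ?thesis using l False by (simp add: zero_le_mult_iff)
  qed
  then have "sqrt B \<le> l * sqrt D" using l real_sqrt_le_mono[of B "l\<^sup>2 * D"] by (simp add: real_sqrt_mult)
  then have "sqrt B / sqrt D \<le> l" using l nn
    by (cases "D = 0") (auto simp: divide_le_eq)
  then show ?thesis
    by (simp add: kernel_norm_quotient B_def D_def g_def)
  qed
  moreover have "(\<lambda>_. 0) \<in> L2_zero M" by (simp add: L2_zero_iff square_integrable_def)
  ultimately show ?thesis unfolding kernel_norm_def by (intro cSUP_least) auto
qed

end

text \<open>The form of \<open>T'\<close> dominates that of \<open>T\<close>, so it inherits
  positivity, and the norms of both operators are suprema of Rayleigh quotients. The bound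
  \<open>c \<le> 1\<close> keeps the candidate norm \<open>1 - c * (1 - kernel_norm M T)\<close>
  nonnegative.\<close>

lemma kernel_norm_comparison:
  assumes T: "reversible_kernel M T" and T': "reversible_kernel M T'"
    and form: "\<And>f. square_integrable M f \<Longrightarrow> 0 \<le> (\<integral>x. f x * (\<integral>y. f y \<partial>T x) \<partial>M)"
      "\<And>f. square_integrable M f \<Longrightarrow> (\<integral>x. f x * (\<integral>y. f y \<partial>T x) \<partial>M) \<le> (\<integral>x. f x * (\<integral>y. f y \<partial>T' x) \<partial>M)"
      "\<And>f. square_integrable M f \<Longrightarrow> c * ((\<integral>x. (f x)\<^sup>2 \<partial>M) - (\<integral>x. f x * (\<integral>y. f y \<partial>T x) \<partial>M))
        \<le> (\<integral>x. (f x)\<^sup>2 \<partial>M) - (\<integral>x. f x * (\<integral>y. f y \<partial>T' x) \<partial>M)"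
    and c: "0 \<le> c" "c \<le> 1"
  shows "c * (1 - kernel_norm M T) \<le> 1 - kernel_norm M T'" "1 - kernel_norm M T' \<le> 1 - kernel_norm M T"
proof -
  interpret T: reversible_kernel M T by fact
  interpret T': reversible_kernel M T' by fact
  have "kernel_norm M T \<le> kernel_norm M T'"
  proof (rule T.kernel_norm_le[OF T'.kernel_norm_nonneg])
    fix f assume f: "f \<in> L2_zero M"
    then show "(\<integral>x. f x * T.apply_kernel f x \<partial>M) \<le> kernel_norm M T' * (\<integral>x. (f x)\<^sup>2 \<partial>M)"
      using form(2)[of f] T'.rayleigh_le_kernel_norm[OF f]
      by (auto simp: T.apply_kernel_def T'.apply_kernel_def T.L2_zero_iff)
  qed (use form in \<open>auto simp: T.apply_kernel_def\<close>)
  then show "1 - kernel_norm M T' \<le> 1 - kernel_norm M T" by simp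
  have le1: "kernel_norm M T \<le> 1"
  proof (rule T.kernel_norm_le)
    fix f assume f: "f \<in> L2_zero M"
    then show "(\<integral>x. f x * T.apply_kernel f x \<partial>M) \<le> 1 * (\<integral>x. (f x)\<^sup>2 \<partial>M)"
    proof -
      have "0 \<le> (\<integral>x. \<integral>y. (f x - f y)\<^sup>2 \<partial>T x \<partial>M)" by simp
      moreover have "square_integrable M f" using f by (simp add: T.L2_zero_iff)
      note T.dirichlet_form(1)[OF this]
      ultimately show ?thesis by linarith
    qed
  qed (use form in \<open>auto simp: T.apply_kernel_def\<close>)
  have "kernel_norm M T' \<le> 1 - c * (1 - kernel_norm M T)"
  proof (rule T'.kernel_norm_le)
    have "c * (1 - kernel_norm M T) \<le> 1 * (1 - 0)"
      using c le1 T.kernel_norm_nonneg by (intro mult_mono) auto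
    then show "0 \<le> 1 - c * (1 - kernel_norm M T)" by simp
    fix f assume f: "square_integrable M f"
    then show "0 \<le> (\<integral>x. f x * T'.apply_kernel f x \<partial>M)"
      using form(1,2)[OF f] by (simp add: T'.apply_kernel_def)
  next
    fix f assume f: "f \<in> L2_zero M"
    then have sq: "square_integrable M f" by (simp add: T.L2_zero_iff)
    have "c * ((1 - kernel_norm M T) * (\<integral>x. (f x)\<^sup>2 \<partial>M)) \<le> c * ((\<integral>x. (f x)\<^sup>2 \<partial>M) - (\<integral>x. f x * T.apply_kernel f x \<partial>M))"
      using c T.rayleigh_le_kernel_norm[OF f] by (intro mult_left_mono) (auto simp: algebra_simps)
    then show "(\<integral>x. f x * T'.apply_kernel f x \<partial>M) \<le> (1 - c * (1 - kernel_norm M T)) * (\<integral>x. (f x)\<^sup>2 \<partial>M)"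
      using form(3)[OF sq] by (simp add: T'.apply_kernel_def T.apply_kernel_def algebra_simps)
  qed
  then show "c * (1 - kernel_norm M T) \<le> 1 - kernel_norm M T'" by simp
qed

section \<open>Gaussian densities and Gibbs measures\<close>

definition gauss_dens :: "nat \<Rightarrow> real \<Rightarrow> (nat \<Rightarrow> real) \<Rightarrow> (nat \<Rightarrow> real) \<Rightarrow> real" where
  "gauss_dens d \<sigma> x y = (\<Prod>j<d. normal_density (x j) \<sigma> (y j))"

definition sq_dist :: "nat \<Rightarrow> (nat \<Rightarrow> real) \<Rightarrow> (nat \<Rightarrow> real) \<Rightarrow> real" where
  "sq_dist d x y = (\<Sum>j<d. (y j - x j)\<^sup>2)"

interpretation lborel_prod: product_sigma_finite "\<lambda>_::nat. lborel :: real measure" ..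

lemma sigma_finite_euclid: "sigma_finite_measure (euclid d)"
  unfolding euclid_def by (rule lborel_prod.sigma_finite) simp

interpretation euclid: sigma_finite_measure "euclid d" for d
  by (rule sigma_finite_euclid)

interpretation euclid_pair: pair_sigma_finite "euclid d" "euclid d" for d ..

lemma space_euclid: "space (euclid d) = extensional {..<d}"
  by (simp add: euclid_def space_PiM PiE_def)

lemma measurable_euclid_component [measurable]: "j < d \<Longrightarrow> (\<lambda>x. x j) \<in> borel_measurable (euclid d)"
  unfolding euclid_def by (subst measurable_lborel1[symmetric]) (rule measurable_component_singleton, simp)

lemma measurable_gauss_dens [measurable]:
  assumes [measurable]: "f \<in> M \<rightarrow>\<^sub>M euclid d" "g \<in> M \<rightarrow>\<^sub>M euclid d"
  shows "(\<lambda>w. gauss_dens d \<sigma> (f w) (g w)) \<in> borel_measurable M"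
proof -
  have [measurable]: "(\<lambda>w. f w j) \<in> borel_measurable M" "(\<lambda>w. g w j) \<in> borel_measurable M" if "j < d" for j
    using measurable_compose[OF assms(1) measurable_euclid_component[OF that]]
     measurable_compose[OF assms(2) measurable_euclid_component[OF that]] by auto
  show ?thesis unfolding gauss_dens_def normal_density_def
    by (intro borel_measurable_prod borel_measurable_times borel_measurable_divide borel_measurable_exp) auto
qed

lemma measurable_gauss_dens_right [measurable]: "gauss_dens d \<sigma> x \<in> borel_measurable (euclid d)"
  unfolding gauss_dens_def normal_density_def
  by (intro borel_measurable_prod borel_measurable_times borel_measurable_divide borel_measurable_exp) auto

lemma gauss_dens_nonneg: "0 \<le> gauss_dens d \<sigma> x y"
  by (simp add: gauss_dens_def prod_nonneg)

lemma gauss_dens_sym: "gauss_dens d \<sigma> x y = gauss_dens d \<sigma> y x"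
  by (simp add: gauss_dens_def normal_density_def power2_commute)

lemma ennreal_gauss_dens: "ennreal (gauss_dens d \<sigma> x y) = (\<Prod>j<d. ennreal (normal_density (x j) \<sigma> (y j)))"
  by (simp add: gauss_dens_def prod_ennreal)

lemma gaussian_eq_density:
  assumes "0 < \<sigma>"
  shows "gaussian d x \<sigma> = density (euclid d) (\<lambda>y. ennreal (gauss_dens d \<sigma> x y))"
proof -
  interpret N: product_prob_space "\<lambda>j. density lborel (\<lambda>t. ennreal (normal_density (x j) \<sigma> t))" "{..<d}"
    using prob_space_normal_density[OF assms]
    by (auto simp: product_prob_space_def product_prob_space_axioms_def product_sigma_finite_def
        intro: prob_space_imp_sigma_finite)
  have "density (euclid d) (\<lambda>y. ennreal (gauss_dens d \<sigma> x y)) = gaussian d x \<sigma>"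
    unfolding gaussian_def
  proof (rule N.PiM_eqI)
    show "sets (density (euclid d) (\<lambda>y. ennreal (gauss_dens d \<sigma> x y))) =
      sets (PiM {..<d} (\<lambda>j. density lborel (\<lambda>t. ennreal (normal_density (x j) \<sigma> t))))"
      by (simp add: euclid_def cong: sets_PiM_cong)
    fix A :: "nat \<Rightarrow> real set"
    assume "\<And>i. i \<in> {..<d} \<Longrightarrow> A i \<in> sets (density lborel (\<lambda>t. ennreal (normal_density (x i) \<sigma> t)))"
    then have A: "A i \<in> sets borel" if "i < d" for i using that by simp
    have PA: "PiE {..<d} A \<in> sets (euclid d)"
      unfolding euclid_def using A by (intro sets_PiM_I_finite) auto
    have "emeasure (density (euclid d) (\<lambda>y. ennreal (gauss_dens d \<sigma> x y))) (PiE {..<d} A) =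
      (\<integral>\<^sup>+y. ennreal (gauss_dens d \<sigma> x y) * indicator (PiE {..<d} A) y \<partial>euclid d)"
      using PA by (subst emeasure_density) auto
    also have "\<dots> = (\<integral>\<^sup>+y. (\<Prod>j<d. ennreal (normal_density (x j) \<sigma> (y j)) * indicator (A j) (y j)) \<partial>euclid d)"
    proof (intro nn_integral_cong)
      fix y assume "y \<in> space (euclid d)"
      then have "indicator (PiE {..<d} A) y = (\<Prod>j<d. indicator (A j) (y j) :: ennreal)"
        by (auto simp: space_euclid indicator_def PiE_def Pi_def prod_zero_iff)
      then show "ennreal (gauss_dens d \<sigma> x y) * indicator (PiE {..<d} A) y
        = (\<Prod>j<d. ennreal (normal_density (x j) \<sigma> (y j)) * indicator (A j) (y j))"
        by (simp add: ennreal_gauss_dens prod.distrib)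
    qed
    also have "\<dots> = (\<Prod>j<d. \<integral>\<^sup>+t. ennreal (normal_density (x j) \<sigma> t) * indicator (A j) t \<partial>lborel)"
      unfolding euclid_def using A by (subst lborel_prod.product_nn_integral_prod) auto
    also have "\<dots> = (\<Prod>j<d. emeasure (density lborel (\<lambda>t. ennreal (normal_density (x j) \<sigma> t))) (A j))"
      using A by (intro prod.cong refl) (simp add: emeasure_density)
    finally show "emeasure (density (euclid d) (\<lambda>y. ennreal (gauss_dens d \<sigma> x y))) (PiE {..<d} A) =
      (\<Prod>j<d. emeasure (density lborel (\<lambda>t. ennreal (normal_density (x j) \<sigma> t))) (A j))" .
  qed simp
  then show ?thesis by simp
qed

text \<open>Completing the square. An exponential tilt of a Gaussian is a shifted Gaussian; both the
  exponential moments and the likelihood ratio of two proposals with different base points come from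
  this.\<close>

lemma normal_density_tilt:
  assumes "0 < \<sigma>"
  shows "normal_density m \<sigma> t * exp (w * (t - m)) = exp (\<sigma>\<^sup>2 * w\<^sup>2 / 2) * normal_density (m + \<sigma>\<^sup>2 * w) \<sigma> t"
proof -
  have "- (t - m)\<^sup>2 / (2 * \<sigma>\<^sup>2) + w * (t - m) = \<sigma>\<^sup>2 * w\<^sup>2 / 2 + - (t - (m + \<sigma>\<^sup>2 * w))\<^sup>2 / (2 * \<sigma>\<^sup>2)"
    using assms by (simp add: field_simps power2_eq_square)
  then show ?thesis by (simp add: normal_density_def exp_add[symmetric] mult_ac)
qed

lemma gauss_dens_tilt:
  assumes "0 < \<sigma>"
  shows "gauss_dens d \<sigma> x y * exp (\<Sum>j<d. w j * (y j - x j)) =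
    exp (\<sigma>\<^sup>2 / 2 * (\<Sum>j<d. (w j)\<^sup>2)) * gauss_dens d \<sigma> (\<lambda>j. x j + \<sigma>\<^sup>2 * w j) y"
proof -
  have "gauss_dens d \<sigma> x y * exp (\<Sum>j<d. w j * (y j - x j)) =
    (\<Prod>j<d. normal_density (x j) \<sigma> (y j) * exp (w j * (y j - x j)))"
    by (simp add: gauss_dens_def exp_sum prod.distrib)
  also have "\<dots> = (\<Prod>j<d. exp (\<sigma>\<^sup>2 * (w j)\<^sup>2 / 2) * normal_density (x j + \<sigma>\<^sup>2 * w j) \<sigma> (y j))"
    using normal_density_tilt[OF assms] by simp
  also have "\<dots> = exp (\<sigma>\<^sup>2 / 2 * (\<Sum>j<d. (w j)\<^sup>2)) * gauss_dens d \<sigma> (\<lambda>j. x j + \<sigma>\<^sup>2 * w j) y"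
    by (simp add: prod.distrib gauss_dens_def sum_distrib_left exp_sum)
  finally show ?thesis .
qed

lemma nn_integral_gauss_dens:
  assumes "0 < \<sigma>"
  shows "(\<integral>\<^sup>+y. ennreal (gauss_dens d \<sigma> x y) \<partial>euclid d) = 1"
proof -
  have "(\<integral>\<^sup>+y. ennreal (gauss_dens d \<sigma> x y) \<partial>euclid d) = (\<Prod>j<d. \<integral>\<^sup>+t. ennreal (normal_density (x j) \<sigma> t) \<partial>lborel)"
    unfolding ennreal_gauss_dens euclid_def by (rule lborel_prod.product_nn_integral_prod) auto
  also have "\<dots> = 1"
  proof (intro prod.neutral ballI)
    fix j
    interpret prob_space "density lborel (\<lambda>t. ennreal (normal_density (x j) \<sigma> t))"
      by (rule prob_space_normal_density[OF assms])
    show "(\<integral>\<^sup>+t. ennreal (normal_density (x j) \<sigma> t) \<partial>lborel) = 1"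
      using emeasure_space_1 by (simp add: emeasure_density)
  qed
  finally show ?thesis .
qed

lemma nn_integral_gauss_dens_exp:
  assumes "0 < \<sigma>"
  shows "(\<integral>\<^sup>+y. ennreal (gauss_dens d \<sigma> x y * exp (\<Sum>j<d. w j * (y j - x j))) \<partial>euclid d)
    = ennreal (exp (\<sigma>\<^sup>2 / 2 * (\<Sum>j<d. (w j)\<^sup>2)))"
proof -
  have [measurable]: "(\<lambda>y. gauss_dens d \<sigma> (\<lambda>j. x j + \<sigma>\<^sup>2 * w j) y) \<in> borel_measurable (euclid d)"
    unfolding gauss_dens_def by measurable
  show ?thesis
    unfolding gauss_dens_tilt[OF assms]
    by (simp add: ennreal_mult gauss_dens_nonneg nn_integral_cmult nn_integral_gauss_dens[OF assms])
qed

lemma nn_integral_gauss_dens_sq_dist: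
  assumes "0 < \<sigma>"
  shows "(\<integral>\<^sup>+y. ennreal (gauss_dens d \<sigma> x y * sq_dist d x y) \<partial>euclid d) = ennreal (d * \<sigma>\<^sup>2)"
proof -
  have one: "(\<integral>\<^sup>+t. ennreal (normal_density m \<sigma> t) \<partial>lborel) = 1" for m
    using prob_space.emeasure_space_1[OF prob_space_normal_density[OF assms], of m] by (simp add: emeasure_density)
  have two: "(\<integral>\<^sup>+t. ennreal (normal_density m \<sigma> t * (t - m)\<^sup>2) \<partial>lborel) = ennreal (\<sigma>\<^sup>2)" for m
  proof -
    have "has_bochner_integral lborel (\<lambda>t. normal_density m \<sigma> t * (t - m)\<^sup>2) (\<sigma>\<^sup>2)"
      using normal_moment_even[of \<sigma> m 1] assms by simp
    then show ?thesis
      by (subst nn_integral_eq_integral) (auto simp: has_bochner_integral_iff)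
  qed
  have comp: "(\<integral>\<^sup>+y. ennreal (gauss_dens d \<sigma> x y * (y j - x j)\<^sup>2) \<partial>euclid d) = ennreal (\<sigma>\<^sup>2)" if j: "j < d" for j
  proof -
    have "(\<integral>\<^sup>+y. ennreal (gauss_dens d \<sigma> x y * (y j - x j)\<^sup>2) \<partial>euclid d) =
      (\<integral>\<^sup>+y. (\<Prod>i<d. ennreal (normal_density (x i) \<sigma> (y i) * (if i = j then (y i - x i)\<^sup>2 else 1))) \<partial>euclid d)"
      using j by (intro nn_integral_cong) (simp add: prod_ennreal gauss_dens_def prod.distrib prod.delta)
    also have "\<dots> = (\<Prod>i<d. \<integral>\<^sup>+t. ennreal (normal_density (x i) \<sigma> t * (if i = j then (t - x i)\<^sup>2 else 1)) \<partial>lborel)"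
      unfolding euclid_def by (rule lborel_prod.product_nn_integral_prod) auto
    also have "\<dots> = (\<Prod>i<d. if i = j then ennreal (\<sigma>\<^sup>2) else 1)"
      by (intro prod.cong refl) (simp add: one two)
    also have "\<dots> = ennreal (\<sigma>\<^sup>2)" using j by (simp add: prod.delta)
    finally show ?thesis .
  qed
  have "(\<integral>\<^sup>+y. ennreal (gauss_dens d \<sigma> x y * sq_dist d x y) \<partial>euclid d) =
    (\<integral>\<^sup>+y. (\<Sum>j<d. ennreal (gauss_dens d \<sigma> x y * (y j - x j)\<^sup>2)) \<partial>euclid d)"
    by (intro nn_integral_cong) (simp add: sq_dist_def sum_distrib_left sum_ennreal gauss_dens_nonneg)
  also have "\<dots> = (\<Sum>j<d. \<integral>\<^sup>+y. ennreal (gauss_dens d \<sigma> x y * (y j - x j)\<^sup>2) \<partial>euclid d)"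
  proof (rule nn_integral_sum)
    fix j assume "j \<in> {..<d}"
    then have [measurable]: "(\<lambda>x. x j) \<in> borel_measurable (euclid d)" by (intro measurable_euclid_component) auto
    have [measurable]: "gauss_dens d \<sigma> x \<in> borel_measurable (euclid d)"
      unfolding gauss_dens_def by measurable
    show "(\<lambda>y. ennreal (gauss_dens d \<sigma> x y * (y j - x j)\<^sup>2)) \<in> borel_measurable (euclid d)" by measurable
  qed
  also have "\<dots> = ennreal (d * \<sigma>\<^sup>2)" by (simp add: comp ennreal_of_nat_eq_real_of_nat ennreal_mult)
  finally show ?thesis .
qed

text \<open>The integration runs over the common mean \<open>z\<close>, so the identity exhibits the
  Gaussian kernel with doubled variance as a Gram kernel. In each coordinate it is the convolution
  of two centred normal densities.\<close>

lemma gauss_dens_convolution: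
  assumes "0 < \<sigma>"
  shows "(\<integral>\<^sup>+z. ennreal (gauss_dens d \<sigma> z x) * ennreal (gauss_dens d \<sigma> z y) \<partial>euclid d)
    = ennreal (gauss_dens d (sqrt 2 * \<sigma>) x y)"
proof -
  have [measurable]: "(\<lambda>t. normal_density t \<sigma> a) \<in> borel_measurable borel" for a
    unfolding normal_density_def by measurable
  have c: "(\<integral>\<^sup>+t. ennreal (normal_density t \<sigma> a) * ennreal (normal_density t \<sigma> b) \<partial>lborel)
     = ennreal (normal_density a (sqrt 2 * \<sigma>) b)" for a b
  proof -
    have "(\<integral>\<^sup>+t. ennreal (normal_density t \<sigma> a) * ennreal (normal_density t \<sigma> b) \<partial>lborel)
      = ennreal \<bar>1\<bar> * (\<integral>\<^sup>+t. ennreal (normal_density (a + 1 * t) \<sigma> a) * ennreal (normal_density (a + 1 * t) \<sigma> b) \<partial>lborel)"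
      by (rule nn_integral_real_affine) (auto simp: normal_density_def)
    also have "\<dots> = (\<integral>\<^sup>+t. ennreal (normal_density 0 \<sigma> ((b - a) - t) * normal_density 0 \<sigma> t) \<partial>lborel)"
      by (simp add: ennreal_mult'[symmetric]) (simp add: normal_density_def power2_commute algebra_simps)
    also have "\<dots> = ennreal (normal_density 0 (sqrt (\<sigma>\<^sup>2 + \<sigma>\<^sup>2)) (b - a))"
      using conv_normal_density_zero_mean[OF assms assms] by (simp add: fun_eq_iff)
    also have "\<dots> = ennreal (normal_density a (sqrt 2 * \<sigma>) b)"
      using assms by (simp add: normal_density_def power_mult_distrib)
    finally show ?thesis .
  qed
  show ?thesis
    unfolding ennreal_gauss_dens prod.distrib[symmetric] euclid_def
    by (subst lborel_prod.product_nn_integral_prod) (simp_all add: c)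
qed

lemma gauss_dens_ratio:
  assumes "0 < \<sigma>"
  shows "gauss_dens d \<sigma> x' y = gauss_dens d \<sigma> x y *
    exp ((\<Sum>j<d. (x' j - x j) * (y j - x j)) / \<sigma>\<^sup>2 - sq_dist d x x' / (2 * \<sigma>\<^sup>2))"
proof -
  let ?w = "\<lambda>j. (x' j - x j) / \<sigma>\<^sup>2"
  have "gauss_dens d \<sigma> x y * exp (\<Sum>j<d. ?w j * (y j - x j)) =
    exp (\<sigma>\<^sup>2 / 2 * (\<Sum>j<d. (?w j)\<^sup>2)) * gauss_dens d \<sigma> x' y"
    unfolding gauss_dens_tilt[OF assms] using assms by simp
  moreover have "(\<Sum>j<d. ?w j * (y j - x j)) = (\<Sum>j<d. (x' j - x j) * (y j - x j)) / \<sigma>\<^sup>2"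
    by (simp add: sum_divide_distrib)
  moreover have "\<sigma>\<^sup>2 / 2 * (\<Sum>j<d. (?w j)\<^sup>2) = sq_dist d x x' / (2 * \<sigma>\<^sup>2)"
    using assms by (simp add: sq_dist_def power_divide sum_divide_distrib[symmetric] power2_eq_square)
  ultimately show ?thesis by (simp add: exp_diff field_simps)
qed

lemma gibbs_normalizer_pos:
  fixes U :: "'a \<Rightarrow> real"
  assumes int: "integrable M (\<lambda>x. exp (- U x))" and ne: "emeasure M (space M) \<noteq> 0"
  shows "0 < (\<integral>x. exp (- U x) \<partial>M)"
proof -
  have "(\<integral>x. exp (- U x) \<partial>M) \<noteq> 0"
  proof
    assume "(\<integral>x. exp (- U x) \<partial>M) = 0"
    then have "AE x in M. exp (- U x) = 0"
      by (subst (asm) integral_nonneg_eq_0_iff_AE[OF int]) auto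
    then have "AE x in M. False" by eventually_elim simp
    then have "(\<integral>\<^sup>+x. 1 \<partial>M) = (\<integral>\<^sup>+x. 0 \<partial>M)" by (intro nn_integral_cong_AE) (auto elim: eventually_mono)
    then show False using ne by simp
  qed
  moreover have "0 \<le> (\<integral>x. exp (- U x) \<partial>M)" by simp
  ultimately show ?thesis by linarith
qed

lemma prob_space_gibbs_measure:
  assumes U [measurable]: "U \<in> borel_measurable M" and int: "integrable M (\<lambda>x. exp (- U x))"
    and ne: "emeasure M (space M) \<noteq> 0"
  shows "prob_space (gibbs_measure M U)"
proof
  note Z = gibbs_normalizer_pos[OF int ne]
  have "emeasure (gibbs_measure M U) (space (gibbs_measure M U)) = (\<integral>\<^sup>+x. ennreal (exp (- U x) / (\<integral>x. exp (- U x) \<partial>M)) \<partial>M)"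
    unfolding gibbs_measure_def by (simp add: emeasure_density cong: nn_integral_cong)
  also have "\<dots> = ennreal (\<integral>x. exp (- U x) / (\<integral>x. exp (- U x) \<partial>M) \<partial>M)"
    using int Z by (intro nn_integral_eq_integral) auto
  also have "\<dots> = 1" using Z by simp
  finally show "emeasure (gibbs_measure M U) (space (gibbs_measure M U)) = 1" .
qed

text \<open>On a null space the Gaussian density could not integrate to 1.\<close>

lemma emeasure_euclid_space: "emeasure (euclid d) (space (euclid d)) \<noteq> 0"
proof
  assume "emeasure (euclid d) (space (euclid d)) = 0"
  then have "AE x in euclid d. False" by (intro AE_I[of _ _ "space (euclid d)"]) auto
  then have "(\<integral>\<^sup>+y. ennreal (gauss_dens d 1 (\<lambda>_. 0) y) \<partial>euclid d) = (\<integral>\<^sup>+y. 0 \<partial>euclid d)"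
    by (intro nn_integral_cong_AE) (auto elim: eventually_mono)
  then show False by (simp add: nn_integral_gauss_dens)
qed

section \<open>Variance bound for strongly log-concave measures\<close>

text \<open>Valid for every real \<open>t\<close>, because the remainder after the cubic term is a
  nonnegative multiple of the fourth power.\<close>

lemma exp_lower_cubic: "1 + t + t\<^sup>2 / 2 + t ^ 3 / 6 \<le> exp (t::real)"
proof -
  obtain u where u: "exp t = (\<Sum>k<4. t ^ k / fact k) + exp u / fact 4 * t ^ 4"
    using Maclaurin_exp_le[of t 4] by auto
  have "(\<Sum>k<4. t ^ k / fact k) = 1 + t + t\<^sup>2 / 2 + t ^ 3 / 6"
    by (simp add: eval_nat_numeral)
  moreover have "0 \<le> exp u / fact 4 * t ^ 4" by simp
  ultimately show ?thesis using u by linarith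
qed

lemma sq_dist_nonneg: "0 \<le> sq_dist d x y"
  by (simp add: sq_dist_def sum_nonneg)

lemma sum_mult_le_sqrt:
  "\<bar>\<Sum>j<d. f j * (y j - x j)\<bar> \<le> L2_set f {..<d::nat} * sqrt (sq_dist d x y)"
proof -
  have "\<bar>\<Sum>j<d. f j * (y j - x j)\<bar> \<le> (\<Sum>j<d. \<bar>f j\<bar> * \<bar>y j - x j\<bar>)"
    by (rule order_trans[OF sum_abs]) (simp add: abs_mult)
  also have "\<dots> \<le> L2_set f {..<d} * L2_set (\<lambda>j. y j - x j) {..<d}"
    by (rule L2_set_mult_ineq)
  finally show ?thesis by (simp add: L2_set_def sq_dist_def)
qed

text \<open>\<open>v\<close> stands for the gradient. Everything about it, including measurability
  and the Lipschitz bound, is derived from the two-sided quadratic bound. Points are extensional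
  functions, for which \<open>sq_dist\<close> is a genuine squared metric.\<close>

locale convex_potential =
  fixes d :: nat and U :: "(nat \<Rightarrow> real) \<Rightarrow> real" and v :: "(nat \<Rightarrow> real) \<Rightarrow> nat \<Rightarrow> real" and m L :: real
  assumes d: "1 \<le> d" and m: "0 < m" and L: "0 < L"
    and U_measurable [measurable]: "U \<in> borel_measurable (euclid d)"
    and U_integrable: "integrable (euclid d) (\<lambda>z. exp (- U z))"
    and lower: "\<And>x y. x \<in> extensional {..<d} \<Longrightarrow> y \<in> extensional {..<d} \<Longrightarrow>
      m / 2 * sq_dist d x y \<le> U y - U x - (\<Sum>j<d. v x j * (y j - x j))"
    and upper: "\<And>x y. x \<in> extensional {..<d} \<Longrightarrow> y \<in> extensional {..<d} \<Longrightarrow>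
      U y - U x - (\<Sum>j<d. v x j * (y j - x j)) \<le> L / 2 * sq_dist d x y"
begin

abbreviation pts :: "(nat \<Rightarrow> real) set" where "pts \<equiv> extensional {..<d}"

definition Z where "Z = (\<integral>z. exp (- U z) \<partial>euclid d)"

definition \<nu> where "\<nu> = gibbs_measure (euclid d) U"

lemma Z_pos: "0 < Z"
  unfolding Z_def by (rule gibbs_normalizer_pos[OF U_integrable emeasure_euclid_space])

lemma \<nu>_density: "\<nu> = density (euclid d) (\<lambda>z. ennreal (exp (- U z) / Z))"
  by (simp add: \<nu>_def gibbs_measure_def Z_def)

lemma sets_\<nu> [simp, measurable_cong]: "sets \<nu> = sets (euclid d)"
  and space_\<nu> [simp]: "space \<nu> = space (euclid d)"
  by (simp_all add: \<nu>_density)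

lemma nn_integral_\<nu>:
  "f \<in> borel_measurable (euclid d) \<Longrightarrow> (\<integral>\<^sup>+z. f z \<partial>\<nu>) = (\<integral>\<^sup>+z. ennreal (exp (- U z) / Z) * f z \<partial>euclid d)"
  unfolding \<nu>_density by (rule nn_integral_density) auto

lemma prob_space_\<nu>: "prob_space \<nu>"
  unfolding \<nu>_def by (rule prob_space_gibbs_measure[OF U_measurable U_integrable emeasure_euclid_space])

sublocale \<nu>: prob_space \<nu> by (rule prob_space_\<nu>)

lemma measure_\<nu>_space [simp]: "measure \<nu> (space (euclid d)) = 1"
  using \<nu>.prob_space by simp

text \<open>Strong convexity is used at the midpoint, towards \<open>x\<close> and towards
  \<open>y\<close>: the two linear terms cancel, and each squared distance is a quarter of that
  between \<open>x\<close> and \<open>y\<close>.\<close>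

lemma midpoint_convex:
  assumes x: "x \<in> pts" and y: "y \<in> pts"
  shows "2 * U (\<lambda>j\<in>{..<d}. (x j + y j) / 2) + m / 4 * sq_dist d x y \<le> U x + U y"
proof -
  let ?c = "\<lambda>j\<in>{..<d}. (x j + y j) / 2"
  have "m / 2 * sq_dist d ?c x \<le> U x - U ?c - (\<Sum>j<d. v ?c j * (x j - ?c j))"
    "m / 2 * sq_dist d ?c y \<le> U y - U ?c - (\<Sum>j<d. v ?c j * (y j - ?c j))"
    by (rule lower; simp add: x y)+
  moreover have "(\<Sum>j<d. v ?c j * (x j - ?c j)) + (\<Sum>j<d. v ?c j * (y j - ?c j)) = 0"
    unfolding sum.distrib[symmetric] by (intro sum.neutral ballI) (auto simp: field_simps)
  moreover have "sq_dist d ?c x = sq_dist d x y / 4" "sq_dist d ?c y = sq_dist d x y / 4"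
    unfolding sq_dist_def sum_divide_distrib by (auto intro!: sum.cong simp: power2_eq_square field_simps)
  ultimately show ?thesis by (simp add: field_simps)
qed

text \<open>Maurey's property (tau) with quadratic cost. In the Prekopa-Leindler inequality for the
  normalised densities, with \<open>h\<close> added to one potential exponent and \<open>g\<close>
  subtracted from the other, the excess of \<open>h x\<close> over \<open>g y\<close> is paid for by
  the quadratic gain in \<open>midpoint_convex\<close>.\<close>

lemma inf_convolution:
  assumes [measurable]: "h \<in> borel_measurable (euclid d)" "g \<in> borel_measurable (euclid d)"
    and le: "\<And>x y. x \<in> pts \<Longrightarrow> y \<in> pts \<Longrightarrow> h x - g y \<le> m / 4 * sq_dist d x y"
  shows "(\<integral>\<^sup>+x. ennreal (exp (h x)) \<partial>\<nu>) * (\<integral>\<^sup>+x. ennreal (exp (- g x)) \<partial>\<nu>) \<le> 1"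
proof -
  let ?u = "\<lambda>x. ennreal (exp (- U x) / Z) * ennreal (exp (h x))"
    and ?v = "\<lambda>x. ennreal (exp (- U x) / Z) * ennreal (exp (- g x))"
    and ?w = "\<lambda>x. ennreal (exp (- U x) / Z)"
  have "(\<integral>\<^sup>+x. ?u x \<partial>euclid d) * (\<integral>\<^sup>+x. ?v x \<partial>euclid d) \<le> (\<integral>\<^sup>+x. ?w x \<partial>euclid d)^2"
    unfolding euclid_def
  proof (rule prekopa_leindler)
    fix x y :: "nat \<Rightarrow> real" assume xy: "x \<in> pts" "y \<in> pts"
    let ?c = "\<lambda>j\<in>{..<d}. (x j + y j) / 2"
    have "- U x + h x + (- U y - g y) \<le> 2 * (- U ?c)"
      using midpoint_convex[OF xy] le[OF xy] by simp
    then have "exp (- U x + h x + (- U y - g y)) \<le> exp (2 * (- U ?c))" by (simp only: exp_le_cancel_iff)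
    then have "exp (- U x + h x + (- U y - g y)) / Z\<^sup>2 \<le> exp (2 * (- U ?c)) / Z\<^sup>2"
      by (intro divide_right_mono) auto
    moreover have "exp (- U x) / Z * exp (h x) * (exp (- U y) / Z * exp (- g y)) = exp (- U x + h x + (- U y - g y)) / Z\<^sup>2"
      by (simp add: exp_add exp_diff exp_minus power2_eq_square field_simps)
    moreover have "(exp (- U ?c) / Z)\<^sup>2 = exp (2 * (- U ?c)) / Z\<^sup>2"
      by (simp add: power_divide exp_double[symmetric])
    ultimately have "exp (- U x) / Z * exp (h x) * (exp (- U y) / Z * exp (- g y)) \<le> (exp (- U ?c) / Z)\<^sup>2" by simp
    then have "ennreal (exp (- U x) / Z * exp (h x) * (exp (- U y) / Z * exp (- g y))) \<le> ennreal ((exp (- U ?c) / Z)\<^sup>2)"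
      by (rule ennreal_leI)
    then show "?u x * ?v y \<le> (?w ?c)^2"
      using Z_pos by (simp only: ennreal_mult[symmetric] ennreal_power divide_nonneg_pos exp_ge_zero mult_nonneg_nonneg)
  qed (use U_measurable assms in \<open>auto simp: euclid_def[symmetric]\<close>)
  moreover have "(\<integral>\<^sup>+x. ?w x \<partial>euclid d) = 1"
    using nn_integral_\<nu>[of "\<lambda>_. 1"] \<nu>.emeasure_space_1 by simp
  ultimately show ?thesis by (simp add: nn_integral_\<nu>)
qed

text \<open>A Poincare inequality with \<open>A x\<close> in place of the squared gradient, compared
  with increments only up to squared distance \<open>\<delta>\<close>. The pair inserted into
  \<open>inf_convolution\<close> is \<open>e * G'\<close> and its correction by
  \<open>e\<^sup>2 * (A x / m)\<close>; comparison of the second-order terms as \<open>e\<close>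
  tends to 0 gives the claim. The bounds \<open>B\<close> and \<open>D\<close> make the error terms
  uniform and disappear with \<open>e\<close>.\<close>

lemma variance_le:
  assumes [measurable]: "G \<in> borel_measurable (euclid d)" "A \<in> borel_measurable (euclid d)"
    and G: "\<And>x. x \<in> pts \<Longrightarrow> \<bar>G x\<bar> \<le> B"
    and A: "\<And>x. x \<in> pts \<Longrightarrow> 0 \<le> A x" "\<And>x. x \<in> pts \<Longrightarrow> A x \<le> D"
    and \<delta>: "0 < \<delta>"
    and lip: "\<And>x y. x \<in> pts \<Longrightarrow> y \<in> pts \<Longrightarrow> sq_dist d x y \<le> \<delta> \<Longrightarrow>
      (G x - G y)\<^sup>2 \<le> A x * sq_dist d x y"
  shows "(\<integral>x. (G x - (\<integral>x. G x \<partial>\<nu>))\<^sup>2 \<partial>\<nu>) \<le> (\<integral>x. A x \<partial>\<nu>) / m"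
proof -
  define c where "c = (\<integral>x. G x \<partial>\<nu>)"
  define G' where "G' x = G x - c" for x
  \<comment> \<open>One constant for both ingredients: \<open>2 * B\<close> bounds the centred
    function and \<open>D / m\<close> the correction.\<close>
  define K where "K = 2 * B + D / m"
  obtain x0 :: "nat \<Rightarrow> real" where x0: "x0 \<in> pts" using \<nu>.not_empty by (auto simp: space_euclid)
  have B: "0 \<le> B" using G[OF x0] by simp
  have D: "0 \<le> D" using A[OF x0] by simp
  have K: "0 \<le> K" using B D m by (simp add: K_def)
  have bounded_int: "integrable \<nu> f" if "f \<in> borel_measurable (euclid d)" "\<And>x. x \<in> pts \<Longrightarrow> \<bar>f x\<bar> \<le> b" for f :: "_ \<Rightarrow> real" and b
    using that by (intro \<nu>.integrable_const_bound[of _ b]) (auto simp: space_euclid)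
  have iG: "integrable \<nu> G" by (rule bounded_int[OF _ G]) auto
  have iA: "integrable \<nu> A" by (rule bounded_int[of _ D]) (use A in auto)
  have cB: "\<bar>c\<bar> \<le> B"
  proof -
    have "\<bar>c\<bar> \<le> (\<integral>x. \<bar>G x\<bar> \<partial>\<nu>)" unfolding c_def using integral_norm_bound[of \<nu> G] by simp
    also have "\<dots> \<le> (\<integral>x. B \<partial>\<nu>)" using iG G by (intro integral_mono) (auto simp: space_euclid)
    finally show ?thesis by (simp add: \<nu>.prob_space)
  qed
  have G': "\<bar>G' x\<bar> \<le> K" "\<bar>G' x\<bar> \<le> 2 * B" if "x \<in> pts" for x
  proof -
    show "\<bar>G' x\<bar> \<le> 2 * B" using G[OF that] cB by (simp add: G'_def)
    then show "\<bar>G' x\<bar> \<le> K" using D m by (simp add: K_def add_increasing2)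
  qed
  have Am: "A x / m \<le> K" if "x \<in> pts" for x
    using A[OF that] B m divide_right_mono[of "A x" D m] by (simp add: K_def)
  have [measurable]: "G' \<in> borel_measurable (euclid d)" unfolding G'_def by measurable
  have iG': "integrable \<nu> G'" "integrable \<nu> (\<lambda>x. (G' x)\<^sup>2)"
  proof -
    show "integrable \<nu> G'" by (rule bounded_int[OF _ G'(1)]) measurable
    show "integrable \<nu> (\<lambda>x. (G' x)\<^sup>2)"
    proof (rule bounded_int)
      fix x :: "nat \<Rightarrow> real" assume "x \<in> pts"
      from power_mono[OF G'(1)[OF this], of 2] show "\<bar>(G' x)\<^sup>2\<bar> \<le> K\<^sup>2" by simp
    qed measurable
  qed
  have zero: "(\<integral>x. G' x \<partial>\<nu>) = 0" using iG by (simp add: G'_def c_def)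
  define V a where "V = (\<integral>x. (G' x)\<^sup>2 \<partial>\<nu>)" and "a = (\<integral>x. A x \<partial>\<nu>)"
  have V: "0 \<le> V" by (simp add: V_def)
  have a: "0 \<le> a" unfolding a_def using A by (intro integral_nonneg_AE AE_I2) (auto simp: space_euclid)
  \<comment> \<open>The third-order errors: the square of \<open>K\<close> bounds the cross term in
    the square of \<open>?h\<close>, the cube bounds the cubic Taylor term. \<open>K''\<close> then
    bounds \<open>P\<close> and \<open>Q\<close> in units of \<open>e\<^sup>2\<close>.\<close>
  define K' where "K' = K\<^sup>2 + K ^ 3"
  define K'' where "K'' = V + a / m + K'"
  have K': "0 \<le> K'" "0 \<le> K''" using K V a m by (auto simp: K'_def K''_def)
  define R where "R = 2 * K' + K''\<^sup>2"
  \<comment> \<open>In order, the entries let powers of \<open>e\<close> decrease, keep the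
    exponents within [-1, 1], make pairs at squared distance beyond \<open>\<delta>\<close>
    harmless, and keep \<open>1 + P\<close> and \<open>1 + Q\<close> positive.\<close>
  define e1 where "e1 = Min {1, 1 / (K + 1), m * \<delta> / (8 * B + 1), 1 / (2 * (K'' + 1))}"
  have e1: "0 < e1" "e1 \<le> 1" "e1 \<le> 1 / (K + 1)" "e1 \<le> m * \<delta> / (8 * B + 1)" "e1 \<le> 1 / (2 * (K'' + 1))"
    unfolding e1_def using K K' m \<delta> B by auto
  have main: "V - a / m \<le> e * R" if e: "0 < e" "e \<le> e1" for e
  proof -
    have el: "e \<le> 1 / (K + 1)" "e \<le> m * \<delta> / (8 * B + 1)" "e \<le> 1 / (2 * (K'' + 1))"
      using e(2) e1 by linarith+
    have eK: "e * K \<le> 1"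
    proof -
      have "e * (K + 1) \<le> 1" using el(1) K by (simp add: pos_le_divide_eq)
      then show ?thesis using e by (simp add: algebra_simps)
    qed
    have e8: "e * (2 * B) \<le> m / 4 * \<delta>"
    proof -
      have "e * (8 * B + 1) \<le> m * \<delta>" using el(2) B by (simp add: pos_le_divide_eq)
      then show ?thesis using e by (simp add: algebra_simps)
    qed
    have e2: "e\<^sup>2 * K'' < 1"
    proof -
      have "e * (2 * (K'' + 1)) \<le> 1" using el(3) K' by (simp add: pos_le_divide_eq)
      then have "e * K'' < 1" using e by (simp add: algebra_simps)
      moreover have "e\<^sup>2 * K'' \<le> e * K''" using e e1 K' by (intro mult_right_mono) (auto simp: power2_eq_square)
      ultimately show ?thesis by simp
    qed
    let ?h = "\<lambda>x. e * G' x - e\<^sup>2 * (A x / m)" and ?g = "\<lambda>x. e * G' x"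
    have h_bound: "\<bar>?h x\<bar> \<le> e * K" if x: "x \<in> pts" for x
    proof -
      have "\<bar>?h x\<bar> \<le> e * \<bar>G' x\<bar> + e\<^sup>2 * (A x / m)"
        using A(1)[OF x] m e by (intro order_trans[OF abs_triangle_ineq4]) (simp add: abs_mult)
      also have "\<dots> \<le> e * (2 * B) + e * (D / m)"
        using G'(2)[OF x] A[OF x] m e e1 by (intro add_mono mult_mono divide_right_mono) (auto simp: power2_eq_square)
      finally show ?thesis by (simp add: K_def algebra_simps)
    qed
    have g_bound: "\<bar>?g x\<bar> \<le> e * K" if x: "x \<in> pts" for x
      using G'(1)[OF x] e by (simp add: abs_mult)
    have cube: "- ((e * K) ^ 3) \<le> t ^ 3 / 6" if "\<bar>t\<bar> \<le> e * K" for t :: real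
    proof -
      have "\<bar>t ^ 3\<bar> \<le> (e * K) ^ 3" unfolding power_abs using that by (intro power_mono) auto
      then show ?thesis by linarith
    qed
    have square: "(e * g - e\<^sup>2 * q)\<^sup>2 = e\<^sup>2 * g\<^sup>2 - 2 * e ^ 3 * (g * q) + (e\<^sup>2 * q)\<^sup>2" for g q :: real
      by (simp add: power2_eq_square power3_eq_cube algebra_simps)
    define X Y where "X = (\<integral>x. exp (?h x) \<partial>\<nu>)" and "Y = (\<integral>x. exp (- ?g x) \<partial>\<nu>)"
    have iX: "integrable \<nu> (\<lambda>x. exp (?h x))" "integrable \<nu> (\<lambda>x. exp (- ?g x))"
      using h_bound g_bound by (auto intro!: bounded_int[of _ "exp (e * K)"] simp: abs_le_iff)
    have XY: "X * Y \<le> 1"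
    proof -
      have "(\<integral>\<^sup>+x. ennreal (exp (?h x)) \<partial>\<nu>) * (\<integral>\<^sup>+x. ennreal (exp (- ?g x)) \<partial>\<nu>) \<le> 1"
      proof (rule inf_convolution)
        fix x y assume x: "x \<in> pts" and y: "y \<in> pts"
        have diff: "?h x - ?g y = e * (G x - G y) - e\<^sup>2 * (A x / m)" by (simp add: G'_def algebra_simps)
        \<comment> \<open>Near pairs are handled by \<open>lip\<close> and the arithmetic-geometric
          mean inequality, which is the origin of the coefficient \<open>A x / m\<close>. For far
          pairs boundedness of \<open>G\<close> suffices, since \<open>e\<close> makes every
          increment smaller than the quadratic cost.\<close>
        show "?h x - ?g y \<le> m / 4 * sq_dist d x y"
        proof (cases "sq_dist d x y \<le> \<delta>")
          case True
          have "G x - G y \<le> sqrt (A x * sq_dist d x y)" by (rule real_le_rsqrt[OF lip[OF x y True]])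
          also have "\<dots> = sqrt (A x) * sqrt (sq_dist d x y)" by (rule real_sqrt_mult)
          finally have "e * (G x - G y) \<le> e * (sqrt (A x) * sqrt (sq_dist d x y))" using e by simp
          also have "\<dots> \<le> e\<^sup>2 * (A x / m) + m / 4 * sq_dist d x y"
          proof -
            have "0 \<le> (e * sqrt (A x) - m / 2 * sqrt (sq_dist d x y))\<^sup>2" by simp
            also have "\<dots> = e\<^sup>2 * A x - m * (e * (sqrt (A x) * sqrt (sq_dist d x y))) + m\<^sup>2 / 4 * sq_dist d x y"
              using A(1)[OF x] sq_dist_nonneg[of d x y]
              by (simp add: power2_diff power_mult_distrib power_divide)
            finally show ?thesis using m by (simp add: field_simps power2_eq_square)
          qed
          finally show ?thesis unfolding diff by simp
        next
          case False
          have "G x - G y \<le> 2 * B" using G[OF x] G[OF y] by simp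
          then have "e * (G x - G y) \<le> e * (2 * B)" using e by simp
          also have "\<dots> \<le> m / 4 * \<delta>" by (rule e8)
          also have "\<dots> \<le> m / 4 * sq_dist d x y" using False m by simp
          finally show ?thesis unfolding diff using A(1)[OF x] m by (smt (verit) divide_nonneg_pos mult_nonneg_nonneg zero_le_power2)
        qed
      qed measurable
      then have "ennreal X * ennreal Y \<le> ennreal 1"
        unfolding X_def Y_def using iX by (simp add: nn_integral_eq_integral)
      then show ?thesis unfolding X_def Y_def by (simp add: ennreal_mult[symmetric] del: ennreal_1)
    qed
    \<comment> \<open>Second-order expansions with third-order error. The first order vanishes
      because \<open>G'\<close> has mean zero, and only \<open>?h\<close> contributes
      \<open>a / m\<close>.\<close>
    define P Q where "P = e\<^sup>2 * (V / 2 - a / m) - e ^ 3 * K'" and "Q = e\<^sup>2 * (V / 2) - e ^ 3 * K'"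
    have X: "1 + P \<le> X"
    proof -
      have pw: "1 + e * G' x - e\<^sup>2 * (A x / m) + e\<^sup>2 * ((G' x)\<^sup>2 / 2) - e ^ 3 * K' \<le> exp (?h x)"
        if x: "x \<in> pts" for x
      proof -
        have sq: "e\<^sup>2 * (G' x)\<^sup>2 - 2 * e ^ 3 * K\<^sup>2 \<le> (?h x)\<^sup>2"
        proof -
          have "(?h x)\<^sup>2 = e\<^sup>2 * (G' x)\<^sup>2 - 2 * e ^ 3 * (G' x * (A x / m)) + (e\<^sup>2 * (A x / m))\<^sup>2"
            by (rule square)
          moreover have "G' x * (A x / m) \<le> K * K"
          proof -
            have "G' x * (A x / m) \<le> \<bar>G' x\<bar> * (A x / m)" using A(1)[OF x] m by (intro mult_right_mono) auto
            also have "\<dots> \<le> K * K" using G'(1)[OF x] Am[OF x] K A(1)[OF x] m by (intro mult_mono) auto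
            finally show ?thesis .
          qed
          then have "2 * e ^ 3 * (G' x * (A x / m)) \<le> 2 * e ^ 3 * K\<^sup>2"
            using e by (intro mult_left_mono) (auto simp: power2_eq_square)
          ultimately show ?thesis by (smt (verit) zero_le_power2)
        qed
        have "1 + ?h x + (?h x)\<^sup>2 / 2 - (e * K) ^ 3 \<le> exp (?h x)"
          using exp_lower_cubic[of "?h x"] cube[OF h_bound[OF x]] by linarith
        then show ?thesis using sq by (simp add: K'_def algebra_simps power_mult_distrib)
      qed
      have "(\<integral>x. 1 + e * G' x - e\<^sup>2 * (A x / m) + e\<^sup>2 * ((G' x)\<^sup>2 / 2) - e ^ 3 * K' \<partial>\<nu>) \<le> X"
        unfolding X_def using pw iG' iA iX by (intro integral_mono) (auto simp: space_euclid)
      also have "(\<integral>x. 1 + e * G' x - e\<^sup>2 * (A x / m) + e\<^sup>2 * ((G' x)\<^sup>2 / 2) - e ^ 3 * K' \<partial>\<nu>) = 1 + P"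
        using iG' iA zero by (simp add: P_def V_def a_def algebra_simps)
      finally show ?thesis .
    qed
    have Y: "1 + Q \<le> Y"
    proof -
      have pw: "1 - e * G' x + e\<^sup>2 * ((G' x)\<^sup>2 / 2) - e ^ 3 * K' \<le> exp (- ?g x)"
        if x: "x \<in> pts" for x
      proof -
        have "\<bar>- ?g x\<bar> \<le> e * K" using g_bound[OF x] by simp
        then have "1 + - ?g x + (- ?g x)\<^sup>2 / 2 - (e * K) ^ 3 \<le> exp (- ?g x)"
          using exp_lower_cubic[of "- ?g x"] cube[of "- ?g x"] by linarith
        moreover have "(e * K) ^ 3 \<le> e ^ 3 * K'" using e by (simp add: K'_def power_mult_distrib)
        ultimately show ?thesis by (simp add: power_mult_distrib)
      qed
      have "(\<integral>x. 1 - e * G' x + e\<^sup>2 * ((G' x)\<^sup>2 / 2) - e ^ 3 * K' \<partial>\<nu>) \<le> Y"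
        unfolding Y_def using pw iG' iX by (intro integral_mono) (auto simp: space_euclid)
      also have "(\<integral>x. 1 - e * G' x + e\<^sup>2 * ((G' x)\<^sup>2 / 2) - e ^ 3 * K' \<partial>\<nu>) = 1 + Q"
        using iG' zero by (simp add: Q_def V_def algebra_simps)
      finally show ?thesis .
    qed
    have e3: "e ^ 3 * K' \<le> e\<^sup>2 * K'"
      using e e1 K' by (intro mult_right_mono) (auto simp: eval_nat_numeral mult_left_le)
    have "0 \<le> e\<^sup>2 * V" "0 \<le> e\<^sup>2 * (a / m)" "0 \<le> e\<^sup>2 * K'" "0 \<le> e ^ 3 * K'"
      using V a m K' e by auto
    moreover have "P = e\<^sup>2 * V / 2 - e\<^sup>2 * (a / m) - e ^ 3 * K'" "Q = e\<^sup>2 * V / 2 - e ^ 3 * K'"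
      "e\<^sup>2 * K'' = e\<^sup>2 * V + e\<^sup>2 * (a / m) + e\<^sup>2 * K'"
      by (simp_all add: P_def Q_def K''_def algebra_simps)
    ultimately have PQ: "\<bar>P\<bar> \<le> e\<^sup>2 * K''" "\<bar>Q\<bar> \<le> e\<^sup>2 * K''"
      using e3 unfolding abs_le_iff by linarith+
    then have pos: "0 < 1 + P" "0 < 1 + Q" using e2 by auto
    \<comment> \<open>From \<open>X * Y \<le> 1\<close> it follows that \<open>P + Q\<close> is at
      most the product of the absolute values, of fourth order in \<open>e\<close>, whereas
      \<open>P + Q\<close> equals \<open>e\<^sup>2 * (V - a / m)\<close> up to third order. Division
      by \<open>e\<^sup>2\<close> gives \<open>main\<close>.\<close>
    have "(1 + P) * (1 + Q) \<le> X * Y" using X Y pos by (intro mult_mono) auto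
    then have "P + Q \<le> - (P * Q)" using XY by (simp add: algebra_simps)
    also have "\<dots> \<le> \<bar>P\<bar> * \<bar>Q\<bar>" by (simp add: abs_mult[symmetric])
    also have "\<dots> \<le> (e\<^sup>2 * K'') * (e\<^sup>2 * K'')" using PQ K' by (intro mult_mono) auto
    also have "\<dots> \<le> e\<^sup>2 * (e * K''\<^sup>2)"
    proof -
      have "(e\<^sup>2 * K'') * (e\<^sup>2 * K'') = e\<^sup>2 * (e * (e * K''\<^sup>2))" by (simp add: power2_eq_square mult_ac)
      also have "\<dots> \<le> e\<^sup>2 * (1 * (e * K''\<^sup>2))"
        using e e1 by (intro mult_left_mono mult_right_mono) auto
      finally show ?thesis by simp
    qed
    finally have "e\<^sup>2 * (V - a / m) \<le> e\<^sup>2 * (e * R)"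
      by (simp add: P_def Q_def R_def algebra_simps eval_nat_numeral)
    then show ?thesis using e by (simp add: mult_le_cancel_left)
  qed
  have R: "0 \<le> R" using K' by (simp add: R_def)
  have "V \<le> a / m"
  proof (rule ccontr)
    assume "\<not> V \<le> a / m"
    then have "0 < V - a / m" by simp
    define e where "e = min e1 ((V - a / m) / (2 * (R + 1)))"
    have e: "0 < e" "e \<le> e1" using e1 \<open>0 < V - a / m\<close> R by (auto simp: e_def)
    have "e \<le> (V - a / m) / (2 * (R + 1))" by (simp add: e_def)
    then have "e * (2 * (R + 1)) \<le> V - a / m" using R by (subst (asm) pos_le_divide_eq) auto
    moreover have "e * (2 * (R + 1)) = 2 * (e * R) + 2 * e" by (simp add: algebra_simps)
    ultimately show False using main[OF e] e R \<open>0 < V - a / m\<close> mult_nonneg_nonneg[of e R] by linarith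
  qed
  then show ?thesis by (simp add: V_def a_def G'_def c_def)
qed

end

section \<open>Smoothing at the scale of the proposal\<close>

text \<open>The Paley--Zygmund lower bound for the probability that a standard normal variable \<open>N\<close> is at most
  \<open>-2\<close>, obtained from the second moment of \<open>exp (- 5 * N)\<close>.\<close>

definition tail_mass :: real where "tail_mass = ((exp (25/2) - exp 10) / exp 25)\<^sup>2"
text \<open>The excess over 2 is chosen for Markov's inequality: a nonnegative variable of mean 1/4
  exceeds it with probability at most \<open>tail_mass / 2\<close>.\<close>

definition cutoff_level :: real where "cutoff_level = 2 + 1 / (2 * tail_mass)"
text \<open>A lower bound for the acceptance probability wherever U rises by at most
  \<open>cutoff_level + 1\<close>.\<close>

definition accept_floor :: real where "accept_floor = exp (- (cutoff_level + 1))"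

lemma tail_mass: "0 < tail_mass" "tail_mass \<le> 1"
proof -
  have "exp 10 < exp (25/2 :: real)" by simp
  then show "0 < tail_mass" unfolding tail_mass_def by simp
  have "exp (25/2) - exp 10 \<le> (exp 25 :: real)"
    using exp_le_cancel_iff[of "25/2" "25::real"] exp_gt_zero[of "10::real"] by linarith
  then show "tail_mass \<le> 1" unfolding tail_mass_def by (simp add: power_le_one)
qed

lemma cutoff_level: "2 < cutoff_level" "cutoff_level - 2 = 1 / (2 * tail_mass)" "0 < cutoff_level"
  using tail_mass by (auto simp: cutoff_level_def add_pos_pos)

lemma accept_floor: "0 < accept_floor" "accept_floor \<le> 1"
  using cutoff_level by (auto simp: accept_floor_def)

section \<open>The Gaussian proposal and its cutoff\<close>

context convex_potential
begin

definition \<sigma> where "\<sigma> = sqrt (1 / (2 * L * real d))"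

lemma \<sigma>: "0 < \<sigma>" "\<sigma>\<^sup>2 = 1 / (2 * L * real d)" "L * \<sigma>\<^sup>2 \<le> 1 / 2" "L * real d * \<sigma>\<^sup>2 = 1 / 2"
  using d L by (auto simp: \<sigma>_def field_simps)

definition \<gamma> where "\<gamma> x = density (euclid d) (\<lambda>y. ennreal (gauss_dens d \<sigma> x y))"

lemma sets_\<gamma> [simp, measurable_cong]: "sets (\<gamma> x) = sets (euclid d)"
  and space_\<gamma> [simp]: "space (\<gamma> x) = pts"
  by (simp_all add: \<gamma>_def space_euclid)

lemma nn_integral_\<gamma>:
  "f \<in> borel_measurable (euclid d) \<Longrightarrow> (\<integral>\<^sup>+y. f y \<partial>\<gamma> x) = (\<integral>\<^sup>+y. ennreal (gauss_dens d \<sigma> x y) * f y \<partial>euclid d)"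
  unfolding \<gamma>_def by (rule nn_integral_density) auto

lemma prob_space_\<gamma>: "prob_space (\<gamma> x)"
proof
  show "emeasure (\<gamma> x) (space (\<gamma> x)) = 1"
    using nn_integral_\<gamma>[of "\<lambda>_. 1" x] nn_integral_gauss_dens[OF \<sigma>(1)] by simp
qed

lemma gaussian_\<gamma>: "gaussian d x \<sigma> = \<gamma> x"
  unfolding \<gamma>_def by (rule gaussian_eq_density[OF \<sigma>(1)])

interpretation \<gamma>: prob_space "\<gamma> x" for x by (rule prob_space_\<gamma>)

lemma integrable_\<gamma>_bounded:
  fixes f :: "_ \<Rightarrow> real"
  assumes "f \<in> borel_measurable (euclid d)" "\<And>y. y \<in> pts \<Longrightarrow> \<bar>f y\<bar> \<le> b"
  shows "integrable (\<gamma> x) f"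
  using assms by (intro \<gamma>.integrable_const_bound[of _ b]) auto

lemma square_integrable_\<gamma>_bounded:
  assumes f: "f \<in> borel_measurable (euclid d)" and b: "\<And>y. y \<in> pts \<Longrightarrow> \<bar>f y\<bar> \<le> b"
  shows "square_integrable (\<gamma> x) f"
  unfolding square_integrable_def
proof
  show "integrable (\<gamma> x) (\<lambda>y. (f y)\<^sup>2)"
  proof (rule integrable_\<gamma>_bounded)
    fix y assume "y \<in> pts"
    from power_mono[OF b[OF this], of 2] show "\<bar>(f y)\<^sup>2\<bar> \<le> b\<^sup>2" by simp
  qed (use f in measurable)
qed (use f in measurable)

lemma
  assumes [measurable]: "E \<in> sets (euclid d)"
  shows integral_\<gamma>_indicator: "(\<integral>y. c * indicator E y \<partial>\<gamma> x) = c * measure (\<gamma> x) E"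
    and integrable_\<gamma>_indicator: "integrable (\<gamma> x) (\<lambda>y. c * indicator E y)"
proof -
  have "E \<subseteq> pts" using sets.sets_into_space[OF assms] by (simp add: space_euclid)
  then have "E \<inter> pts = E" by auto
  then show "(\<integral>y. c * indicator E y \<partial>\<gamma> x) = c * measure (\<gamma> x) E" by simp
  have "integrable (\<gamma> x) (indicator E :: _ \<Rightarrow> real)"
    by (rule integrable_\<gamma>_bounded[of _ 1]) (auto simp: indicator_def)
  then show "integrable (\<gamma> x) (\<lambda>y. c * indicator E y)" by simp
qed

lemma
  shows integral_\<gamma>_exp: "(\<integral>y. exp (\<Sum>j<d. w j * (y j - x j)) \<partial>\<gamma> x) = exp (\<sigma>\<^sup>2 / 2 * (\<Sum>j<d. (w j)\<^sup>2))"
    and integrable_\<gamma>_exp: "integrable (\<gamma> x) (\<lambda>y. exp (\<Sum>j<d. w j * (y j - x j)))"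
proof -
  have [measurable]: "(\<lambda>y. \<Sum>j<d. w j * (y j - x j)) \<in> borel_measurable (euclid d)"
    by (intro borel_measurable_sum borel_measurable_times borel_measurable_diff) auto
  have *: "(\<integral>\<^sup>+y. ennreal (exp (\<Sum>j<d. w j * (y j - x j))) \<partial>\<gamma> x) = ennreal (exp (\<sigma>\<^sup>2 / 2 * (\<Sum>j<d. (w j)\<^sup>2)))"
    unfolding nn_integral_gauss_dens_exp[OF \<sigma>(1), symmetric, where d = d and w = w and x = x]
    by (subst nn_integral_\<gamma>) (auto simp: ennreal_mult gauss_dens_nonneg)
  then show i: "integrable (\<gamma> x) (\<lambda>y. exp (\<Sum>j<d. w j * (y j - x j)))"
    by (intro integrableI_nonneg) auto
  show "(\<integral>y. exp (\<Sum>j<d. w j * (y j - x j)) \<partial>\<gamma> x) = exp (\<sigma>\<^sup>2 / 2 * (\<Sum>j<d. (w j)\<^sup>2))"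
    using * by (subst integral_eq_nn_integral) auto
qed

lemma
  shows integral_\<gamma>_sq_dist: "(\<integral>y. sq_dist d x y \<partial>\<gamma> x) = d * \<sigma>\<^sup>2"
    and integrable_\<gamma>_sq_dist: "integrable (\<gamma> x) (sq_dist d x)"
proof -
  have [measurable]: "sq_dist d x \<in> borel_measurable (euclid d)"
    unfolding sq_dist_def by (intro borel_measurable_sum borel_measurable_power borel_measurable_diff) auto
  have *: "(\<integral>\<^sup>+y. ennreal (sq_dist d x y) \<partial>\<gamma> x) = ennreal (d * \<sigma>\<^sup>2)"
    unfolding nn_integral_gauss_dens_sq_dist[OF \<sigma>(1), symmetric, where d = d and x = x]
    by (subst nn_integral_\<gamma>) (auto simp: ennreal_mult gauss_dens_nonneg sq_dist_nonneg)
  then show i: "integrable (\<gamma> x) (sq_dist d x)"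
    by (intro integrableI_nonneg) (auto simp: sq_dist_nonneg)
  show "(\<integral>y. sq_dist d x y \<partial>\<gamma> x) = d * \<sigma>\<^sup>2"
    using * by (subst integral_eq_nn_integral) (auto simp: sq_dist_nonneg)
qed

definition grad_norm where "grad_norm x = L2_set (v x) {..<d}"

lemma grad_norm_nonneg: "0 \<le> grad_norm x" by (simp add: grad_norm_def)

text \<open>The gradient itself is shown to be Lipschitz with constant \<open>L\<close>. The test
  point \<open>w\<close> lies at distance \<open>D\<close> from \<open>y\<close> against the
  gradient difference \<open>h\<close>. Convexity from \<open>x\<close> to \<open>w\<close> and the
  upper bounds from \<open>y\<close> to \<open>w\<close> and from \<open>x\<close> to
  \<open>y\<close>, each with error \<open>L / 2 * D\<^sup>2\<close>, add up to
  \<open>D * H \<le> L * D\<^sup>2\<close>.\<close>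

lemma grad_norm_lipschitz:
  assumes x: "x \<in> pts" and y: "y \<in> pts"
  shows "\<bar>grad_norm y - grad_norm x\<bar> \<le> L * sqrt (sq_dist d x y)"
proof (cases "sq_dist d x y = 0")
  case True
  then have "\<forall>j<d. y j = x j" by (auto simp: sq_dist_def sum_nonneg_eq_0_iff)
  then have "y = x" by (intro extensionalityI[OF y x]) auto
  with True show ?thesis by simp
next
  case False
  define D where "D = sqrt (sq_dist d x y)"
  have D: "0 < D" "D\<^sup>2 = sq_dist d x y" using False sq_dist_nonneg[of d x y] by (auto simp: D_def less_le)
  define h where "h j = v y j - v x j" for j
  define H where "H = L2_set h {..<d}"
  have H2: "H\<^sup>2 = (\<Sum>j<d. (h j)\<^sup>2)" by (simp add: H_def L2_set_def sum_nonneg)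
  have H0: "0 \<le> H" by (simp add: H_def)
  have "H \<le> L * D"
  proof (cases "H = 0")
    case False
    then have H: "0 < H" using H0 by simp
    define t where "t = D / H"
    define w where "w = (\<lambda>j\<in>{..<d}. y j - t * h j)"
    have w: "w \<in> pts" by (simp add: w_def)
    have "sq_dist d y w = t\<^sup>2 * H\<^sup>2"
      unfolding H2 sq_dist_def w_def by (simp add: sum_distrib_left power_mult_distrib)
    also have "\<dots> = D\<^sup>2" using H by (simp add: t_def power_divide)
    finally have yw: "sq_dist d y w = D\<^sup>2" .
    have sy: "(\<Sum>j<d. v y j * (w j - y j)) = - t * (\<Sum>j<d. v y j * h j)"
      by (simp add: w_def sum_distrib_left sum_negf mult_ac)
    have sx: "(\<Sum>j<d. v x j * (w j - x j)) = (\<Sum>j<d. v x j * (y j - x j)) - t * (\<Sum>j<d. v x j * h j)"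
      unfolding sum_distrib_left sum_subtractf[symmetric] by (intro sum.cong) (auto simp: w_def algebra_simps)
    have "U w - U y - (\<Sum>j<d. v y j * (w j - y j)) \<le> L / 2 * D\<^sup>2" using upper[OF y w] yw by simp
    moreover have "0 \<le> U w - U x - (\<Sum>j<d. v x j * (w j - x j))"
      using lower[OF x w] m sq_dist_nonneg[of d x w] by (smt (verit) divide_nonneg_nonneg mult_nonneg_nonneg)
    moreover have "U y - U x - (\<Sum>j<d. v x j * (y j - x j)) \<le> L / 2 * D\<^sup>2" using upper[OF x y] D by simp
    ultimately have "t * (\<Sum>j<d. v y j * h j) - t * (\<Sum>j<d. v x j * h j) \<le> L * D\<^sup>2"
      unfolding sx sy by linarith
    then have "t * ((\<Sum>j<d. v y j * h j) - (\<Sum>j<d. v x j * h j)) \<le> L * D\<^sup>2"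
      unfolding right_diff_distrib .
    also have "(\<Sum>j<d. v y j * h j) - (\<Sum>j<d. v x j * h j) = H\<^sup>2"
      unfolding H2 sum_subtractf[symmetric] by (intro sum.cong) (auto simp: h_def power2_eq_square algebra_simps)
    finally have "D * H \<le> D * (L * D)" using H by (simp add: t_def power2_eq_square mult_ac)
    then show ?thesis using D by simp
  qed (use L D in simp)
  moreover have "grad_norm y \<le> grad_norm x + H"
  proof -
    have "grad_norm y = L2_set (\<lambda>j. v x j + h j) {..<d}" by (simp add: grad_norm_def h_def)
    also have "\<dots> \<le> grad_norm x + H" unfolding grad_norm_def H_def by (rule L2_set_triangle_ineq)
    finally show ?thesis .
  qed
  moreover have "grad_norm x \<le> grad_norm y + H"
  proof -
    have "grad_norm x = L2_set (\<lambda>j. v y j + - h j) {..<d}" by (simp add: grad_norm_def h_def)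
    also have "\<dots> \<le> grad_norm y + L2_set (\<lambda>j. - h j) {..<d}" unfolding grad_norm_def by (rule L2_set_triangle_ineq)
    also have "L2_set (\<lambda>j. - h j) {..<d} = H" by (simp add: H_def L2_set_def)
    finally show ?thesis .
  qed
  ultimately show ?thesis by (simp add: D_def abs_le_iff)
qed

text \<open>The two-sided bound puts the difference quotient with step \<open>r\<close> within
  \<open>L / 2 * r\<close> of the component of \<open>v\<close>, so that component is a limit of
  measurable functions.\<close>

lemma measurable_v: "j < d \<Longrightarrow> (\<lambda>x. v x j) \<in> borel_measurable (euclid d)"
proof -
  assume j: "j < d"
  have upd: "(\<lambda>x. x(j := x j + c)) \<in> euclid d \<rightarrow>\<^sub>M euclid d" for c
  proof -
    have "(\<lambda>x. x(j := x j + c)) \<in> PiM {..<d} (\<lambda>_. lborel) \<rightarrow>\<^sub>M PiM {..<d} (\<lambda>_. lborel)"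
    proof (rule measurable_fun_upd[where J = "{..<d}"])
      have "(\<lambda>x. x j + c) \<in> borel_measurable (euclid d)" using j by measurable
      then show "(\<lambda>x. x j + c) \<in> PiM {..<d} (\<lambda>_. lborel) \<rightarrow>\<^sub>M lborel" by (simp add: euclid_def)
    qed (use j in auto)
    then show ?thesis by (simp add: euclid_def)
  qed
  show ?thesis
  proof (rule borel_measurable_LIMSEQ_real)
    let ?q = "\<lambda>n x. real (Suc n) * (U (x(j := x j + inverse (real (Suc n)))) - U x)"
    show "?q n \<in> borel_measurable (euclid d)" for n
      using measurable_compose[OF upd U_measurable] by measurable
    fix x assume "x \<in> space (euclid d)"
    then have x: "x \<in> pts" by (simp add: space_euclid)
    have bd: "\<bar>?q n x - v x j\<bar> \<le> L / 2 * inverse (real (Suc n))" for n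
    proof -
      let ?r = "inverse (real (Suc n))"
      let ?y = "x(j := x j + ?r)"
      have y: "?y \<in> pts" using x j by (auto simp: extensional_def)
      have "(\<Sum>i<d. v x i * (?y i - x i)) = (\<Sum>i<d. if i = j then v x j * ?r else 0)"
        by (intro sum.cong) auto
      then have s: "(\<Sum>i<d. v x i * (?y i - x i)) = v x j * ?r" using j by simp
      have "sq_dist d x ?y = (\<Sum>i<d. if i = j then ?r\<^sup>2 else 0)"
        unfolding sq_dist_def by (intro sum.cong) auto
      then have q: "sq_dist d x ?y = ?r\<^sup>2" using j by simp
      have "0 \<le> U ?y - U x - v x j * ?r"
        using lower[OF x y] m unfolding s q by (smt (verit) divide_nonneg_nonneg mult_nonneg_nonneg zero_le_power2)
      then have "\<bar>U ?y - U x - v x j * ?r\<bar> \<le> L / 2 * ?r\<^sup>2" using upper[OF x y] unfolding s q by simp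
      then have "real (Suc n) * \<bar>U ?y - U x - v x j * ?r\<bar> \<le> real (Suc n) * (L / 2 * ?r\<^sup>2)"
        by (intro mult_left_mono) auto
      also have "real (Suc n) * \<bar>U ?y - U x - v x j * ?r\<bar> = \<bar>?q n x - v x j\<bar>"
      proof -
        have "real (Suc n) * (U ?y - U x - v x j * ?r) = ?q n x - v x j * (real (Suc n) * ?r)"
          unfolding right_diff_distrib by (simp only: mult_ac)
        also have "real (Suc n) * ?r = 1" by simp
        finally have e: "?q n x - v x j = real (Suc n) * (U ?y - U x - v x j * ?r)" by (simp only: mult_1_right)
        show ?thesis unfolding e by (simp only: abs_mult abs_of_nat)
      qed
      also have "real (Suc n) * (L / 2 * ?r\<^sup>2) = L / 2 * ?r" by (simp add: power2_eq_square)
      finally show ?thesis .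
    qed
    have lim: "(\<lambda>n. L / 2 * inverse (real (Suc n))) \<longlonglongrightarrow> 0"
      using tendsto_mult_right_zero[OF LIMSEQ_inverse_real_of_nat] by simp
    have "(\<lambda>n. ?q n x - v x j) \<longlonglongrightarrow> 0"
      by (rule Lim_null_comparison[OF _ lim], rule always_eventually) (intro allI, unfold real_norm_def, rule bd)
    then show "(\<lambda>n. ?q n x) \<longlonglongrightarrow> v x j" by (simp add: LIM_zero_iff)
  qed
qed

text \<open>The order of magnitude of the change of U under one proposal:
  \<open>\<sigma> * grad_norm x\<close> is the standard deviation of the linear part, and 1 accounts
  for the quadratic part.\<close>

definition scale where "scale x = 1 + \<sigma> * grad_norm x"

lemma scale_ge: "1 \<le> scale x" using \<sigma>(1) grad_norm_nonneg by (simp add: scale_def)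

lemma measurable_scale [measurable]: "scale \<in> borel_measurable (euclid d)"
proof -
  note [measurable] = measurable_v
  have "(\<lambda>x. sqrt (\<Sum>j<d. (v x j)\<^sup>2)) \<in> borel_measurable (euclid d)" by measurable
  then show ?thesis by (simp add: scale_def[abs_def] grad_norm_def[abs_def] L2_set_def)
qed

text \<open>A ramp in \<open>U y\<close> and not an indicator: a change of base point alters it by
  at most the changes of U and of \<open>scale\<close>. Its height is \<open>scale x\<close>, so
  these changes are small relative to its mean. The subtracted \<open>scale x\<close> leaves room
  for the same change in the support.\<close>

definition cutoff where "cutoff x y = min (scale x) (max 0 (cutoff_level + U x - U y - scale x))"

lemma cutoff: "0 \<le> cutoff x y" "cutoff x y \<le> scale x"
  using scale_ge[of x] by (auto simp: cutoff_def)

lemma measurable_cutoff [measurable]: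
  "(\<lambda>(x, y). cutoff x y) \<in> borel_measurable (euclid d \<Otimes>\<^sub>M euclid d)" "cutoff x \<in> borel_measurable (euclid d)"
  unfolding cutoff_def by measurable

text \<open>With a probability independent of the dimension a proposal goes downhill by two standard
  deviations of the linear part, enough to outweigh the \<open>scale x\<close> subtracted in
  \<open>cutoff\<close> and still reach the full height of the ramp. For a vanishing gradient the
  event is the whole space.\<close>

lemma prob_tail:
  shows "tail_mass \<le> measure (\<gamma> x) {y \<in> pts. (\<Sum>j<d. v x j * (y j - x j)) \<le> - 2 * \<sigma> * grad_norm x}"
proof (cases "grad_norm x = 0")
  case True
  then have "\<forall>j<d. v x j = 0" by (simp add: grad_norm_def L2_set_def sum_nonneg_eq_0_iff)
  then show ?thesis using True tail_mass \<gamma>.prob_space[of x] by simp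
next
  case False
  then have grad_norm: "0 < grad_norm x" using grad_norm_nonneg[of x] by simp
  have nv2: "(\<Sum>j<d. (v x j)\<^sup>2) = (grad_norm x)\<^sup>2" by (simp add: grad_norm_def L2_set_def sum_nonneg)
  let ?E = "{y \<in> pts. (\<Sum>j<d. v x j * (y j - x j)) \<le> - 2 * \<sigma> * grad_norm x}"
  have [measurable]: "(\<lambda>y. \<Sum>j<d. v x j * (y j - x j)) \<in> borel_measurable (euclid d)"
    by (intro borel_measurable_sum borel_measurable_times borel_measurable_diff) auto
  have E [measurable]: "?E \<in> sets (euclid d)" unfolding space_euclid[symmetric] by measurable
  \<comment> \<open>Under \<open>\<gamma> x\<close> the linear form divided by
    \<open>\<sigma> * grad_norm x\<close> is a standard normal N, so \<open>?X\<close> is exp(-5 N),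
    with mean exp(25/2) and value exp(10) at N = -2. A factor above 4 is what makes the mean exceed
    the value at the threshold; then a positive part of the mean must come from
    \<open>?E\<close>.\<close>
  define c where "c = - (5 / (\<sigma> * grad_norm x))"
  let ?X = "\<lambda>y. exp (\<Sum>j<d. (c * v x j) * (y j - x j))"
  have lin: "(\<Sum>j<d. (c * v x j) * (y j - x j)) = c * (\<Sum>j<d. v x j * (y j - x j))" for y
    by (simp add: sum_distrib_left mult_ac)
  have c2: "c\<^sup>2 * (\<sigma>\<^sup>2 * (grad_norm x)\<^sup>2) = 25" using grad_norm \<sigma>(1) by (simp add: c_def power_divide power_mult_distrib)
  have i1: "(\<integral>y. ?X y \<partial>\<gamma> x) = exp (25 / 2)"
    unfolding integral_\<gamma>_exp using c2 by (simp add: power_mult_distrib sum_distrib_left[symmetric] nv2 mult_ac)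
  have Xsq: "(?X y)\<^sup>2 = exp (\<Sum>j<d. (2 * c * v x j) * (y j - x j))" for y
    by (simp add: exp_double[symmetric] sum_distrib_left mult_ac)
  have i2: "(\<integral>y. (?X y)\<^sup>2 \<partial>\<gamma> x) = exp 50"
    unfolding Xsq integral_\<gamma>_exp using c2 by (simp add: power_mult_distrib sum_distrib_left[symmetric] nv2 mult_ac)
  have sqX: "square_integrable (\<gamma> x) ?X"
    unfolding square_integrable_def Xsq using integrable_\<gamma>_exp[THEN borel_measurable_integrable] by (auto intro: integrable_\<gamma>_exp)
  have sqE: "square_integrable (\<gamma> x) (indicator ?E)"
    by (rule square_integrable_\<gamma>_bounded[of _ 1]) (rule borel_measurable_indicator[OF E], simp add: indicator_def)
  have "exp (25 / 2) = (\<integral>y. ?X y \<partial>\<gamma> x)" using i1 by simp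
  also have "\<dots> \<le> (\<integral>y. exp 10 + ?X y * indicator ?E y \<partial>\<gamma> x)"
  proof (rule integral_mono)
    fix y assume "y \<in> space (\<gamma> x)"
    then have y: "y \<in> pts" by simp
    show "?X y \<le> exp 10 + ?X y * indicator ?E y"
    proof (cases "y \<in> ?E")
      case False
      then have "- 2 * \<sigma> * grad_norm x < (\<Sum>j<d. v x j * (y j - x j))" using y by auto
      then have "c * (\<Sum>j<d. v x j * (y j - x j)) \<le> c * (- 2 * \<sigma> * grad_norm x)"
        using grad_norm \<sigma>(1) by (intro mult_left_mono_neg) (auto simp: c_def)
      also have "\<dots> = 10" using grad_norm \<sigma>(1) by (simp add: c_def)
      finally show ?thesis using False by (simp add: lin)
    qed simp
  qed (use integrable_\<gamma>_exp square_integrable_mult[OF sqX sqE] in auto)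
  also have "\<dots> = exp 10 + (\<integral>y. ?X y * indicator ?E y \<partial>\<gamma> x)"
    using square_integrable_mult[OF sqX sqE] \<gamma>.prob_space[of x] by simp
  finally have "exp (25/2) - exp 10 \<le> (\<integral>y. ?X y * indicator ?E y \<partial>\<gamma> x)" by simp
  moreover have "0 \<le> exp (25/2) - (exp 10 :: real)" by simp
  ultimately have "(exp (25/2) - exp 10)\<^sup>2 \<le> (\<integral>y. ?X y * indicator ?E y \<partial>\<gamma> x)\<^sup>2" by (intro power_mono) auto
  also have "\<dots> \<le> (\<integral>y. (?X y)\<^sup>2 \<partial>\<gamma> x) * (\<integral>y. (indicator ?E y)\<^sup>2 \<partial>\<gamma> x)"
    by (rule Cauchy_Schwarz_integral[OF sqX sqE])
  also have "(\<lambda>y. (indicator ?E y :: real)\<^sup>2) = indicator ?E" by (auto simp: indicator_def)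
  also have "(\<integral>y. (?X y)\<^sup>2 \<partial>\<gamma> x) * (\<integral>y. indicator ?E y \<partial>\<gamma> x) = (exp 25)\<^sup>2 * measure (\<gamma> x) ?E"
    unfolding i2 integral_\<gamma>_indicator[OF E, where c = 1 and x = x, unfolded mult_1]
    by (subst exp_double[symmetric]) simp
  finally have "(exp (25/2) - exp 10)\<^sup>2 \<le> measure (\<gamma> x) ?E * (exp 25)\<^sup>2" by (simp only: mult.commute)
  then show ?thesis unfolding tail_mass_def power_divide by (rule mult_imp_div_pos_le[OF zero_less_power[OF exp_gt_zero]])
qed

text \<open>Markov's inequality. The choice of \<open>\<sigma>\<close> gives the bound on the
  quadratic part of U the mean 1/4 in every dimension.\<close>

lemma prob_far: "measure (\<gamma> x) {y \<in> pts. cutoff_level - 2 < L / 2 * sq_dist d x y} \<le> tail_mass / 2"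
proof -
  let ?E = "{y \<in> pts. cutoff_level - 2 < L / 2 * sq_dist d x y}"
  have [measurable]: "sq_dist d x \<in> borel_measurable (euclid d)"
    unfolding sq_dist_def by (intro borel_measurable_sum borel_measurable_power borel_measurable_diff) auto
  have E [measurable]: "?E \<in> sets (euclid d)" unfolding space_euclid[symmetric] by measurable
  have l: "0 < cutoff_level - 2" using cutoff_level(1) by simp
  have "(cutoff_level - 2) * measure (\<gamma> x) ?E = (\<integral>y. (cutoff_level - 2) * indicator ?E y \<partial>\<gamma> x)"
    by (rule integral_\<gamma>_indicator[OF E, symmetric])
  also have "\<dots> \<le> (\<integral>y. L / 2 * sq_dist d x y \<partial>\<gamma> x)"
    using L sq_dist_nonneg[of d x]
    by (intro integral_mono integrable_mult_right integrable_\<gamma>_sq_dist integrable_\<gamma>_indicator E)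
      (auto simp: indicator_def)
  also have "\<dots> = L * real d * \<sigma>\<^sup>2 / 2" by (simp add: integral_\<gamma>_sq_dist)
  also have "\<dots> = 1 / 4" unfolding \<sigma>(4) by simp
  finally have "measure (\<gamma> x) ?E \<le> 1 / 4 / (cutoff_level - 2)" using l by (subst pos_le_divide_eq) (simp_all only: mult.commute)
  also have "\<dots> = tail_mass / 2" using tail_mass by (simp add: cutoff_level(2))
  finally show ?thesis .
qed

definition cutoff_mean where "cutoff_mean x = (\<integral>y. cutoff x y \<partial>\<gamma> x)"

text \<open>Outside the far event and inside the downhill event, \<open>U y - U x\<close> is at most
  \<open>cutoff_level - 2 - 2 * \<sigma> * grad_norm x\<close>, and there the ramp has its full
  height \<open>scale x\<close>. That set has probability at least
  \<open>tail_mass / 2\<close>.\<close>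

lemma cutoff_mean_lower:
  assumes x: "x \<in> pts"
  shows "tail_mass / 2 * scale x \<le> cutoff_mean x"
proof -
  have [measurable]: "(\<lambda>y. \<Sum>j<d. v x j * (y j - x j)) \<in> borel_measurable (euclid d)"
    by (intro borel_measurable_sum borel_measurable_times borel_measurable_diff) auto
  have [measurable]: "sq_dist d x \<in> borel_measurable (euclid d)"
    unfolding sq_dist_def by (intro borel_measurable_sum borel_measurable_power borel_measurable_diff) auto
  let ?A = "{y \<in> pts. (\<Sum>j<d. v x j * (y j - x j)) \<le> - 2 * \<sigma> * grad_norm x}"
    and ?B = "{y \<in> pts. cutoff_level - 2 < L / 2 * sq_dist d x y}"
  have AB [measurable]: "?A \<in> sets (euclid d)" "?B \<in> sets (euclid d)" unfolding space_euclid[symmetric] by measurable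
  have "tail_mass - tail_mass / 2 \<le> measure (\<gamma> x) ?A - measure (\<gamma> x) ?B"
    using prob_tail[of x] prob_far[of x] by simp
  also have "\<dots> \<le> measure (\<gamma> x) (?A - ?B)"
    using AB \<gamma>.finite_measure_Diff'[of ?A x ?B] \<gamma>.finite_measure_mono[of "?A \<inter> ?B" ?B x]
    by (simp only: sets_\<gamma>) simp
  finally have "scale x * (tail_mass / 2) \<le> scale x * measure (\<gamma> x) (?A - ?B)" using scale_ge[of x] by (intro mult_left_mono) auto
  also have "\<dots> = (\<integral>y. scale x * indicator (?A - ?B) y \<partial>\<gamma> x)"
    using AB by (intro integral_\<gamma>_indicator[symmetric] sets.Diff)
  also have "\<dots> \<le> cutoff_mean x" unfolding cutoff_mean_def
  proof (rule integral_mono)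
    fix y assume "y \<in> space (\<gamma> x)"
    then have y: "y \<in> pts" by simp
    show "scale x * indicator (?A - ?B) y \<le> cutoff x y"
    proof (cases "y \<in> ?A - ?B")
      case True
      then have "U y - U x \<le> - 2 * \<sigma> * grad_norm x + (cutoff_level - 2)" using upper[OF x y] by auto
      then have "scale x \<le> cutoff_level + U x - U y - scale x" by (simp add: scale_def)
      then show ?thesis using True scale_ge[of x] by (auto simp: cutoff_def)
    qed (simp add: cutoff)
  next
    show "integrable (\<gamma> x) (cutoff x)" by (rule integrable_\<gamma>_bounded[of _ "scale x"]) (auto simp: cutoff)
    show "integrable (\<gamma> x) (\<lambda>y. scale x * indicator (?A - ?B) y)"
      using AB by (intro integrable_\<gamma>_indicator sets.Diff)
  qed
  finally show ?thesis by (simp add: mult.commute)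
qed

lemma accept_prob_bounds: "0 \<le> accept_prob U x y" "accept_prob U x y \<le> 1"
  by (auto simp: accept_prob_def)

lemma measurable_accept_prob [measurable]:
  "(\<lambda>(x, y). accept_prob U x y) \<in> borel_measurable (euclid d \<Otimes>\<^sub>M euclid d)"
  "accept_prob U x \<in> borel_measurable (euclid d)"
  unfolding accept_prob_def by measurable

text \<open>The slack 1/2 makes room for the supports of the cutoffs at all base points within
  distance \<open>\<sigma>\<close> of \<open>x\<close>.\<close>

definition sublevel where "sublevel x = {y \<in> pts. U y \<le> U x + cutoff_level + 1 / 2}"

lemma sublevel_sets [measurable]: "sublevel x \<in> sets (euclid d)"
  unfolding sublevel_def space_euclid[symmetric] by measurable

lemma accept_procutoff_sublevel: "y \<in> sublevel x \<Longrightarrow> accept_floor \<le> accept_prob U x y"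
  unfolding sublevel_def accept_floor_def accept_prob_def using cutoff_level(3) by auto

lemma cutoff_sublevel: "y \<in> pts \<Longrightarrow> cutoff x y \<noteq> 0 \<Longrightarrow> y \<in> sublevel x"
  using scale_ge[of x] by (auto simp: cutoff_def sublevel_def min_def max_def split: if_splits)

lemma measurable_integral_\<gamma>:
  fixes F :: "_ \<Rightarrow> _ \<Rightarrow> real"
  assumes [measurable]: "(\<lambda>(x, y). F x y) \<in> borel_measurable (euclid d \<Otimes>\<^sub>M euclid d)"
  shows "(\<lambda>x. \<integral>y. F x y \<partial>\<gamma> x) \<in> borel_measurable (euclid d)"
proof -
  have "(\<lambda>x. \<integral>y. gauss_dens d \<sigma> x y * F x y \<partial>euclid d) \<in> borel_measurable (euclid d)"
    by measurable
  also have "?this \<longleftrightarrow> ?thesis"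
  proof (rule measurable_cong)
    fix x assume "x \<in> space (euclid d)"
    then have [measurable]: "F x \<in> borel_measurable (euclid d)"
      using measurable_compose[OF measurable_Pair1' assms] by simp
    show "(\<integral>y. gauss_dens d \<sigma> x y * F x y \<partial>euclid d) = (\<integral>y. F x y \<partial>\<gamma> x)"
      unfolding \<gamma>_def by (subst integral_density) (auto simp: gauss_dens_nonneg)
  qed
  finally show ?thesis .
qed

lemma square_integrable_\<gamma>_indicator:
  assumes [measurable]: "g \<in> borel_measurable (euclid d)" and g: "\<And>y. y \<in> pts \<Longrightarrow> \<bar>g y\<bar> \<le> c"
  shows "square_integrable (\<gamma> x) (\<lambda>y. indicator (sublevel z) y * g y)"
proof (rule square_integrable_\<gamma>_bounded)
  fix y assume "y \<in> pts"
  from g[OF this] show "\<bar>indicator (sublevel z) y * g y\<bar> \<le> c" by (cases "y \<in> sublevel z") auto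
qed measurable

lemma cutoff_mean_measurable [measurable]: "cutoff_mean \<in> borel_measurable (euclid d)"
  unfolding cutoff_mean_def[abs_def] by (rule measurable_integral_\<gamma>) measurable

lemma cutoff_mean_pos: "x \<in> pts \<Longrightarrow> 0 < cutoff_mean x"
  using cutoff_mean_lower[of x] scale_ge[of x] tail_mass(1) by (smt (verit) half_gt_zero mult_pos_pos)

section \<open>Smoothing a bounded function and its local energy\<close>

context
  fixes f :: "(nat \<Rightarrow> real) \<Rightarrow> real" and B :: real
  assumes f_measurable [measurable]: "f \<in> borel_measurable (euclid d)"
    and f_bounded: "\<And>x. x \<in> pts \<Longrightarrow> \<bar>f x\<bar> \<le> B"
begin

definition smooth where "smooth x = (\<integral>y. cutoff x y * f y \<partial>\<gamma> x) / cutoff_mean x"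

text \<open>This is the integral of the squared increment against the Metropolis kernel at
  \<open>x\<close>: the atom of rejected proposals contributes nothing.\<close>

definition energy where "energy x = (\<integral>y. accept_prob U x y * (f x - f y)\<^sup>2 \<partial>\<gamma> x)"

lemma smooth_measurable [measurable]: "smooth \<in> borel_measurable (euclid d)"
proof -
  have "(\<lambda>x. \<integral>y. cutoff x y * f y \<partial>\<gamma> x) \<in> borel_measurable (euclid d)"
    by (rule measurable_integral_\<gamma>) measurable
  then show ?thesis unfolding smooth_def[abs_def] by measurable
qed

lemma energy_measurable [measurable]: "energy \<in> borel_measurable (euclid d)"
  unfolding energy_def[abs_def] by (rule measurable_integral_\<gamma>) measurable

lemma diff_bound: "x \<in> pts \<Longrightarrow> y \<in> pts \<Longrightarrow> (f x - f y)\<^sup>2 \<le> (2 * B)\<^sup>2"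
  using power_mono[of "\<bar>f x - f y\<bar>" "2 * B" 2] f_bounded[of x] f_bounded[of y] by simp

lemma integrable_energy:
  assumes "x \<in> pts"
  shows "integrable (\<gamma> x) (\<lambda>y. accept_prob U x y * (f x - f y)\<^sup>2)"
proof (rule integrable_\<gamma>_bounded[of _ "(2 * B)\<^sup>2"])
  fix y assume "y \<in> pts"
  then show "\<bar>accept_prob U x y * (f x - f y)\<^sup>2\<bar> \<le> (2 * B)\<^sup>2"
    using diff_bound[OF assms, of y] accept_prob_bounds[of x y]
      mult_mono[of "accept_prob U x y" 1 "(f x - f y)\<^sup>2" "(2 * B)\<^sup>2"] by (simp add: abs_mult)
qed measurable

lemma energy_bounds: "0 \<le> energy x" "x \<in> pts \<Longrightarrow> energy x \<le> (2 * B)\<^sup>2"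
proof -
  show "0 \<le> energy x" unfolding energy_def by (simp add: accept_prob_bounds)
  assume x: "x \<in> pts"
  have "energy x \<le> (\<integral>y. (2 * B)\<^sup>2 \<partial>\<gamma> x)"
    unfolding energy_def
  proof (rule integral_mono[OF integrable_energy[OF x]])
    fix y assume "y \<in> space (\<gamma> x)"
    then show "accept_prob U x y * (f x - f y)\<^sup>2 \<le> (2 * B)\<^sup>2"
      using diff_bound[OF x, of y] accept_prob_bounds[of x y]
        mult_mono[of "accept_prob U x y" 1 "(f x - f y)\<^sup>2" "(2 * B)\<^sup>2"] by simp
  qed simp
  also have "\<dots> = (2 * B)\<^sup>2" using \<gamma>.prob_space[of x] by simp
  finally show "energy x \<le> (2 * B)\<^sup>2" .
qed

text \<open>On \<open>sublevel x\<close> a proposal is accepted with probability at least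
  \<open>accept_floor\<close>, so the energy pays for the increments there without the acceptance
  weight.\<close>

lemma energy_sublevel:
  assumes x: "x \<in> pts"
  shows "(\<integral>y. (indicator (sublevel x) y * (f x - f y))\<^sup>2 \<partial>\<gamma> x) \<le> energy x / accept_floor"
proof -
  have "(\<integral>y. (indicator (sublevel x) y * (f x - f y))\<^sup>2 \<partial>\<gamma> x) \<le> (\<integral>y. accept_prob U x y * (f x - f y)\<^sup>2 / accept_floor \<partial>\<gamma> x)"
  proof (rule integral_mono)
    show "integrable (\<gamma> x) (\<lambda>y. (indicator (sublevel x) y * (f x - f y))\<^sup>2)"
      using diff_bound[OF x]
      by (intro integrable_\<gamma>_bounded[of _ "(2 * B)\<^sup>2"]) (measurable, auto simp: indicator_def)
    show "integrable (\<gamma> x) (\<lambda>y. accept_prob U x y * (f x - f y)\<^sup>2 / accept_floor)"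
      using integrable_energy[OF x] by simp
    fix y
    show "(indicator (sublevel x) y * (f x - f y))\<^sup>2 \<le> accept_prob U x y * (f x - f y)\<^sup>2 / accept_floor"
      using accept_procutoff_sublevel[of y x] accept_prob_bounds[of x y] accept_floor
      by (cases "y \<in> sublevel x") (auto simp: pos_le_divide_eq mult_right_mono mult.commute[of _ accept_floor])
  qed
  then show ?thesis by (simp add: energy_def)
qed

lemma cutoff_bound: "\<bar>cutoff x y\<bar> \<le> scale x"
  using cutoff[of x y] by simp

lemma smooth_bound:
  assumes x: "x \<in> pts"
  shows "\<bar>smooth x\<bar> \<le> B"
proof -
  have B: "0 \<le> B" using f_bounded[OF x] by simp
  have "\<bar>\<integral>y. cutoff x y * f y \<partial>\<gamma> x\<bar> \<le> (\<integral>y. \<bar>cutoff x y * f y\<bar> \<partial>\<gamma> x)"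
    using integral_norm_bound[of "\<gamma> x" "\<lambda>y. cutoff x y * f y"] by simp
  also have "\<dots> \<le> (\<integral>y. B * cutoff x y \<partial>\<gamma> x)"
  proof (rule integral_mono)
    show "integrable (\<gamma> x) (\<lambda>y. \<bar>cutoff x y * f y\<bar>)"
      using B cutoff_bound[of x] f_bounded scale_ge[of x]
      by (intro integrable_\<gamma>_bounded[of _ "scale x * B"]) (measurable, auto simp: abs_mult intro!: mult_mono)
    show "integrable (\<gamma> x) (\<lambda>y. B * cutoff x y)"
      using cutoff_bound[of x] by (intro integrable_mult_right integrable_\<gamma>_bounded[of _ "scale x"]) auto
    fix y assume "y \<in> space (\<gamma> x)"
    then show "\<bar>cutoff x y * f y\<bar> \<le> B * cutoff x y"
      using f_bounded[of y] cutoff[of x y] by (simp add: abs_mult mult.commute mult_right_mono)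
  qed
  also have "\<dots> = B * cutoff_mean x" by (simp add: cutoff_mean_def)
  finally show ?thesis using cutoff_mean_pos[OF x] by (simp add: smooth_def abs_divide pos_divide_le_eq)
qed

lemma integrable_cutoff_mult:
  assumes "g \<in> borel_measurable (euclid d)" "\<And>y. y \<in> pts \<Longrightarrow> \<bar>g y\<bar> \<le> c"
  shows "integrable (\<gamma> x) (\<lambda>y. cutoff x' y * g y)"
proof (rule integrable_\<gamma>_bounded[of _ "scale x' * c"])
  fix y assume "y \<in> pts"
  from assms(2)[OF this] cutoff_bound[of x' y] show "\<bar>cutoff x' y * g y\<bar> \<le> scale x' * c"
    unfolding abs_mult by (intro mult_mono) auto
qed (use assms in measurable)

text \<open>\<open>cutoff_mean x\<close> times the difference is the integral of the cutoff against
  the increments of \<open>f\<close> from \<open>x\<close>, and the cutoff lives on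
  \<open>sublevel x\<close>. In the Cauchy-Schwarz inequality the height \<open>scale x\<close> of
  the cutoff cancels against the lower bound for its mean, so that no trace of the gradient
  remains.\<close>

lemma smooth_close:
  assumes x: "x \<in> pts"
  shows "(f x - smooth x)\<^sup>2 \<le> energy x / ((tail_mass / 2)\<^sup>2 * accept_floor)"
proof -
  have ib: "integrable (\<gamma> x) (cutoff x)" using cutoff_bound[of x] by (intro integrable_\<gamma>_bounded[of _ "scale x"]) auto
  have ibf: "integrable (\<gamma> x) (\<lambda>y. cutoff x y * f y)" by (rule integrable_cutoff_mult[OF f_measurable f_bounded])
  have "cutoff_mean x * (f x - smooth x) = f x * cutoff_mean x - (\<integral>y. cutoff x y * f y \<partial>\<gamma> x)"
    using cutoff_mean_pos[OF x] by (simp add: smooth_def right_diff_distrib)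
  also have "\<dots> = (\<integral>y. f x * cutoff x y - cutoff x y * f y \<partial>\<gamma> x)"
    using ib ibf by (simp add: cutoff_mean_def)
  also have "\<dots> = (\<integral>y. cutoff x y * (indicator (sublevel x) y * (f x - f y)) \<partial>\<gamma> x)"
    using cutoff_sublevel[of _ x] by (intro Bochner_Integration.integral_cong) (auto simp: indicator_def algebra_simps)
  finally have eq: "cutoff_mean x * (f x - smooth x) = (\<integral>y. cutoff x y * (indicator (sublevel x) y * (f x - f y)) \<partial>\<gamma> x)" .
  have sqb: "square_integrable (\<gamma> x) (cutoff x)" by (rule square_integrable_\<gamma>_bounded[of _ "scale x"]) (use cutoff_bound in auto)
  have sqf: "square_integrable (\<gamma> x) (\<lambda>y. indicator (sublevel x) y * (f x - f y))"
    using f_bounded[OF x] f_bounded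
    by (intro square_integrable_\<gamma>_indicator[of _ "2 * B"]) (measurable, smt (verit))
  have "(cutoff_mean x * (f x - smooth x))\<^sup>2 \<le> (\<integral>y. (cutoff x y)\<^sup>2 \<partial>\<gamma> x) * (\<integral>y. (indicator (sublevel x) y * (f x - f y))\<^sup>2 \<partial>\<gamma> x)"
    unfolding eq by (rule Cauchy_Schwarz_integral[OF sqb sqf])
  also have "\<dots> \<le> (scale x)\<^sup>2 * (energy x / accept_floor)"
  proof (intro mult_mono energy_sublevel x)
    have "(\<integral>y. (cutoff x y)\<^sup>2 \<partial>\<gamma> x) \<le> (\<integral>y. (scale x)\<^sup>2 \<partial>\<gamma> x)"
      using sqb cutoff[of x] by (intro integral_mono) (auto simp: square_integrable_def intro!: power_mono)
    then show "(\<integral>y. (cutoff x y)\<^sup>2 \<partial>\<gamma> x) \<le> (scale x)\<^sup>2" using \<gamma>.prob_space[of x] by simp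
  qed auto
  finally have upper: "(cutoff_mean x)\<^sup>2 * (f x - smooth x)\<^sup>2 \<le> (scale x)\<^sup>2 * (energy x / accept_floor)"
    unfolding power_mult_distrib .
  have "(scale x)\<^sup>2 * ((tail_mass / 2)\<^sup>2 * (f x - smooth x)\<^sup>2) = (tail_mass / 2 * scale x)\<^sup>2 * (f x - smooth x)\<^sup>2"
    by (simp only: power_mult_distrib mult_ac)
  also have "\<dots> \<le> (cutoff_mean x)\<^sup>2 * (f x - smooth x)\<^sup>2"
    using cutoff_mean_lower[OF x] tail_mass scale_ge[of x] by (intro mult_right_mono power_mono) auto
  also note upper
  finally have "(scale x)\<^sup>2 * ((tail_mass / 2)\<^sup>2 * (f x - smooth x)\<^sup>2) \<le> (scale x)\<^sup>2 * (energy x / accept_floor)" .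
  then have "(tail_mass / 2)\<^sup>2 * (f x - smooth x)\<^sup>2 \<le> energy x / accept_floor"
    using scale_ge[of x] by (subst (asm) mult_le_cancel_left_pos) auto
  then have "(f x - smooth x)\<^sup>2 \<le> energy x / accept_floor / (tail_mass / 2)\<^sup>2"
    using tail_mass by (subst pos_le_divide_eq) (auto simp: mult.commute)
  then show ?thesis by (simp add: mult.commute)
qed

text \<open>The centre is moved from \<open>f x\<close> to \<open>smooth x\<close>, the only one for
  which the integral against \<open>cutoff x\<close> vanishes; the cost is one use of
  \<open>smooth_close\<close>.\<close>

lemma centred_sublevel:
  assumes x: "x \<in> pts"
  shows "(\<integral>y. (indicator (sublevel x) y * (f y - smooth x))\<^sup>2 \<partial>\<gamma> x) \<le> 4 * energy x / ((tail_mass / 2)\<^sup>2 * accept_floor)"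
proof -
  have sqf: "square_integrable (\<gamma> x) (\<lambda>y. indicator (sublevel x) y * (f x - f y))"
    using f_bounded[OF x] f_bounded
    by (intro square_integrable_\<gamma>_indicator[of _ "2 * B"]) (measurable, smt (verit))
  have sqg: "square_integrable (\<gamma> x) (\<lambda>y. indicator (sublevel x) y * (f y - smooth x))"
    using smooth_bound[OF x] f_bounded
    by (intro square_integrable_\<gamma>_indicator[of _ "2 * B"]) (measurable, smt (verit))
  have "(\<integral>y. (indicator (sublevel x) y * (f y - smooth x))\<^sup>2 \<partial>\<gamma> x)
    \<le> (\<integral>y. 2 * (indicator (sublevel x) y * (f x - f y))\<^sup>2 + 2 * (f x - smooth x)\<^sup>2 \<partial>\<gamma> x)"
  proof (rule integral_mono)
    fix y
    have "(f y - smooth x)\<^sup>2 \<le> 2 * (f x - f y)\<^sup>2 + 2 * (f x - smooth x)\<^sup>2"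
      using zero_le_power2[of "(f x - f y) + (f x - smooth x)"] by (simp add: power2_eq_square algebra_simps)
    then show "(indicator (sublevel x) y * (f y - smooth x))\<^sup>2 \<le>
      2 * (indicator (sublevel x) y * (f x - f y))\<^sup>2 + 2 * (f x - smooth x)\<^sup>2"
      by (simp add: indicator_def)
  qed (use sqf sqg in \<open>auto simp: square_integrable_def\<close>)
  also have "\<dots> = 2 * (\<integral>y. (indicator (sublevel x) y * (f x - f y))\<^sup>2 \<partial>\<gamma> x) + 2 * (f x - smooth x)\<^sup>2"
    using sqf \<gamma>.prob_space[of x] by (simp add: square_integrable_def)
  also have "\<dots> \<le> 2 * (energy x / accept_floor) + 2 * (energy x / ((tail_mass / 2)\<^sup>2 * accept_floor))"
    using energy_sublevel[OF x] smooth_close[OF x] by simp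
  also have "energy x / accept_floor \<le> energy x / ((tail_mass / 2)\<^sup>2 * accept_floor)"
  proof (rule divide_left_mono)
    have "(tail_mass / 2)\<^sup>2 \<le> 1" using tail_mass by (intro power_le_one) auto
    then show "(tail_mass / 2)\<^sup>2 * accept_floor \<le> accept_floor" using accept_floor by (simp add: mult_left_le_one_le)
  qed (use accept_floor tail_mass energy_bounds in auto)
  finally show ?thesis by (simp add: mult.commute)
qed

text \<open>Changing the base point of the smoothing kernel is a first-order perturbation in \<open>L\<^sup>2(\<gamma> x)\<close>: the Gaussian
  factor by its chi-square divergence, the cutoff because the scale \<open>scale\<close> dominates the variation of \<open>U\<close>.\<close>

lemma smooth_lipschitz:
  assumes x: "x \<in> pts" and x': "x' \<in> pts" and close: "sq_dist d x x' \<le> \<sigma>\<^sup>2"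
  shows "(smooth x - smooth x')\<^sup>2 \<le> 144 * energy x / ((tail_mass / 2) ^ 4 * accept_floor * \<sigma>\<^sup>2) * sq_dist d x x'"
proof -
  define p where "p = tail_mass / 2"
  have p: "0 < p" using tail_mass by (simp add: p_def)
  \<comment> \<open>The displacement of the base point in units of the proposal scale, at most
    1.\<close>
  define \<rho> where "\<rho> = sqrt (sq_dist d x x') / \<sigma>"
  have \<rho>0: "0 \<le> \<rho>" using \<sigma>(1) by (simp add: \<rho>_def sq_dist_nonneg)
  have \<rho>2: "\<rho>\<^sup>2 = sq_dist d x x' / \<sigma>\<^sup>2" by (simp add: \<rho>_def power_divide sq_dist_nonneg)
  have D: "sqrt (sq_dist d x x') = \<rho> * \<sigma>" using \<sigma>(1) by (simp add: \<rho>_def)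
  have D2: "sq_dist d x x' = \<rho>\<^sup>2 * \<sigma>\<^sup>2" using \<sigma>(1) by (simp add: \<rho>2)
  have "\<rho>\<^sup>2 \<le> 1" using close \<sigma>(1) by (simp add: \<rho>2)
  then have \<rho>1: "\<rho> \<le> 1" using \<rho>0 by (simp add: power_le_one_iff)
  have \<rho>sq: "\<rho>\<^sup>2 \<le> \<rho>" using \<rho>0 \<rho>1 by (simp add: power2_eq_square mult_left_le)
  have sdiff: "\<bar>scale x' - scale x\<bar> \<le> \<rho> / 2"
  proof -
    have "\<bar>scale x' - scale x\<bar> = \<sigma> * \<bar>grad_norm x' - grad_norm x\<bar>"
      using \<sigma>(1) by (simp add: scale_def abs_mult right_diff_distrib[symmetric])
    also have "\<dots> \<le> \<sigma> * (L * (\<rho> * \<sigma>))" using grad_norm_lipschitz[OF x x'] \<sigma>(1) unfolding D by simp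
    also have "\<dots> = (L * \<sigma>\<^sup>2) * \<rho>" by (simp add: power2_eq_square)
    also have "\<dots> \<le> 1 / 2 * \<rho>" using \<sigma>(3) \<rho>0 by (rule mult_right_mono)
    finally show ?thesis by simp
  qed
  have s1: "1 \<le> scale x" "1 \<le> scale x'" by (rule scale_ge)+
  have s2: "scale x \<le> 2 * scale x'" using sdiff \<rho>1 s1 by linarith
  have lin: "\<bar>\<Sum>j<d. v x j * (x' j - x j)\<bar> \<le> \<rho> * (\<sigma> * grad_norm x)"
    using sum_mult_le_sqrt[of "v x" x' x d] unfolding D grad_norm_def by (simp add: mult_ac)
  have Udiff: "\<bar>U x' - U x\<bar> \<le> \<rho> * scale x"
  proof -
    have "L / 2 * sq_dist d x x' = (L * \<sigma>\<^sup>2) * \<rho>\<^sup>2 / 2" unfolding D2 by simp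
    also have "\<dots> \<le> 1 / 2 * \<rho> / 2"
      using \<sigma>(3) \<rho>sq \<rho>0 L by (intro divide_right_mono mult_mono) auto
    finally have "U x' - U x \<le> \<rho> * (\<sigma> * grad_norm x) + \<rho>" using upper[OF x x'] lin \<rho>0 by linarith
    moreover have "0 \<le> m / 2 * sq_dist d x x'" using m sq_dist_nonneg by simp
    then have "- (\<rho> * (\<sigma> * grad_norm x)) \<le> U x' - U x" using lower[OF x x'] lin by linarith
    ultimately show ?thesis using \<rho>0 by (simp add: scale_def abs_le_iff algebra_simps)
  qed
  have \<rho>scale: "\<rho> * scale x \<le> scale x" using \<rho>1 s1 by (simp add: mult_left_le_one_le \<rho>0)
  \<comment> \<open>The moved cutoff is still supported in \<open>sublevel x\<close>, so
    \<open>F\<close> is integrated only where the energy at \<open>x\<close> controls it.\<close>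
  have b': "y \<in> sublevel x" if "y \<in> pts" "cutoff x' y \<noteq> 0" for y
  proof -
    have "U y < cutoff_level + U x' - scale x'" using that s1 by (auto simp: cutoff_def min_def max_def split: if_splits)
    then have "U y \<le> U x + cutoff_level + 1 / 2" using Udiff sdiff \<rho>scale \<rho>1 by linarith
    then show ?thesis using that by (simp add: sublevel_def)
  qed
  have bdiff: "\<bar>cutoff x' y - cutoff x y\<bar> \<le> 2 * \<rho> * scale x" for y
  proof -
    have "\<bar>cutoff x' y - cutoff x y\<bar> \<le> \<bar>U x' - U x\<bar> + \<bar>scale x' - scale x\<bar>" unfolding cutoff_def by linarith
    moreover have "\<rho> \<le> \<rho> * scale x" using \<rho>0 s1 by (simp add: mult_le_cancel_left1)
    ultimately show ?thesis using Udiff sdiff \<rho>0 by linarith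
  qed
  define w where "w j = (x' j - x j) / \<sigma>\<^sup>2" for j
  \<comment> \<open>The likelihood ratio of \<open>\<gamma> x'\<close> to \<open>\<gamma> x\<close>.
    It has mean 1 and second moment \<open>exp (\<rho>\<^sup>2)\<close>, hence chi-square divergence
    at most \<open>2 * \<rho>\<^sup>2\<close>.\<close>
  define R where "R y = exp (\<Sum>j<d. w j * (y j - x j)) * exp (- (\<rho>\<^sup>2 / 2))" for y
  have wsq: "\<sigma>\<^sup>2 * (\<Sum>j<d. (w j)\<^sup>2) = \<rho>\<^sup>2"
  proof -
    have "(\<Sum>j<d. (w j)\<^sup>2) = sq_dist d x x' / (\<sigma>\<^sup>2)\<^sup>2" unfolding w_def sq_dist_def power_divide sum_divide_distrib ..
    then show ?thesis unfolding \<rho>2 using \<sigma>(1) by (simp add: power2_eq_square)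
  qed
  have [measurable]: "(\<lambda>y. \<Sum>j<d. w j * (y j - x j)) \<in> borel_measurable (euclid d)"
    by (intro borel_measurable_sum borel_measurable_times borel_measurable_diff) auto
  have [measurable]: "R \<in> borel_measurable (euclid d)" unfolding R_def by measurable
  have R0: "0 \<le> R y" for y by (simp add: R_def)
  have dens: "\<gamma> x' = density (\<gamma> x) (\<lambda>y. ennreal (R y))"
  proof -
    have "gauss_dens d \<sigma> x' y = gauss_dens d \<sigma> x y * R y" for y
    proof -
      have "(\<Sum>j<d. (x' j - x j) * (y j - x j)) / \<sigma>\<^sup>2 - sq_dist d x x' / (2 * \<sigma>\<^sup>2) = (\<Sum>j<d. w j * (y j - x j)) + - (\<rho>\<^sup>2 / 2)"
        by (simp add: w_def \<rho>2 sum_divide_distrib)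
      then show ?thesis by (simp only: gauss_dens_ratio[OF \<sigma>(1), of d x' y x] R_def exp_add)
    qed
    then have "\<gamma> x' = density (euclid d) (\<lambda>y. ennreal (gauss_dens d \<sigma> x y) * ennreal (R y))"
      unfolding \<gamma>_def by (simp add: ennreal_mult gauss_dens_nonneg R0)
    also have "\<dots> = density (\<gamma> x) (\<lambda>y. ennreal (R y))"
      unfolding \<gamma>_def by (subst density_density_eq) auto
    finally show ?thesis .
  qed
  have ER: "(\<integral>y. R y \<partial>\<gamma> x) = 1" "integrable (\<gamma> x) R"
  proof -
    show "integrable (\<gamma> x) R" unfolding R_def by (intro integrable_mult_left integrable_\<gamma>_exp)
    have "(\<integral>y. R y \<partial>\<gamma> x) = exp (\<sigma>\<^sup>2 / 2 * (\<Sum>j<d. (w j)\<^sup>2)) * exp (- (\<rho>\<^sup>2 / 2))"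
      unfolding R_def by (simp add: integral_\<gamma>_exp)
    then show "(\<integral>y. R y \<partial>\<gamma> x) = 1" using wsq by (simp add: exp_add[symmetric])
  qed
  have Rsq: "(R y)\<^sup>2 = exp (\<Sum>j<d. (2 * w j) * (y j - x j)) * exp (- \<rho>\<^sup>2)" for y
    by (simp add: R_def exp_double[symmetric] exp_add[symmetric] sum_distrib_left mult_ac)
  have ER2: "(\<integral>y. (R y)\<^sup>2 \<partial>\<gamma> x) = exp (\<rho>\<^sup>2)" "integrable (\<gamma> x) (\<lambda>y. (R y)\<^sup>2)"
  proof -
    show "integrable (\<gamma> x) (\<lambda>y. (R y)\<^sup>2)" unfolding Rsq by (intro integrable_mult_left integrable_\<gamma>_exp)
    have "(\<integral>y. (R y)\<^sup>2 \<partial>\<gamma> x) = exp (\<sigma>\<^sup>2 / 2 * (\<Sum>j<d. (2 * w j)\<^sup>2)) * exp (- \<rho>\<^sup>2)"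
      unfolding Rsq by (simp add: integral_\<gamma>_exp)
    also have "\<sigma>\<^sup>2 / 2 * (\<Sum>j<d. (2 * w j)\<^sup>2) = 2 * \<rho>\<^sup>2"
      using wsq by (simp add: power_mult_distrib sum_distrib_left[symmetric])
    finally show "(\<integral>y. (R y)\<^sup>2 \<partial>\<gamma> x) = exp (\<rho>\<^sup>2)" by (simp add: exp_add[symmetric])
  qed
  have sqR: "square_integrable (\<gamma> x) (\<lambda>y. R y - 1)"
  proof -
    have "square_integrable (\<gamma> x) R" using ER2 by (simp add: square_integrable_def)
    from square_integrable_lincomb[OF this \<gamma>.square_integrable_const[of x 1], of 1 "-1"] show ?thesis by simp
  qed
  have chi: "(\<integral>y. (R y - 1)\<^sup>2 \<partial>\<gamma> x) \<le> 2 * \<rho>\<^sup>2"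
  proof -
    have "(\<integral>y. (R y - 1)\<^sup>2 \<partial>\<gamma> x) = (\<integral>y. (R y)\<^sup>2 - 2 * R y + 1 \<partial>\<gamma> x)"
      by (intro Bochner_Integration.integral_cong) (auto simp: power2_diff)
    also have "\<dots> = exp (\<rho>\<^sup>2) - 1" using ER ER2 \<gamma>.prob_space[of x] by simp
    also have "\<dots> \<le> \<rho>\<^sup>2 + (\<rho>\<^sup>2)\<^sup>2" using exp_bound[of "\<rho>\<^sup>2"] \<open>\<rho>\<^sup>2 \<le> 1\<close> by simp
    also have "(\<rho>\<^sup>2)\<^sup>2 \<le> \<rho>\<^sup>2"
      using mult_left_mono[OF \<open>\<rho>\<^sup>2 \<le> 1\<close>, of "\<rho>\<^sup>2"] unfolding power2_eq_square[of "\<rho>\<^sup>2"] by simp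
    finally show ?thesis by simp
  qed
  \<comment> \<open>Centring at \<open>smooth x\<close> makes the integral of
    \<open>cutoff x y * F y\<close> under \<open>\<gamma> x\<close> vanish; the difference
    \<open>smooth x' - smooth x\<close> is then an effect of the moved base point alone.\<close>
  define F where "F y = f y - smooth x" for y
  have [measurable]: "F \<in> borel_measurable (euclid d)" unfolding F_def by measurable
  have Fb: "\<bar>F y\<bar> \<le> 2 * B" if "y \<in> pts" for y
    using f_bounded[OF that] smooth_bound[OF x] by (simp add: F_def)
  define M where "M = (\<integral>y. (indicator (sublevel x) y * F y)\<^sup>2 \<partial>\<gamma> x)"
  have M0: "0 \<le> M" by (simp add: M_def)
  have M: "M \<le> 4 * energy x / (p\<^sup>2 * accept_floor)" using centred_sublevel[OF x] by (simp add: M_def F_def p_def)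
  have sqF: "square_integrable (\<gamma> x) (\<lambda>y. indicator (sublevel x) y * F y)"
    by (rule square_integrable_\<gamma>_indicator[of _ "2 * B"]) (measurable, rule Fb)
  have sqbF: "square_integrable (\<gamma> x) (\<lambda>y. cutoff x' y * F y)"
  proof (rule square_integrable_\<gamma>_bounded[of _ "scale x' * (2 * B)"])
    fix y assume "y \<in> pts"
    from Fb[OF this] cutoff_bound[of x' y] show "\<bar>cutoff x' y * F y\<bar> \<le> scale x' * (2 * B)"
      unfolding abs_mult by (intro mult_mono) auto
  qed measurable
  have ib: "integrable (\<gamma> z) (cutoff z')" for z z' using cutoff_bound[of z'] by (intro integrable_\<gamma>_bounded[of _ "scale z'"]) auto
  have ibF: "integrable (\<gamma> z) (\<lambda>y. cutoff z' y * F y)" for z z' by (rule integrable_cutoff_mult[OF _ Fb]) measurable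
  have ibf: "integrable (\<gamma> z) (\<lambda>y. cutoff z' y * f y)" for z z' by (rule integrable_cutoff_mult[OF f_measurable f_bounded])
  have NG: "(\<integral>y. cutoff z y * F y \<partial>\<gamma> z) = cutoff_mean z * (smooth z - smooth x)" if z: "z \<in> pts" for z
  proof -
    have "(\<integral>y. cutoff z y * F y \<partial>\<gamma> z) = (\<integral>y. cutoff z y * f y - cutoff z y * smooth x \<partial>\<gamma> z)"
      by (simp add: F_def right_diff_distrib)
    also have "\<dots> = (\<integral>y. cutoff z y * f y \<partial>\<gamma> z) - cutoff_mean z * smooth x" using ib ibf by (simp add: cutoff_mean_def)
    finally show ?thesis using cutoff_mean_pos[OF z] by (simp add: smooth_def right_diff_distrib)
  qed
  have "cutoff_mean x' * (smooth x' - smooth x) = (\<integral>y. R y * (cutoff x' y * F y) \<partial>\<gamma> x)"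
    unfolding NG[OF x', symmetric] dens by (subst integral_density) (auto simp: R0)
  also have "\<dots> = (\<integral>y. R y * (cutoff x' y * F y) \<partial>\<gamma> x) - (\<integral>y. cutoff x y * F y \<partial>\<gamma> x)" using NG[OF x] by simp
  \<comment> \<open>The integral subtracted just before is zero. The difference splits into the
    change of density against the new cutoff and the change of cutoff against the old
    density.\<close>
  also have "\<dots> = (\<integral>y. (R y - 1) * (cutoff x' y * F y) + (cutoff x' y - cutoff x y) * (indicator (sublevel x) y * F y) \<partial>\<gamma> x)"
  proof -
    have "integrable (\<gamma> x) (\<lambda>y. R y * (cutoff x' y * F y))"
      using Bochner_Integration.integrable_add[OF square_integrable_mult[OF sqR sqbF] ibF[of x x']] by (simp add: algebra_simps)
    then have "(\<integral>y. R y * (cutoff x' y * F y) \<partial>\<gamma> x) - (\<integral>y. cutoff x y * F y \<partial>\<gamma> x) = (\<integral>y. R y * (cutoff x' y * F y) - cutoff x y * F y \<partial>\<gamma> x)"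
      using ibF by simp
    also have "\<dots> = (\<integral>y. (R y - 1) * (cutoff x' y * F y) + (cutoff x' y - cutoff x y) * (indicator (sublevel x) y * F y) \<partial>\<gamma> x)"
    proof (intro Bochner_Integration.integral_cong refl)
      fix y assume "y \<in> space (\<gamma> x)"
      then have "y \<notin> sublevel x \<Longrightarrow> cutoff x' y = 0 \<and> cutoff x y = 0" using b'[of y] cutoff_sublevel[of y x] by auto
      then show "R y * (cutoff x' y * F y) - cutoff x y * F y
          = (R y - 1) * (cutoff x' y * F y) + (cutoff x' y - cutoff x y) * (indicator (sublevel x) y * F y)"
        by (cases "y \<in> sublevel x") (auto simp: algebra_simps)
    qed
    finally show ?thesis .
  qed
  also have "\<dots> = (\<integral>y. (R y - 1) * (cutoff x' y * F y) \<partial>\<gamma> x) + (\<integral>y. (cutoff x' y - cutoff x y) * (indicator (sublevel x) y * F y) \<partial>\<gamma> x)"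
  proof (rule Bochner_Integration.integral_add[OF square_integrable_mult[OF sqR sqbF]])
    have "square_integrable (\<gamma> x) (\<lambda>y. cutoff x' y - cutoff x y)"
      by (rule square_integrable_\<gamma>_bounded[of _ "2 * \<rho> * scale x"]) (measurable, rule bdiff)
    from square_integrable_mult[OF this sqF] show "integrable (\<gamma> x) (\<lambda>y. (cutoff x' y - cutoff x y) * (indicator (sublevel x) y * F y))" .
  qed
  finally have split: "cutoff_mean x' * (smooth x' - smooth x) =
    (\<integral>y. (R y - 1) * (cutoff x' y * F y) \<partial>\<gamma> x) + (\<integral>y. (cutoff x' y - cutoff x y) * (indicator (sublevel x) y * F y) \<partial>\<gamma> x)" (is "_ = ?I + ?J") .
  have I: "?I\<^sup>2 \<le> 2 * \<rho>\<^sup>2 * ((scale x')\<^sup>2 * M)"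
  proof -
    have "?I\<^sup>2 \<le> (\<integral>y. (R y - 1)\<^sup>2 \<partial>\<gamma> x) * (\<integral>y. (cutoff x' y * F y)\<^sup>2 \<partial>\<gamma> x)"
      by (rule Cauchy_Schwarz_integral[OF sqR sqbF])
    also have "\<dots> \<le> 2 * \<rho>\<^sup>2 * ((scale x')\<^sup>2 * M)"
    proof (rule mult_mono[OF chi])
      have "(\<integral>y. (cutoff x' y * F y)\<^sup>2 \<partial>\<gamma> x) \<le> (\<integral>y. (scale x')\<^sup>2 * (indicator (sublevel x) y * F y)\<^sup>2 \<partial>\<gamma> x)"
      proof (rule integral_mono)
        fix y assume "y \<in> space (\<gamma> x)"
        then show "(cutoff x' y * F y)\<^sup>2 \<le> (scale x')\<^sup>2 * (indicator (sublevel x) y * F y)\<^sup>2"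
          using b'[of y] cutoff[of x' y] by (cases "cutoff x' y = 0")
            (auto simp: power_mult_distrib intro!: mult_right_mono power_mono)
      qed (use sqF sqbF in \<open>auto simp: square_integrable_def\<close>)
      then show "(\<integral>y. (cutoff x' y * F y)\<^sup>2 \<partial>\<gamma> x) \<le> (scale x')\<^sup>2 * M" by (simp add: M_def)
    qed auto
    finally show ?thesis .
  qed
  have J: "?J\<^sup>2 \<le> 16 * \<rho>\<^sup>2 * ((scale x')\<^sup>2 * M)"
  proof -
    have sqd: "square_integrable (\<gamma> x) (\<lambda>y. cutoff x' y - cutoff x y)"
      by (rule square_integrable_\<gamma>_bounded[of _ "2 * \<rho> * scale x"]) (measurable, rule bdiff)
    have "?J\<^sup>2 \<le> (\<integral>y. (cutoff x' y - cutoff x y)\<^sup>2 \<partial>\<gamma> x) * M"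
      unfolding M_def by (rule Cauchy_Schwarz_integral[OF sqd sqF])
    also have "\<dots> \<le> (16 * \<rho>\<^sup>2 * (scale x')\<^sup>2) * M"
    proof (rule mult_right_mono[OF _ M0])
      have bb: "(cutoff x' y - cutoff x y)\<^sup>2 \<le> 16 * \<rho>\<^sup>2 * (scale x')\<^sup>2" for y
      proof -
        have "2 * \<rho> * scale x \<le> 2 * \<rho> * (2 * scale x')" using s2 \<rho>0 by (intro mult_left_mono) auto
        then have "\<bar>cutoff x' y - cutoff x y\<bar> \<le> 4 * \<rho> * scale x'" using bdiff[of y] by linarith
        from power_mono[OF this, of 2] show ?thesis by (simp add: power_mult_distrib)
      qed
      have "(\<integral>y. (cutoff x' y - cutoff x y)\<^sup>2 \<partial>\<gamma> x) \<le> (\<integral>y. 16 * \<rho>\<^sup>2 * (scale x')\<^sup>2 \<partial>\<gamma> x)"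
        using sqd by (intro integral_mono bb) (auto simp: square_integrable_def)
      then show "(\<integral>y. (cutoff x' y - cutoff x y)\<^sup>2 \<partial>\<gamma> x) \<le> 16 * \<rho>\<^sup>2 * (scale x')\<^sup>2" using \<gamma>.prob_space[of x] by simp
    qed
    finally show ?thesis by (simp add: mult_ac)
  qed
  have "(p * scale x')\<^sup>2 * (smooth x' - smooth x)\<^sup>2 \<le> (cutoff_mean x')\<^sup>2 * (smooth x' - smooth x)\<^sup>2"
    using cutoff_mean_lower[OF x'] p s1 by (intro mult_right_mono power_mono) (auto simp: p_def)
  also have "\<dots> = (?I + ?J)\<^sup>2" unfolding split[symmetric] by (simp add: power_mult_distrib)
  also have "\<dots> \<le> 2 * ?I\<^sup>2 + 2 * ?J\<^sup>2"
    using zero_le_power2[of "?I - ?J"] unfolding power2_sum power2_diff by linarith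
  \<comment> \<open>Doubling 2 and 16 gives 36; the factor 4 of \<open>centred_sublevel\<close>
    turns it into the constant 144.\<close>
  also have "\<dots> \<le> 36 * \<rho>\<^sup>2 * ((scale x')\<^sup>2 * M)" using I J by linarith
  also have "\<dots> \<le> 36 * \<rho>\<^sup>2 * ((scale x')\<^sup>2 * (4 * energy x / (p\<^sup>2 * accept_floor)))"
    using M by (intro mult_left_mono) auto
  also have "(p * scale x')\<^sup>2 * (smooth x' - smooth x)\<^sup>2 = (scale x')\<^sup>2 * (p\<^sup>2 * (smooth x' - smooth x)\<^sup>2)"
    by (simp only: power_mult_distrib mult_ac)
  also have "36 * \<rho>\<^sup>2 * ((scale x')\<^sup>2 * (4 * energy x / (p\<^sup>2 * accept_floor))) = (scale x')\<^sup>2 * (144 * \<rho>\<^sup>2 * energy x / (p\<^sup>2 * accept_floor))"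
    by simp
  finally have "(scale x')\<^sup>2 * (p\<^sup>2 * (smooth x' - smooth x)\<^sup>2) \<le> (scale x')\<^sup>2 * (144 * \<rho>\<^sup>2 * energy x / (p\<^sup>2 * accept_floor))" .
  then have "p\<^sup>2 * (smooth x' - smooth x)\<^sup>2 \<le> 144 * \<rho>\<^sup>2 * energy x / (p\<^sup>2 * accept_floor)"
    using s1 by (subst (asm) mult_le_cancel_left_pos) auto
  then have "(smooth x' - smooth x)\<^sup>2 \<le> 144 * \<rho>\<^sup>2 * energy x / (p\<^sup>2 * accept_floor) / p\<^sup>2"
    using p by (subst pos_le_divide_eq) (auto simp: mult.commute)
  also have "\<dots> = 144 * energy x / (p ^ 4 * accept_floor * \<sigma>\<^sup>2) * sq_dist d x x'"
    unfolding \<rho>2 by (simp add: field_simps power4_eq_xxxx power2_eq_square)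
  finally show ?thesis by (simp add: p_def power2_commute)
qed

text \<open>The variance of \<open>f\<close> is at most twice its squared distance from
  \<open>smooth\<close> plus twice the variance of \<open>smooth\<close>; the latter follows from
  \<open>variance_le\<close> with coefficient \<open>energy x / \<sigma>\<^sup>2\<close> up to
  constants. As \<open>1 / \<sigma>\<^sup>2\<close> is \<open>2 * L * d\<close>, this part
  contributes 576; the other part contributes 2 because \<open>m \<le> L * d\<close>.\<close>

lemma variance_le_energy:
  "(\<integral>x. (f x - (\<integral>x. f x \<partial>\<nu>))\<^sup>2 \<partial>\<nu>) \<le> 578 * L * d / (m * (tail_mass / 2) ^ 4 * accept_floor) * (\<integral>x. energy x \<partial>\<nu>)"
proof -
  define p where "p = tail_mass / 2"
  have p: "0 < p" "p \<le> 1" using tail_mass by (auto simp: p_def)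
  note k = accept_floor
  have bounded_int: "integrable \<nu> g" if "g \<in> borel_measurable (euclid d)" "\<And>x. x \<in> pts \<Longrightarrow> \<bar>g x\<bar> \<le> c" for g :: "_ \<Rightarrow> real" and c
    using that by (intro \<nu>.integrable_const_bound[of _ c]) (auto simp: space_euclid)
  have iE: "integrable \<nu> energy"
    by (rule bounded_int[of _ "(2 * B)\<^sup>2"]) (use energy_bounds in auto)
  have if': "integrable \<nu> f" by (rule bounded_int[OF f_measurable f_bounded])
  have sq_bound: "\<bar>(a - c)\<^sup>2\<bar> \<le> (2 * B)\<^sup>2" if "\<bar>a\<bar> \<le> B" "\<bar>c\<bar> \<le> B" for a c
    using power_mono[of "\<bar>a - c\<bar>" "2 * B" 2] that by simp
  define c where "c = (\<integral>x. smooth x \<partial>\<nu>)"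
  have iG: "integrable \<nu> smooth" by (rule bounded_int[OF smooth_measurable smooth_bound])
  have cB: "\<bar>c\<bar> \<le> B"
  proof -
    have "\<bar>c\<bar> \<le> (\<integral>x. \<bar>smooth x\<bar> \<partial>\<nu>)" unfolding c_def using integral_norm_bound[of \<nu> smooth] by simp
    also have "\<dots> \<le> (\<integral>x. B \<partial>\<nu>)" using iG smooth_bound by (intro integral_mono) (auto simp: space_euclid)
    finally show ?thesis by simp
  qed
  have i1: "integrable \<nu> (\<lambda>x. (f x - c)\<^sup>2)" "integrable \<nu> (\<lambda>x. (f x - smooth x)\<^sup>2)" "integrable \<nu> (\<lambda>x. (smooth x - c)\<^sup>2)"
  proof -
    show "integrable \<nu> (\<lambda>x. (f x - c)\<^sup>2)"
      by (rule bounded_int[of _ "(2 * B)\<^sup>2"]) (measurable, intro sq_bound f_bounded cB)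
    show "integrable \<nu> (\<lambda>x. (f x - smooth x)\<^sup>2)"
      by (rule bounded_int[of _ "(2 * B)\<^sup>2"]) (measurable, intro sq_bound f_bounded smooth_bound)
    show "integrable \<nu> (\<lambda>x. (smooth x - c)\<^sup>2)"
      by (rule bounded_int[of _ "(2 * B)\<^sup>2"]) (measurable, intro sq_bound smooth_bound cB)
  qed
  let ?\<mu> = "\<integral>x. f x \<partial>\<nu>"
  \<comment> \<open>The mean of \<open>f\<close> is the best constant, so the mean \<open>c\<close>
    of \<open>smooth\<close> may replace it.\<close>
  have "(\<integral>x. (f x - ?\<mu>)\<^sup>2 \<partial>\<nu>) \<le> (\<integral>x. (f x - c)\<^sup>2 \<partial>\<nu>)"
  proof -
    have if2: "integrable \<nu> (\<lambda>x. (f x - ?\<mu>)\<^sup>2)"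
    proof -
      have "integrable \<nu> (\<lambda>x. (f x - c)\<^sup>2 + 2 * (c - ?\<mu>) * f x + (?\<mu>\<^sup>2 - c\<^sup>2))" using i1 if' by simp
      then show ?thesis by (simp add: power2_eq_square algebra_simps)
    qed
    have "(\<integral>x. (f x - c)\<^sup>2 \<partial>\<nu>) = (\<integral>x. (f x - ?\<mu>)\<^sup>2 + 2 * (?\<mu> - c) * (f x - ?\<mu>) + (?\<mu> - c)\<^sup>2 \<partial>\<nu>)"
      by (intro Bochner_Integration.integral_cong) (auto simp: power2_eq_square algebra_simps)
    also have "\<dots> = (\<integral>x. (f x - ?\<mu>)\<^sup>2 \<partial>\<nu>) + (?\<mu> - c)\<^sup>2" using if' if2 by simp
    finally show ?thesis by simp
  qed
  also have "\<dots> \<le> (\<integral>x. 2 * (f x - smooth x)\<^sup>2 + 2 * (smooth x - c)\<^sup>2 \<partial>\<nu>)"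
  proof (rule integral_mono)
    fix x
    show "(f x - c)\<^sup>2 \<le> 2 * (f x - smooth x)\<^sup>2 + 2 * (smooth x - c)\<^sup>2"
      using zero_le_power2[of "(f x - smooth x) - (smooth x - c)"] by (simp add: power2_eq_square algebra_simps)
  qed (use i1 in auto)
  also have "\<dots> = 2 * (\<integral>x. (f x - smooth x)\<^sup>2 \<partial>\<nu>) + 2 * (\<integral>x. (smooth x - c)\<^sup>2 \<partial>\<nu>)" using i1 by simp
  also have "\<dots> \<le> 2 * (\<integral>x. energy x / (p\<^sup>2 * accept_floor) \<partial>\<nu>) + 2 * ((\<integral>x. 144 * energy x / (p ^ 4 * accept_floor * \<sigma>\<^sup>2) \<partial>\<nu>) / m)"
  proof (intro add_mono mult_left_mono)
    show "(\<integral>x. (f x - smooth x)\<^sup>2 \<partial>\<nu>) \<le> (\<integral>x. energy x / (p\<^sup>2 * accept_floor) \<partial>\<nu>)"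
      using i1 iE smooth_close by (intro integral_mono) (auto simp: p_def space_euclid)
    show "(\<integral>x. (smooth x - c)\<^sup>2 \<partial>\<nu>) \<le> (\<integral>x. 144 * energy x / (p ^ 4 * accept_floor * \<sigma>\<^sup>2) \<partial>\<nu>) / m"
      unfolding c_def
    proof (rule variance_le[where \<delta> = "\<sigma>\<^sup>2"])
      fix x assume x: "x \<in> pts"
      show "0 \<le> 144 * energy x / (p ^ 4 * accept_floor * \<sigma>\<^sup>2)" using energy_bounds(1)[of x] p k by simp
      show "144 * energy x / (p ^ 4 * accept_floor * \<sigma>\<^sup>2) \<le> 144 * (2 * B)\<^sup>2 / (p ^ 4 * accept_floor * \<sigma>\<^sup>2)"
        using energy_bounds(2)[OF x] p k by (intro divide_right_mono mult_left_mono) auto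
    qed (use smooth_bound \<sigma>(1) smooth_lipschitz in \<open>auto simp: p_def\<close>)
  qed auto
  also have "\<dots> = (2 / (p\<^sup>2 * accept_floor) + 288 / (p ^ 4 * accept_floor * \<sigma>\<^sup>2) / m) * (\<integral>x. energy x \<partial>\<nu>)"
    by (simp add: algebra_simps)
  also have "\<dots> \<le> (578 * L * d / (m * p ^ 4 * accept_floor)) * (\<integral>x. energy x \<partial>\<nu>)"
  proof (rule mult_right_mono)
    have arith: "a \<le> 2 * w \<Longrightarrow> cutoff = 576 * w \<Longrightarrow> c = 578 * w \<Longrightarrow> a + cutoff \<le> c" for a cutoff c w :: real
      by linarith
    have "m \<le> L * 1"
    proof -
      \<comment> \<open>Comparing the lower with the upper quadratic bound along a single nonzero
        displacement gives \<open>m \<le> L\<close>; the vector of ones is nonzero because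
        \<open>d\<close> is positive.\<close>
      define z e where "z = (\<lambda>j\<in>{..<d}. 0 :: real)" and "e = (\<lambda>j\<in>{..<d}. 1 :: real)"
      have "sq_dist d z e = d" by (simp add: sq_dist_def z_def e_def)
      moreover have "m / 2 * sq_dist d z e \<le> L / 2 * sq_dist d z e"
        by (rule order_trans[OF lower upper]) (auto simp: z_def e_def)
      ultimately show "m \<le> L * 1" using d by simp
    qed
    also have "L * 1 \<le> L * d" using d L by (intro mult_left_mono) auto
    finally have "m \<le> L * d" by simp
    then have mL: "1 \<le> L * d / m" using m by simp
    have "2 / (p\<^sup>2 * accept_floor) \<le> 2 / (p ^ 4 * accept_floor)"
    proof (rule divide_left_mono)
      have "p ^ 4 \<le> p\<^sup>2" using p by (intro power_decreasing) auto
      then show "p ^ 4 * accept_floor \<le> p\<^sup>2 * accept_floor" using k by simp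
    qed (use p k in auto)
    also have "\<dots> \<le> 2 / (p ^ 4 * accept_floor) * (L * d / m)" using mult_left_mono[OF mL, of "2 / (p ^ 4 * accept_floor)"] p k by simp
    also have "\<dots> = 2 * (L * d / (m * p ^ 4 * accept_floor))" by (simp add: mult_ac)
    finally have "2 / (p\<^sup>2 * accept_floor) \<le> 2 * (L * d / (m * p ^ 4 * accept_floor))" .
    moreover have "288 / (p ^ 4 * accept_floor * \<sigma>\<^sup>2) / m = 576 * (L * d / (m * p ^ 4 * accept_floor))"
      unfolding \<sigma>(2) using L d by (simp add: mult_ac)
    moreover have "578 * L * d / (m * p ^ 4 * accept_floor) = 578 * (L * d / (m * p ^ 4 * accept_floor))" by simp
    ultimately show "2 / (p\<^sup>2 * accept_floor) + 288 / (p ^ 4 * accept_floor * \<sigma>\<^sup>2) / m \<le> 578 * L * d / (m * p ^ 4 * accept_floor)"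
      by (rule arith)
  qed (simp add: energy_bounds)
  finally show ?thesis by (simp add: p_def)
qed

end

end

section \<open>Random-walk Metropolis\<close>

lemma measurable_prob_kernelI:
  assumes "\<And>x. x \<in> space M \<Longrightarrow> prob_space (K x)" "\<And>x. x \<in> space M \<Longrightarrow> sets (K x) = sets N"
    and "\<And>A. A \<in> sets N \<Longrightarrow> (\<lambda>x. emeasure (K x) A) \<in> borel_measurable M"
  shows "K \<in> M \<rightarrow>\<^sub>M prob_algebra N"
  using assms by (intro measurable_prob_algebraI measurable_subprob_algebra prob_space_imp_subprob_space)

text \<open>\<open>ennreal\<close> sends negative numbers to 0, so \<open>ennreal a\<close> and
  \<open>ennreal (- a)\<close> are the positive and negative parts; these are the sign rules for the
  parts of a product.\<close>

lemma ennreal_mult_split: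
  "ennreal (a * b) = ennreal a * ennreal b + ennreal (- a) * ennreal (- b)"
  "ennreal (- (a * b)) = ennreal a * ennreal (- b) + ennreal (- a) * ennreal b"
proof -
  show 1: "ennreal (a * b) = ennreal a * ennreal b + ennreal (- a) * ennreal (- b)" for a b
  proof (cases "0 \<le> a"; cases "0 \<le> b")
    assume "0 \<le> a" "0 \<le> b" then show ?thesis by (simp add: ennreal_mult ennreal_neg)
  next
    assume "0 \<le> a" "\<not> 0 \<le> b" then show ?thesis by (simp add: ennreal_neg mult_nonneg_nonpos)
  next
    assume "\<not> 0 \<le> a" "0 \<le> b" then show ?thesis by (simp add: ennreal_neg mult_nonpos_nonneg)
  next
    assume "\<not> 0 \<le> a" "\<not> 0 \<le> b"
    then show ?thesis using ennreal_mult[of "- a" "- b"] by (simp add: ennreal_neg)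
  qed
  from 1[of a "- b"] show "ennreal (- (a * b)) = ennreal a * ennreal (- b) + ennreal (- a) * ennreal b" by simp
qed

lemma ennreal_cross_le_squares: "x * y + y * x \<le> x * x + y * (y :: ennreal)"
proof (cases "x = top \<or> y = top")
  case True
  then show ?thesis by (auto simp: ennreal_top_mult)
next
  case False
  then obtain a b where "x = ennreal a" "0 \<le> a" "y = ennreal b" "0 \<le> b" by (metis ennreal_cases)
  moreover have "a * b + b * a \<le> a * a + b * b" using zero_le_power2[of "a - b"] by (simp add: power2_eq_square algebra_simps)
  ultimately show ?thesis by (simp add: ennreal_mult[symmetric] ennreal_plus[symmetric] del: ennreal_plus)
qed

section \<open>Positivity of Gram kernels\<close>

lemma nn_integral_gram:
  fixes h :: "'a \<Rightarrow> 'b \<Rightarrow> ennreal"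
  assumes M: "sigma_finite_measure M" and W: "sigma_finite_measure W"
    and h [measurable]: "(\<lambda>(x, w). h x w) \<in> borel_measurable (M \<Otimes>\<^sub>M W)"
    and u [measurable]: "u \<in> borel_measurable M" and v [measurable]: "v \<in> borel_measurable M"
  shows "(\<integral>\<^sup>+x. \<integral>\<^sup>+y. (\<integral>\<^sup>+w. h x w * h y w \<partial>W) * (u x * v y) \<partial>M \<partial>M)
    = (\<integral>\<^sup>+w. (\<integral>\<^sup>+x. h x w * u x \<partial>M) * (\<integral>\<^sup>+y. h y w * v y \<partial>M) \<partial>W)"
proof -
  interpret M: sigma_finite_measure M by fact
  interpret W: sigma_finite_measure W by fact
  interpret MW: pair_sigma_finite M W ..
  have hx [measurable]: "h x \<in> borel_measurable W" if "x \<in> space M" for x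
    using measurable_compose[OF measurable_Pair1'[OF that] h] by simp
  have hw [measurable]: "(\<lambda>x. h x w) \<in> borel_measurable M" if "w \<in> space W" for w
    using measurable_compose[OF measurable_Pair2'[OF that] h] by simp
  define V where "V w = (\<integral>\<^sup>+y. h y w * v y \<partial>M)" for w
  have [measurable]: "V \<in> borel_measurable W" unfolding V_def by measurable
  have "(\<integral>\<^sup>+y. (\<integral>\<^sup>+w. h x w * h y w \<partial>W) * (u x * v y) \<partial>M) = (\<integral>\<^sup>+w. (h x w * u x) * V w \<partial>W)"
    if x: "x \<in> space M" for x
  proof -
    note [measurable] = hx[OF x]
    have "(\<integral>\<^sup>+y. (\<integral>\<^sup>+w. h x w * h y w \<partial>W) * (u x * v y) \<partial>M)
      = (\<integral>\<^sup>+y. \<integral>\<^sup>+w. (h x w * u x) * (h y w * v y) \<partial>W \<partial>M)"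
    proof (rule nn_integral_cong)
      fix y assume y: "y \<in> space M"
      note [measurable] = hx[OF y]
      show "(\<integral>\<^sup>+w. h x w * h y w \<partial>W) * (u x * v y) = (\<integral>\<^sup>+w. (h x w * u x) * (h y w * v y) \<partial>W)"
        by (subst nn_integral_multc[symmetric]) (auto simp: mult_ac)
    qed
    also have "\<dots> = (\<integral>\<^sup>+w. \<integral>\<^sup>+y. (h x w * u x) * (h y w * v y) \<partial>M \<partial>W)"
      by (rule MW.Fubini'[symmetric]) measurable
    also have "\<dots> = (\<integral>\<^sup>+w. (h x w * u x) * V w \<partial>W)"
    proof (rule nn_integral_cong)
      fix w assume w: "w \<in> space W"
      note [measurable] = hw[OF w]
      show "(\<integral>\<^sup>+y. (h x w * u x) * (h y w * v y) \<partial>M) = (h x w * u x) * V w"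
        unfolding V_def by (rule nn_integral_cmult) measurable
    qed
    finally show ?thesis .
  qed
  then have "(\<integral>\<^sup>+x. \<integral>\<^sup>+y. (\<integral>\<^sup>+w. h x w * h y w \<partial>W) * (u x * v y) \<partial>M \<partial>M)
    = (\<integral>\<^sup>+x. \<integral>\<^sup>+w. (h x w * u x) * V w \<partial>W \<partial>M)" by (intro nn_integral_cong)
  also have "\<dots> = (\<integral>\<^sup>+w. \<integral>\<^sup>+x. (h x w * u x) * V w \<partial>M \<partial>W)"
    by (rule MW.Fubini'[symmetric]) measurable
  also have "\<dots> = (\<integral>\<^sup>+w. (\<integral>\<^sup>+x. h x w * u x \<partial>M) * V w \<partial>W)"
  proof (rule nn_integral_cong)
    fix w assume w: "w \<in> space W"
    note [measurable] = hw[OF w]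
    show "(\<integral>\<^sup>+x. (h x w * u x) * V w \<partial>M) = (\<integral>\<^sup>+x. h x w * u x \<partial>M) * V w"
      by (rule nn_integral_multc) measurable
  qed
  finally show ?thesis unfolding V_def .
qed

text \<open>Formally the difference of the two sides is the integral of the square of
  \<open>P w - N w\<close>. Both sides may be infinite, so the subtraction is replaced by the bound
  of the cross terms by the squares inside the integral.\<close>

lemma gram_kernel_positive:
  fixes h :: "'a \<Rightarrow> 'b \<Rightarrow> ennreal" and f :: "'a \<Rightarrow> real"
  assumes M: "sigma_finite_measure M" and W: "sigma_finite_measure W"
    and h [measurable]: "(\<lambda>(x, w). h x w) \<in> borel_measurable (M \<Otimes>\<^sub>M W)"
    and f [measurable]: "f \<in> borel_measurable M"
  shows "(\<integral>\<^sup>+x. \<integral>\<^sup>+y. (\<integral>\<^sup>+w. h x w * h y w \<partial>W) * ennreal (- (f x * f y)) \<partial>M \<partial>M)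
    \<le> (\<integral>\<^sup>+x. \<integral>\<^sup>+y. (\<integral>\<^sup>+w. h x w * h y w \<partial>W) * ennreal (f x * f y) \<partial>M \<partial>M)"
proof -
  interpret M: sigma_finite_measure M by fact
  interpret W: sigma_finite_measure W by fact
  interpret MW: pair_sigma_finite M W ..
  define k where "k x y = (\<integral>\<^sup>+w. h x w * h y w \<partial>W)" for x y
  have k [measurable]: "(\<lambda>(x, y). k x y) \<in> borel_measurable (M \<Otimes>\<^sub>M M)"
  proof -
    have "(\<lambda>q. h (fst (fst q)) (snd q)) \<in> borel_measurable ((M \<Otimes>\<^sub>M M) \<Otimes>\<^sub>M W)"
      "(\<lambda>q. h (snd (fst q)) (snd q)) \<in> borel_measurable ((M \<Otimes>\<^sub>M M) \<Otimes>\<^sub>M W)"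
      using measurable_compose[OF _ h, of "\<lambda>q. (fst (fst q), snd q)" "(M \<Otimes>\<^sub>M M) \<Otimes>\<^sub>M W"]
        measurable_compose[OF _ h, of "\<lambda>q. (snd (fst q), snd q)" "(M \<Otimes>\<^sub>M M) \<Otimes>\<^sub>M W"] by simp_all
    then have "(\<lambda>q. h (fst (fst q)) (snd q) * h (snd (fst q)) (snd q)) \<in> borel_measurable ((M \<Otimes>\<^sub>M M) \<Otimes>\<^sub>M W)"
      by (rule borel_measurable_times_ennreal)
    from W.borel_measurable_nn_integral_fst[OF this] show ?thesis by (simp add: k_def split_beta')
  qed
  have kx: "k x \<in> borel_measurable M" if "x \<in> space M" for x
    using measurable_compose[OF measurable_Pair1'[OF that] k] by simp
  define P N where "P w = (\<integral>\<^sup>+x. h x w * ennreal (f x) \<partial>M)" and "N w = (\<integral>\<^sup>+x. h x w * ennreal (- f x) \<partial>M)" for w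
  have [measurable]: "P \<in> borel_measurable W" "N \<in> borel_measurable W" unfolding P_def N_def by measurable
  have add: "(\<integral>\<^sup>+x. \<integral>\<^sup>+y. k x y * (u x * v y + u' x * v' y) \<partial>M \<partial>M)
     = (\<integral>\<^sup>+x. \<integral>\<^sup>+y. k x y * (u x * v y) \<partial>M \<partial>M) + (\<integral>\<^sup>+x. \<integral>\<^sup>+y. k x y * (u' x * v' y) \<partial>M \<partial>M)"
    if [measurable]: "u \<in> borel_measurable M" "v \<in> borel_measurable M" "u' \<in> borel_measurable M" "v' \<in> borel_measurable M" for u v u' v'
  proof -
    have "(\<integral>\<^sup>+x. \<integral>\<^sup>+y. k x y * (u x * v y + u' x * v' y) \<partial>M \<partial>M)
      = (\<integral>\<^sup>+x. (\<integral>\<^sup>+y. k x y * (u x * v y) \<partial>M) + (\<integral>\<^sup>+y. k x y * (u' x * v' y) \<partial>M) \<partial>M)"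
    proof (rule nn_integral_cong)
      fix x assume "x \<in> space M"
      note [measurable] = kx[OF this]
      show "(\<integral>\<^sup>+y. k x y * (u x * v y + u' x * v' y) \<partial>M) = (\<integral>\<^sup>+y. k x y * (u x * v y) \<partial>M) + (\<integral>\<^sup>+y. k x y * (u' x * v' y) \<partial>M)"
        by (subst nn_integral_add[symmetric]) (auto simp: distrib_left)
    qed
    also have "\<dots> = (\<integral>\<^sup>+x. \<integral>\<^sup>+y. k x y * (u x * v y) \<partial>M \<partial>M) + (\<integral>\<^sup>+x. \<integral>\<^sup>+y. k x y * (u' x * v' y) \<partial>M \<partial>M)"
      by (rule nn_integral_add) measurable
    finally show ?thesis .
  qed
  have gram: "(\<integral>\<^sup>+x. \<integral>\<^sup>+y. k x y * (u x * v y) \<partial>M \<partial>M) = (\<integral>\<^sup>+w. (\<integral>\<^sup>+x. h x w * u x \<partial>M) * (\<integral>\<^sup>+y. h y w * v y \<partial>M) \<partial>W)"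
    if "u \<in> borel_measurable M" "v \<in> borel_measurable M" for u v
    unfolding k_def by (rule nn_integral_gram[OF M W h that])
  have "(\<integral>\<^sup>+x. \<integral>\<^sup>+y. k x y * ennreal (- (f x * f y)) \<partial>M \<partial>M) = (\<integral>\<^sup>+w. P w * N w \<partial>W) + (\<integral>\<^sup>+w. N w * P w \<partial>W)"
    unfolding ennreal_mult_split(2) by (subst add, measurable) (simp add: gram P_def N_def)
  also have "\<dots> = (\<integral>\<^sup>+w. P w * N w + N w * P w \<partial>W)" by (rule nn_integral_add[symmetric]) measurable
  also have "\<dots> \<le> (\<integral>\<^sup>+w. P w * P w + N w * N w \<partial>W)" by (intro nn_integral_mono ennreal_cross_le_squares)
  also have "\<dots> = (\<integral>\<^sup>+w. P w * P w \<partial>W) + (\<integral>\<^sup>+w. N w * N w \<partial>W)" by (rule nn_integral_add) measurable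
  also have "\<dots> = (\<integral>\<^sup>+x. \<integral>\<^sup>+y. k x y * ennreal (f x * f y) \<partial>M \<partial>M)"
    unfolding ennreal_mult_split(1) by (subst add, measurable) (simp add: gram P_def N_def)
  finally show ?thesis unfolding k_def .
qed

text \<open>The kernel is a mixture of two measures, indexed by the Booleans: the proposal density
  weighted by acceptance, and an atom at \<open>z\<close> that carries the rejected mass
  \<open>R\<close>.\<close>

lemma
  assumes z: "z \<in> space (euclid d)" and U [measurable]: "U \<in> borel_measurable (euclid d)" and \<sigma>: "0 < \<sigma>"
  shows emeasure_rw_metropolis: "A \<in> sets (euclid d) \<Longrightarrow> emeasure (rw_metropolis d U \<sigma> z) A =
      (\<integral>\<^sup>+z'. ennreal (accept_prob U z z') * indicator A z' \<partial>gaussian d z \<sigma>)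
        + (\<integral>\<^sup>+z'. ennreal (1 - accept_prob U z z') \<partial>gaussian d z \<sigma>) * indicator A z"
    and nn_integral_rw_metropolis: "g \<in> borel_measurable (euclid d) \<Longrightarrow> (\<integral>\<^sup>+z'. g z' \<partial>rw_metropolis d U \<sigma> z) =
      (\<integral>\<^sup>+z'. ennreal (accept_prob U z z') * g z' \<partial>gaussian d z \<sigma>)
        + (\<integral>\<^sup>+z'. ennreal (1 - accept_prob U z z') \<partial>gaussian d z \<sigma>) * g z"
    and sets_rw_metropolis: "sets (rw_metropolis d U \<sigma> z) = sets (euclid d)"
    and prob_space_rw_metropolis: "prob_space (rw_metropolis d U \<sigma> z)"
proof -
  have sg: "sets (gaussian d z \<sigma>) = sets (euclid d)" "space (gaussian d z \<sigma>) = space (euclid d)"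
    using gaussian_eq_density[OF \<sigma>, of d z] by simp_all
  have [measurable]: "accept_prob U z \<in> borel_measurable (euclid d)" unfolding accept_prob_def by measurable
  note m = measurable_cong_sets[OF sg(1) refl]
  define R where "R = (\<integral>\<^sup>+z'. ennreal (1 - accept_prob U z z') \<partial>gaussian d z \<sigma>)"
  define N where "N i = (if i then density (gaussian d z \<sigma>) (\<lambda>z'. ennreal (accept_prob U z z')) else return (euclid d) z)" for i
  define c where "c i = (if i then 1 else R)" for i
  let ?F = "\<lambda>A. (\<integral>\<^sup>+z'. ennreal (accept_prob U z z') * indicator A z' \<partial>gaussian d z \<sigma>) + R * indicator A z"
  have rw: "rw_metropolis d U \<sigma> z = measure_of (space (euclid d)) (sets (euclid d)) ?F"
    by (simp add: rw_metropolis_def R_def)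
  show sets: "sets (rw_metropolis d U \<sigma> z) = sets (euclid d)"
    unfolding rw by (rule sets.sets_measure_of_eq)
  have sN: "sets (N i) = sets (euclid d)" for i by (simp add: N_def sg)
  have F: "?F A = (\<Sum>i\<in>UNIV. c i * emeasure (N i) A)" if "A \<in> sets (euclid d)" for A
    using that by (simp add: UNIV_bool c_def N_def emeasure_density m sg emeasure_return add.commute)
  note mix = emeasure_mixture[of UNIV N "euclid d" ?F c] nn_integral_mixture[of UNIV N "euclid d" ?F c]
  show em: "emeasure (rw_metropolis d U \<sigma> z) A =
      (\<integral>\<^sup>+z'. ennreal (accept_prob U z z') * indicator A z' \<partial>gaussian d z \<sigma>)
        + (\<integral>\<^sup>+z'. ennreal (1 - accept_prob U z z') \<partial>gaussian d z \<sigma>) * indicator A z"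
    if A: "A \<in> sets (euclid d)" for A
    unfolding rw R_def[symmetric] using mix(1)[OF _ sN F A] F[OF A] by simp
  show "(\<integral>\<^sup>+z'. g z' \<partial>rw_metropolis d U \<sigma> z) =
      (\<integral>\<^sup>+z'. ennreal (accept_prob U z z') * g z' \<partial>gaussian d z \<sigma>)
        + (\<integral>\<^sup>+z'. ennreal (1 - accept_prob U z z') \<partial>gaussian d z \<sigma>) * g z"
    if [measurable]: "g \<in> borel_measurable (euclid d)" for g
  proof -
    have "(\<integral>\<^sup>+z'. g z' \<partial>rw_metropolis d U \<sigma> z) = (\<Sum>i\<in>UNIV. c i * (\<integral>\<^sup>+x. g x \<partial>N i))"
      unfolding rw using mix(2)[OF _ sN F that] by simp
    also have "\<dots> = (\<integral>\<^sup>+x. g x \<partial>density (gaussian d z \<sigma>) (\<lambda>z'. ennreal (accept_prob U z z'))) + R * (\<integral>\<^sup>+x. g x \<partial>return (euclid d) z)"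
      by (simp add: UNIV_bool c_def N_def add.commute)
    also have "\<dots> = (\<integral>\<^sup>+z'. ennreal (accept_prob U z z') * g z' \<partial>gaussian d z \<sigma>) + R * g z"
      using z by (subst nn_integral_density) (auto simp: m nn_integral_return)
    finally show ?thesis by (simp add: R_def)
  qed
  show "prob_space (rw_metropolis d U \<sigma> z)"
  proof
    have a: "0 \<le> accept_prob U z z'" "accept_prob U z z' \<le> 1" for z' by (auto simp: accept_prob_def)
    have "emeasure (rw_metropolis d U \<sigma> z) (space (rw_metropolis d U \<sigma> z)) =
      emeasure (rw_metropolis d U \<sigma> z) (space (euclid d))" using sets_eq_imp_space_eq[OF sets] by simp
    also have "\<dots> = (\<integral>\<^sup>+z'. ennreal (accept_prob U z z') * indicator (space (euclid d)) z' \<partial>gaussian d z \<sigma>) + R"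
      using z by (subst em) (auto simp: R_def)
    also have "(\<integral>\<^sup>+z'. ennreal (accept_prob U z z') * indicator (space (euclid d)) z' \<partial>gaussian d z \<sigma>)
      = (\<integral>\<^sup>+z'. ennreal (accept_prob U z z') \<partial>gaussian d z \<sigma>)"
      by (intro nn_integral_cong) (simp add: sg)
    also have "\<dots> + R = (\<integral>\<^sup>+z'. ennreal (accept_prob U z z') + ennreal (1 - accept_prob U z z') \<partial>gaussian d z \<sigma>)"
      unfolding R_def by (rule nn_integral_add[symmetric]) (simp_all add: m)
    also have "\<dots> = (\<integral>\<^sup>+z'. 1 \<partial>gaussian d z \<sigma>)" using a by (simp add: ennreal_plus[symmetric] del: ennreal_plus)
    also have "\<dots> = 1" using nn_integral_gauss_dens[OF \<sigma>, of d z]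
      by (simp add: gaussian_eq_density[OF \<sigma>] emeasure_density cong: nn_integral_cong)
    finally show "emeasure (rw_metropolis d U \<sigma> z) (space (rw_metropolis d U \<sigma> z)) = 1" .
  qed
qed

text \<open>1156 is twice the 578 of \<open>variance_le_energy\<close>; the factor 2 is that of the
  Dirichlet form.\<close>

definition gap_const :: real where "gap_const = (tail_mass / 2) ^ 4 * accept_floor / 1156"

lemma gap_const: "0 < gap_const" "gap_const \<le> 1"
proof -
  show "0 < gap_const" using tail_mass accept_floor by (simp add: gap_const_def)
  have "(tail_mass / 2) ^ 4 * accept_floor \<le> 1 * 1"
    using tail_mass accept_floor by (intro mult_mono power_le_one) auto
  then show "gap_const \<le> 1" by (simp add: gap_const_def)
qed

section \<open>Reversibility, positivity and spectral gap of the Metropolis kernel\<close>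

context convex_potential
begin

definition Q where "Q = rw_metropolis d U \<sigma>"

lemma nn_integral_Q:
  assumes "z \<in> pts" "g \<in> borel_measurable (euclid d)"
  shows "(\<integral>\<^sup>+z'. g z' \<partial>Q z) = (\<integral>\<^sup>+z'. ennreal (accept_prob U z z') * g z' \<partial>\<gamma> z)
        + (\<integral>\<^sup>+z'. ennreal (1 - accept_prob U z z') \<partial>\<gamma> z) * g z"
  unfolding Q_def using nn_integral_rw_metropolis[OF _ U_measurable \<sigma>(1) assms(2), of z] assms(1)
  by (simp add: gaussian_\<gamma> space_euclid)

lemma measurable_nn_integral_\<gamma>:
  fixes F :: "_ \<Rightarrow> _ \<Rightarrow> ennreal"
  assumes [measurable]: "(\<lambda>(x, y). F x y) \<in> borel_measurable (euclid d \<Otimes>\<^sub>M euclid d)"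
  shows "(\<lambda>x. \<integral>\<^sup>+y. F x y \<partial>\<gamma> x) \<in> borel_measurable (euclid d)"
proof -
  have "(\<lambda>x. \<integral>\<^sup>+y. ennreal (gauss_dens d \<sigma> x y) * F x y \<partial>euclid d) \<in> borel_measurable (euclid d)"
    by measurable
  also have "?this \<longleftrightarrow> ?thesis"
  proof (rule measurable_cong)
    fix x assume "x \<in> space (euclid d)"
    then have "F x \<in> borel_measurable (euclid d)"
      using measurable_compose[OF measurable_Pair1' assms] by simp
    then show "(\<integral>\<^sup>+y. ennreal (gauss_dens d \<sigma> x y) * F x y \<partial>euclid d) = (\<integral>\<^sup>+y. F x y \<partial>\<gamma> x)"
      by (rule nn_integral_\<gamma>[symmetric])
  qed
  finally show ?thesis .
qed

definition reject where "reject x = (\<integral>\<^sup>+y. ennreal (1 - accept_prob U x y) \<partial>\<gamma> x)"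

lemma measurable_reject [measurable]: "reject \<in> borel_measurable (euclid d)"
  unfolding reject_def[abs_def] by (rule measurable_nn_integral_\<gamma>) measurable

lemma Q_kernel: "Q \<in> euclid d \<rightarrow>\<^sub>M prob_algebra (euclid d)"
proof (rule measurable_prob_kernelI)
  fix A assume A [measurable]: "A \<in> sets (euclid d)"
  have "(\<lambda>x. (\<integral>\<^sup>+y. ennreal (accept_prob U x y) * indicator A y \<partial>\<gamma> x) + reject x * indicator A x) \<in> borel_measurable (euclid d)"
    using measurable_nn_integral_\<gamma>[of "\<lambda>x y. ennreal (accept_prob U x y) * indicator A y"] by measurable
  also have "?this \<longleftrightarrow> (\<lambda>x. emeasure (Q x) A) \<in> borel_measurable (euclid d)"
    by (rule measurable_cong) (simp add: Q_def emeasure_rw_metropolis[OF _ U_measurable \<sigma>(1)] A gaussian_\<gamma> reject_def)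
  finally show "(\<lambda>x. emeasure (Q x) A) \<in> borel_measurable (euclid d)" .
qed (auto simp: Q_def sets_rw_metropolis[OF _ U_measurable \<sigma>(1)] prob_space_rw_metropolis[OF _ U_measurable \<sigma>(1)])

text \<open>The joint density of the current point and an accepted proposal in equilibrium. In this
  form its symmetry, which is detailed balance, is evident.\<close>

definition jump where "jump x y = gauss_dens d \<sigma> x y * min (exp (- U x)) (exp (- U y)) / Z"

lemma jump_nonneg: "0 \<le> jump x y" using Z_pos gauss_dens_nonneg by (simp add: jump_def)

lemma jump_sym: "jump x y = jump y x" by (simp add: jump_def gauss_dens_sym[of d \<sigma> x y] min.commute)

lemma jump_eq: "jump x y = exp (- U x) / Z * (gauss_dens d \<sigma> x y * accept_prob U x y)"
proof -
  have "exp (- U x) * accept_prob U x y = min (exp (- U x)) (exp (- U y))"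
    by (simp add: accept_prob_def min_def exp_add[symmetric] mult_exp_exp)
  then show ?thesis by (simp add: jump_def mult_ac)
qed

lemma measurable_jump [measurable]: "(\<lambda>(x, y). jump x y) \<in> borel_measurable (euclid d \<Otimes>\<^sub>M euclid d)"
  unfolding jump_def by measurable

text \<open>In equilibrium a pair of successive states has a symmetric density off the diagonal and
  a part on the diagonal. Both are unchanged when the arguments are exchanged, and only the first
  matters for the sign of the quadratic form.\<close>

lemma nn_integral_Q_\<nu>:
  fixes F :: "_ \<Rightarrow> _ \<Rightarrow> ennreal"
  assumes F [measurable]: "(\<lambda>(x, y). F x y) \<in> borel_measurable (euclid d \<Otimes>\<^sub>M euclid d)"
  shows "(\<integral>\<^sup>+x. \<integral>\<^sup>+y. F x y \<partial>Q x \<partial>\<nu>) =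
    (\<integral>\<^sup>+x. \<integral>\<^sup>+y. ennreal (jump x y) * F x y \<partial>euclid d \<partial>euclid d) + (\<integral>\<^sup>+x. reject x * F x x \<partial>\<nu>)"
proof -
  have Fx: "F x \<in> borel_measurable (euclid d)" if "x \<in> pts" for x
    using measurable_compose[OF measurable_Pair1' F] that by (simp add: space_euclid)
  have [measurable]: "(\<lambda>x. F x x) \<in> borel_measurable (euclid d)"
    using measurable_compose[OF _ F, of "\<lambda>x. (x, x)"] by simp
  have m: "(\<lambda>x. \<integral>\<^sup>+y. ennreal (accept_prob U x y) * F x y \<partial>\<gamma> x) \<in> borel_measurable (euclid d)"
    by (rule measurable_nn_integral_\<gamma>) measurable
  have "(\<integral>\<^sup>+x. \<integral>\<^sup>+y. F x y \<partial>Q x \<partial>\<nu>) = (\<integral>\<^sup>+x. (\<integral>\<^sup>+y. ennreal (accept_prob U x y) * F x y \<partial>\<gamma> x) + reject x * F x x \<partial>\<nu>)"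
    by (intro nn_integral_cong) (simp add: nn_integral_Q Fx reject_def space_euclid)
  also have "\<dots> = (\<integral>\<^sup>+x. \<integral>\<^sup>+y. ennreal (accept_prob U x y) * F x y \<partial>\<gamma> x \<partial>\<nu>) + (\<integral>\<^sup>+x. reject x * F x x \<partial>\<nu>)"
    using m by (intro nn_integral_add) auto
  also have "(\<integral>\<^sup>+x. \<integral>\<^sup>+y. ennreal (accept_prob U x y) * F x y \<partial>\<gamma> x \<partial>\<nu>)
    = (\<integral>\<^sup>+x. \<integral>\<^sup>+y. ennreal (jump x y) * F x y \<partial>euclid d \<partial>euclid d)"
    unfolding nn_integral_\<nu>[OF m]
  proof (rule nn_integral_cong)
    fix x assume "x \<in> space (euclid d)"
    then have x: "x \<in> pts" by (simp add: space_euclid)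
    note [measurable] = Fx[OF x]
    have "ennreal (exp (- U x) / Z) * (\<integral>\<^sup>+y. ennreal (accept_prob U x y) * F x y \<partial>\<gamma> x) =
       (\<integral>\<^sup>+y. ennreal (exp (- U x) / Z) * (ennreal (gauss_dens d \<sigma> x y) * (ennreal (accept_prob U x y) * F x y)) \<partial>euclid d)"
      by (subst nn_integral_\<gamma>, measurable) (rule nn_integral_cmult[symmetric], measurable)
    also have "\<dots> = (\<integral>\<^sup>+y. ennreal (jump x y) * F x y \<partial>euclid d)"
    proof (rule nn_integral_cong)
      fix y
      have "ennreal (jump x y) = ennreal (exp (- U x) / Z) * (ennreal (gauss_dens d \<sigma> x y) * ennreal (accept_prob U x y))"
        unfolding jump_eq using Z_pos gauss_dens_nonneg accept_prob_bounds
        by (subst ennreal_mult, simp, simp, subst ennreal_mult) simp_all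
      then show "ennreal (exp (- U x) / Z) * (ennreal (gauss_dens d \<sigma> x y) * (ennreal (accept_prob U x y) * F x y))
          = ennreal (jump x y) * F x y"
        by (simp only: mult_ac)
    qed
    finally show "ennreal (exp (- U x) / Z) * (\<integral>\<^sup>+y. ennreal (accept_prob U x y) * F x y \<partial>\<gamma> x) =
       (\<integral>\<^sup>+y. ennreal (jump x y) * F x y \<partial>euclid d)" .
  qed
  finally show ?thesis .
qed

lemma reversible_Q: "reversible_kernel \<nu> Q"
proof
  show "Q \<in> \<nu> \<rightarrow>\<^sub>M prob_algebra \<nu>"
    using Q_kernel subprob_algebra_cong[OF sets_\<nu>]
    by (simp add: prob_algebra_def measurable_cong_sets[OF sets_\<nu> refl])
  fix F :: "_ \<Rightarrow> _ \<Rightarrow> ennreal" assume "(\<lambda>(x, y). F x y) \<in> borel_measurable (\<nu> \<Otimes>\<^sub>M \<nu>)"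
  then have F [measurable]: "(\<lambda>(x, y). F x y) \<in> borel_measurable (euclid d \<Otimes>\<^sub>M euclid d)"
    using measurable_cong_sets[OF sets_pair_measure_cong[OF sets_\<nu> sets_\<nu>] refl] by blast
  have "(\<integral>\<^sup>+x. \<integral>\<^sup>+y. ennreal (jump x y) * F x y \<partial>euclid d \<partial>euclid d)
    = (\<integral>\<^sup>+y. \<integral>\<^sup>+x. ennreal (jump x y) * F x y \<partial>euclid d \<partial>euclid d)"
    by (rule euclid_pair.Fubini') measurable
  then show "(\<integral>\<^sup>+x. \<integral>\<^sup>+y. F x y \<partial>Q x \<partial>\<nu>) = (\<integral>\<^sup>+x. \<integral>\<^sup>+y. F y x \<partial>Q x \<partial>\<nu>)"
    by (simp add: nn_integral_Q_\<nu> jump_sym)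
qed

lemma Q_positive:
  assumes f: "square_integrable \<nu> f"
  shows "0 \<le> (\<integral>x. f x * (\<integral>y. f y \<partial>Q x) \<partial>\<nu>)"
proof -
  interpret Q: reversible_kernel \<nu> Q by (rule reversible_Q)
  have [measurable]: "f \<in> borel_measurable (euclid d)" using f by (simp add: square_integrable_def measurable_cong_sets[OF sets_\<nu> refl])
  \<comment> \<open>The feature of \<open>x\<close> in the Gram representation, a function of an
    intermediate point and a level. The standard deviation is divided by \<open>sqrt 2\<close>
    because integrating out the intermediate point doubles the variance; the common levels produce
    the minimum of \<open>exp (- U x)\<close> and \<open>exp (- U y)\<close>.\<close>
  define h where "h x w = ennreal (gauss_dens d (\<sigma> / sqrt 2) (fst w) x) * indicator {0<..<exp (- U x)} (snd w)"
    for x :: "nat \<Rightarrow> real" and w :: "(nat \<Rightarrow> real) \<times> real"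
  let ?W = "euclid d \<Otimes>\<^sub>M (lborel :: real measure)"
  interpret El: pair_sigma_finite "euclid d" "lborel :: real measure" ..
  have h [measurable]: "(\<lambda>(x, w). h x w) \<in> borel_measurable (euclid d \<Otimes>\<^sub>M ?W)"
    unfolding h_def indicator_def greaterThanLessThan_iff by measurable
  have hx: "h x \<in> borel_measurable ?W" if "x \<in> pts" for x
    using measurable_compose[OF measurable_Pair1' h] that by (simp add: space_euclid)
  have gram: "(\<integral>\<^sup>+w. h x w * h y w \<partial>?W) = ennreal Z * ennreal (jump x y)" if x: "x \<in> pts" and y: "y \<in> pts" for x y
  proof -
    note [measurable] = hx[OF x] hx[OF y]
    have "(\<integral>\<^sup>+w. h x w * h y w \<partial>?W) = (\<integral>\<^sup>+z. \<integral>\<^sup>+t. h x (z, t) * h y (z, t) \<partial>lborel \<partial>euclid d)"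
      by (rule lborel.nn_integral_fst[symmetric]) measurable
    also have "\<dots> = (\<integral>\<^sup>+z. ennreal (gauss_dens d (\<sigma> / sqrt 2) z x) * ennreal (gauss_dens d (\<sigma> / sqrt 2) z y) * ennreal (min (exp (- U x)) (exp (- U y))) \<partial>euclid d)"
    proof (rule nn_integral_cong)
      fix z
      have "(\<integral>\<^sup>+t. h x (z, t) * h y (z, t) \<partial>lborel) =
        (\<integral>\<^sup>+t. ennreal (gauss_dens d (\<sigma> / sqrt 2) z x) * ennreal (gauss_dens d (\<sigma> / sqrt 2) z y) * indicator {0<..<min (exp (- U x)) (exp (- U y))} t \<partial>lborel)"
        by (intro nn_integral_cong) (auto simp: h_def indicator_def)
      then show "(\<integral>\<^sup>+t. h x (z, t) * h y (z, t) \<partial>lborel) = ennreal (gauss_dens d (\<sigma> / sqrt 2) z x) * ennreal (gauss_dens d (\<sigma> / sqrt 2) z y) * ennreal (min (exp (- U x)) (exp (- U y)))"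
        by (simp add: nn_integral_cmult)
    qed
    also have "\<dots> = (\<integral>\<^sup>+z. ennreal (gauss_dens d (\<sigma> / sqrt 2) z x) * ennreal (gauss_dens d (\<sigma> / sqrt 2) z y) \<partial>euclid d) * ennreal (min (exp (- U x)) (exp (- U y)))"
    proof (rule nn_integral_multc)
      have "(\<lambda>z. gauss_dens d (\<sigma> / sqrt 2) z x) \<in> borel_measurable (euclid d)" for x
        unfolding gauss_dens_sym[of d _ _ x] by (rule measurable_gauss_dens_right)
      then show "(\<lambda>z. ennreal (gauss_dens d (\<sigma> / sqrt 2) z x) * ennreal (gauss_dens d (\<sigma> / sqrt 2) z y)) \<in> borel_measurable (euclid d)"
        by measurable
    qed
    also have "\<dots> = ennreal (gauss_dens d \<sigma> x y) * ennreal (min (exp (- U x)) (exp (- U y)))"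
      using gauss_dens_convolution[of "\<sigma> / sqrt 2" d x y] \<sigma>(1) by simp
    also have "\<dots> = ennreal (Z * jump x y)" using Z_pos by (simp add: jump_def ennreal_mult' gauss_dens_nonneg)
    finally show ?thesis using Z_pos jump_nonneg by (simp add: ennreal_mult)
  qed
  have jx: "(\<lambda>y. ennreal (jump x y)) \<in> borel_measurable (euclid d)" if "x \<in> pts" for x
    using measurable_compose[OF measurable_Pair1' measurable_jump] that by (simp add: space_euclid)
  have scaled: "(\<integral>\<^sup>+x. \<integral>\<^sup>+y. (\<integral>\<^sup>+w. h x w * h y w \<partial>?W) * g x y \<partial>euclid d \<partial>euclid d) =
      ennreal Z * (\<integral>\<^sup>+x. \<integral>\<^sup>+y. ennreal (jump x y) * g x y \<partial>euclid d \<partial>euclid d)"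
    if g [measurable]: "(\<lambda>(x, y). g x y) \<in> borel_measurable (euclid d \<Otimes>\<^sub>M euclid d)" for g
  proof -
    have "(\<integral>\<^sup>+x. \<integral>\<^sup>+y. (\<integral>\<^sup>+w. h x w * h y w \<partial>?W) * g x y \<partial>euclid d \<partial>euclid d) =
      (\<integral>\<^sup>+x. ennreal Z * (\<integral>\<^sup>+y. ennreal (jump x y) * g x y \<partial>euclid d) \<partial>euclid d)"
    proof (rule nn_integral_cong)
      fix x assume "x \<in> space (euclid d)"
      then have x: "x \<in> pts" by (simp add: space_euclid)
      note [measurable] = jx[OF x]
      have [measurable]: "g x \<in> borel_measurable (euclid d)"
        using measurable_compose[OF measurable_Pair1' g] x by (simp add: space_euclid)
      have "(\<integral>\<^sup>+y. (\<integral>\<^sup>+w. h x w * h y w \<partial>?W) * g x y \<partial>euclid d) = (\<integral>\<^sup>+y. ennreal Z * (ennreal (jump x y) * g x y) \<partial>euclid d)"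
        using gram[OF x] by (intro nn_integral_cong) (simp add: space_euclid mult_ac)
      then show "(\<integral>\<^sup>+y. (\<integral>\<^sup>+w. h x w * h y w \<partial>?W) * g x y \<partial>euclid d) = ennreal Z * (\<integral>\<^sup>+y. ennreal (jump x y) * g x y \<partial>euclid d)"
        by (simp add: nn_integral_cmult)
    qed
    then show ?thesis by (simp add: nn_integral_cmult)
  qed
  let ?P = "\<integral>\<^sup>+x. \<integral>\<^sup>+y. ennreal (f x * f y) \<partial>Q x \<partial>\<nu>" and ?N = "\<integral>\<^sup>+x. \<integral>\<^sup>+y. ennreal (- (f x * f y)) \<partial>Q x \<partial>\<nu>"
  \<comment> \<open>The diagonal part drops out of the negative integral, since the negative part of
    \<open>f x * f x\<close> is 0. In the positive integral it can only add.\<close>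
  have "?N = (\<integral>\<^sup>+x. \<integral>\<^sup>+y. ennreal (jump x y) * ennreal (- (f x * f y)) \<partial>euclid d \<partial>euclid d)"
    by (subst nn_integral_Q_\<nu>) (auto simp: ennreal_neg)
  also have "\<dots> \<le> (\<integral>\<^sup>+x. \<integral>\<^sup>+y. ennreal (jump x y) * ennreal (f x * f y) \<partial>euclid d \<partial>euclid d)"
  proof -
    have "ennreal Z * (\<integral>\<^sup>+x. \<integral>\<^sup>+y. ennreal (jump x y) * ennreal (- (f x * f y)) \<partial>euclid d \<partial>euclid d)
      \<le> ennreal Z * (\<integral>\<^sup>+x. \<integral>\<^sup>+y. ennreal (jump x y) * ennreal (f x * f y) \<partial>euclid d \<partial>euclid d)"
      using gram_kernel_positive[OF sigma_finite_euclid El.sigma_finite_measure_axioms h, of f]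
      by (simp add: scaled)
    then show ?thesis using Z_pos by (subst (asm) ennreal_mult_le_mult_iff) auto
  qed
  also have "\<dots> \<le> ?P" by (subst nn_integral_Q_\<nu>) auto
  finally have le: "?N \<le> ?P" .
  have fin: "(\<integral>\<^sup>+x. \<integral>\<^sup>+y. ennreal \<bar>f x * f y\<bar> \<partial>Q x \<partial>\<nu>) < \<infinity>" by (rule Q.square_integrable_fubini[OF f f])
  have "?P \<le> (\<integral>\<^sup>+x. \<integral>\<^sup>+y. ennreal \<bar>f x * f y\<bar> \<partial>Q x \<partial>\<nu>)"
    by (intro nn_integral_mono ennreal_leI) auto
  then have P: "?P < top" using fin by (simp add: le_less_trans)
  have "(\<integral>x. f x * (\<integral>y. f y \<partial>Q x) \<partial>\<nu>) = (\<integral>x. \<integral>y. f x * f y \<partial>Q x \<partial>\<nu>)" by simp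
  also have "\<dots> = enn2real ?P - enn2real ?N"
    by (rule kernel_fubini(3)[OF Q.kernel _ fin]) measurable
  finally show ?thesis using enn2real_mono[OF le P] by simp
qed

text \<open>\<open>variance_le_energy\<close> is for bounded functions. The truncations
  \<open>t n\<close> are contractions of \<open>f\<close>, so their energies are bounded by the
  Dirichlet form of \<open>f\<close>, and their variances converge to that of \<open>f\<close> by
  dominated convergence.\<close>

lemma Q_gap:
  assumes f: "square_integrable \<nu> f"
  shows "gap_const * m / (d * L) * ((\<integral>x. (f x)\<^sup>2 \<partial>\<nu>) - (\<integral>x. f x \<partial>\<nu>)\<^sup>2)
    \<le> (\<integral>x. (f x)\<^sup>2 \<partial>\<nu>) - (\<integral>x. f x * (\<integral>y. f y \<partial>Q x) \<partial>\<nu>)"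
proof -
  interpret Q: reversible_kernel \<nu> Q by (rule reversible_Q)
  have [measurable]: "f \<in> borel_measurable (euclid d)" using f by (simp add: square_integrable_def measurable_cong_sets[OF sets_\<nu> refl])
  define D where "D = (\<integral>x. \<integral>y. (f x - f y)\<^sup>2 \<partial>Q x \<partial>\<nu>)"
  define Kc where "Kc = 578 * L * d / (m * (tail_mass / 2) ^ 4 * accept_floor)"
  have Kc: "0 < Kc" using L d m tail_mass accept_floor by (simp add: Kc_def)
  define t where "t n x = max (- real n) (min (real n) (f x))" for n x
  have t_meas [measurable]: "t n \<in> borel_measurable (euclid d)" for n unfolding t_def by measurable
  have t_le: "\<bar>t n x\<bar> \<le> \<bar>f x\<bar>" "\<bar>t n x\<bar> \<le> real n" for n x by (auto simp: t_def)
  have t_contr: "(t n x - t n y)\<^sup>2 \<le> (f x - f y)\<^sup>2" for n x y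
  proof -
    have "\<bar>t n x - t n y\<bar> \<le> \<bar>f x - f y\<bar>" unfolding t_def by linarith
    then show ?thesis by (simp add: abs_le_square_iff)
  qed
  have t_lim: "(\<lambda>n. t n x) \<longlonglongrightarrow> f x" for x
  proof (rule tendsto_eventually)
    have "\<forall>\<^sub>F n in sequentially. \<bar>f x\<bar> \<le> real n"
      using eventually_ge_at_top[of "nat \<lceil>\<bar>f x\<bar>\<rceil>"] by eventually_elim linarith
    then show "\<forall>\<^sub>F n in sequentially. t n x = f x" by eventually_elim (auto simp: t_def)
  qed
  have var: "(\<integral>x. (t n x)\<^sup>2 \<partial>\<nu>) - (\<integral>x. t n x \<partial>\<nu>)\<^sup>2 \<le> Kc * D" for n
  proof -
    have sq: "square_integrable \<nu> (t n)"
      unfolding square_integrable_def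
    proof
      show "integrable \<nu> (\<lambda>x. (t n x)\<^sup>2)"
      proof (rule \<nu>.integrable_const_bound[of _ "(real n)\<^sup>2"])
        show "AE x in \<nu>. norm ((t n x)\<^sup>2) \<le> (real n)\<^sup>2"
          using power_mono[OF t_le(2)[of n], of _ 2] by simp
      qed measurable
    qed measurable
    have "(\<integral>x. (t n x)\<^sup>2 \<partial>\<nu>) - (\<integral>x. t n x \<partial>\<nu>)\<^sup>2 = (\<integral>x. (t n x - (\<integral>x. t n x \<partial>\<nu>))\<^sup>2 \<partial>\<nu>)"
      using sq \<nu>.square_integrable_imp_integrable[OF sq]
      by (intro \<nu>.variance_eq[symmetric]) (auto simp: square_integrable_def)
    also have "\<dots> \<le> Kc * (\<integral>x. energy (t n) x \<partial>\<nu>)"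
      unfolding Kc_def by (rule variance_le_energy[OF t_meas t_le(2)])
    also have "(\<integral>x. energy (t n) x \<partial>\<nu>) \<le> D"
      unfolding D_def
    proof (rule integral_mono_AE)
      show "integrable \<nu> (energy (t n))"
      proof (rule \<nu>.integrable_const_bound[of _ "(2 * real n)\<^sup>2"])
        show "AE x in \<nu>. norm (energy (t n) x) \<le> (2 * real n)\<^sup>2"
          using energy_bounds[OF t_meas[of n] t_le(2)[of n]] by (auto simp: space_euclid)
      qed (use energy_measurable[OF t_meas[of n] t_le(2)[of n]] in measurable)
      show "integrable \<nu> (\<lambda>x. \<integral>y. (f x - f y)\<^sup>2 \<partial>Q x)" by (rule Q.dirichlet_form(2)[OF f])
      show "AE x in \<nu>. energy (t n) x \<le> (\<integral>y. (f x - f y)\<^sup>2 \<partial>Q x)"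
        using AE_space Q.AE_square_integrable_kernel[OF f]
      proof eventually_elim
        fix x assume x: "x \<in> space \<nu>" and sqx: "square_integrable (Q x) f"
        then have xp: "x \<in> pts" by (simp add: space_euclid)
        interpret Qx: prob_space "Q x" by (rule Q.kernelD(1)[OF x])
        have i: "integrable (Q x) (\<lambda>y. (f x - f y)\<^sup>2)"
          using square_integrable_lincomb[OF Qx.square_integrable_const[of "f x"] sqx, of 1 "-1"]
          by (simp add: square_integrable_def)
        have "ennreal (energy (t n) x) = (\<integral>\<^sup>+y. ennreal (accept_prob U x y * (t n x - t n y)\<^sup>2) \<partial>\<gamma> x)"
          unfolding energy_def[OF t_meas t_le(2)]
          by (rule nn_integral_eq_integral[symmetric]) (auto simp: accept_prob_bounds integrable_energy[OF t_meas t_le(2) xp])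
        also have "\<dots> \<le> (\<integral>\<^sup>+y. ennreal (accept_prob U x y) * ennreal ((f x - f y)\<^sup>2) \<partial>\<gamma> x)"
          using t_contr[of n x] accept_prob_bounds[of x]
          by (intro nn_integral_mono) (auto simp: ennreal_mult[symmetric] intro!: ennreal_leI mult_left_mono)
        also have "\<dots> \<le> (\<integral>\<^sup>+y. ennreal ((f x - f y)\<^sup>2) \<partial>Q x)"
          by (subst nn_integral_Q[OF xp]) auto
        also have "\<dots> = ennreal (\<integral>y. (f x - f y)\<^sup>2 \<partial>Q x)"
          by (rule nn_integral_eq_integral[OF i]) auto
        finally show "energy (t n) x \<le> (\<integral>y. (f x - f y)\<^sup>2 \<partial>Q x)"
          by (subst (asm) ennreal_le_iff) auto
      qed
    qed
    finally show ?thesis using Kc by simp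
  qed
  have fsq: "integrable \<nu> (\<lambda>x. (f x)\<^sup>2)" and fi: "integrable \<nu> f"
    using f \<nu>.square_integrable_imp_integrable[OF f] by (auto simp: square_integrable_def)
  have l1: "(\<lambda>n. \<integral>x. (t n x)\<^sup>2 \<partial>\<nu>) \<longlonglongrightarrow> (\<integral>x. (f x)\<^sup>2 \<partial>\<nu>)"
  proof (rule integral_dominated_convergence[OF _ _ fsq])
    show "AE x in \<nu>. (\<lambda>n. (t n x)\<^sup>2) \<longlonglongrightarrow> (f x)\<^sup>2" by (intro AE_I2 tendsto_power t_lim)
    show "AE x in \<nu>. norm ((t n x)\<^sup>2) \<le> (f x)\<^sup>2" for n
      using t_le(1)[of n] by (auto simp: abs_le_square_iff)
  qed measurable
  have l2: "(\<lambda>n. \<integral>x. t n x \<partial>\<nu>) \<longlonglongrightarrow> (\<integral>x. f x \<partial>\<nu>)"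
  proof (rule integral_dominated_convergence[OF _ _ integrable_abs[OF fi]])
    show "AE x in \<nu>. (\<lambda>n. t n x) \<longlonglongrightarrow> f x" by (intro AE_I2 t_lim)
    show "AE x in \<nu>. norm (t n x) \<le> \<bar>f x\<bar>" for n using t_le(1)[of n] by auto
  qed measurable
  have "(\<lambda>n. (\<integral>x. (t n x)\<^sup>2 \<partial>\<nu>) - (\<integral>x. t n x \<partial>\<nu>)\<^sup>2) \<longlonglongrightarrow> (\<integral>x. (f x)\<^sup>2 \<partial>\<nu>) - (\<integral>x. f x \<partial>\<nu>)\<^sup>2"
    by (intro tendsto_diff tendsto_power l1 l2)
  then have "(\<integral>x. (f x)\<^sup>2 \<partial>\<nu>) - (\<integral>x. f x \<partial>\<nu>)\<^sup>2 \<le> Kc * D"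
    by (rule LIMSEQ_le_const2) (use var in auto)
  also have "D = 2 * ((\<integral>x. (f x)\<^sup>2 \<partial>\<nu>) - (\<integral>x. f x * (\<integral>y. f y \<partial>Q x) \<partial>\<nu>))"
    using Q.dirichlet_form(1)[OF f] by (simp add: D_def Q.apply_kernel_def)
  finally have "(\<integral>x. (f x)\<^sup>2 \<partial>\<nu>) - (\<integral>x. f x \<partial>\<nu>)\<^sup>2
    \<le> (Kc * 2) * ((\<integral>x. (f x)\<^sup>2 \<partial>\<nu>) - (\<integral>x. f x * (\<integral>y. f y \<partial>Q x) \<partial>\<nu>))"
    by (simp only: mult.assoc)
  then have "gap_const * m / (d * L) * ((\<integral>x. (f x)\<^sup>2 \<partial>\<nu>) - (\<integral>x. f x \<partial>\<nu>)\<^sup>2)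
    \<le> gap_const * m / (d * L) * ((Kc * 2) * ((\<integral>x. (f x)\<^sup>2 \<partial>\<nu>) - (\<integral>x. f x * (\<integral>y. f y \<partial>Q x) \<partial>\<nu>)))"
    using gap_const(1) m L by (intro mult_left_mono) auto
  also have "\<dots> = (gap_const * m / (d * L) * (Kc * 2)) * ((\<integral>x. (f x)\<^sup>2 \<partial>\<nu>) - (\<integral>x. f x * (\<integral>y. f y \<partial>Q x) \<partial>\<nu>))"
    by (simp only: mult.assoc)
  also have "gap_const * m / (d * L) * (Kc * 2) = 1"
    using m L d tail_mass accept_floor by (simp add: Kc_def gap_const_def)
  finally show ?thesis by simp
qed

end

section \<open>Random-scan Gibbs kernels\<close>

text \<open>Positivity is applied to \<open>f\<close> minus its mean. The squared mean is the
  quadratic form of the kernel that samples directly from \<open>M\<close>, so this upgrades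
  positivity to a comparison with the exact conditional kernel.\<close>

lemma (in reversible_kernel) mean_square_le:
  assumes pos: "\<And>g. square_integrable M g \<Longrightarrow> 0 \<le> (\<integral>x. g x * (\<integral>y. g y \<partial>K x) \<partial>M)"
    and f: "square_integrable M f"
  shows "(\<integral>x. f x \<partial>M)\<^sup>2 \<le> (\<integral>x. f x * (\<integral>y. f y \<partial>K x) \<partial>M)"
proof -
  define c where "c = (\<integral>x. f x \<partial>M)"
  have sq: "square_integrable M (\<lambda>x. f x - c)"
    using square_integrable_lincomb[OF f square_integrable_const[of 1], of 1 "- c"] by simp
  have i: "integrable M f" "integrable M (\<lambda>x. f x * apply_kernel f x)" "integrable M (apply_kernel f)"
    using square_integrable_imp_integrable[OF f] square_integrable_mult[OF f square_integrable_apply_kernel[OF f]]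
     square_integrable_imp_integrable[OF square_integrable_apply_kernel[OF f]] by auto
  have [measurable]: "f \<in> borel_measurable M" using f by (simp add: square_integrable_def)
  have "0 \<le> (\<integral>x. (f x - c) * apply_kernel (\<lambda>x. f x - c) x \<partial>M)"
    using pos[OF sq] by (simp add: apply_kernel_def)
  also have "\<dots> = (\<integral>x. f x * apply_kernel f x - c * apply_kernel f x - c * f x + c\<^sup>2 \<partial>M)"
  proof (rule integral_cong_AE)
    show "AE x in M. (f x - c) * apply_kernel (\<lambda>x. f x - c) x = f x * apply_kernel f x - c * apply_kernel f x - c * f x + c\<^sup>2"
      using AE_space AE_square_integrable_kernel[OF f]
    proof eventually_elim
      fix x assume x: "x \<in> space M" and s: "square_integrable (K x) f"
      interpret Kx: prob_space "K x" by (rule kernelD[OF x])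
      have e: "apply_kernel (\<lambda>x. f x - c) x = apply_kernel f x - c"
        using Kx.square_integrable_imp_integrable[OF s] by (simp add: apply_kernel_def Kx.prob_space)
      show "(f x - c) * apply_kernel (\<lambda>x. f x - c) x = f x * apply_kernel f x - c * apply_kernel f x - c * f x + c\<^sup>2"
        unfolding e by (simp add: power2_eq_square algebra_simps)
    qed
  qed (intro borel_measurable_times borel_measurable_diff borel_measurable_add measurable_apply_kernel borel_measurable_const; measurable)+
  also have "\<dots> = (\<integral>x. f x * apply_kernel f x \<partial>M) - c\<^sup>2"
    using i integral_apply_kernel[OF f] by (simp add: prob_space power2_eq_square c_def[symmetric])
  finally show ?thesis by (simp add: c_def apply_kernel_def)
qed

lemma reversible_kernel_const:
  assumes "prob_space M"
  shows "reversible_kernel M (\<lambda>_. M)"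
proof -
  interpret prob_space M by fact
  interpret P: pair_sigma_finite M M ..
  show ?thesis
  proof
    show "(\<lambda>_. M) \<in> M \<rightarrow>\<^sub>M prob_algebra M"
      by (rule measurable_const) (simp add: space_prob_algebra prob_space_axioms)
    fix F :: "'a \<Rightarrow> 'a \<Rightarrow> ennreal" assume "(\<lambda>(x, y). F x y) \<in> borel_measurable (M \<Otimes>\<^sub>M M)"
    then show "(\<integral>\<^sup>+x. \<integral>\<^sup>+y. F x y \<partial>M \<partial>M) = (\<integral>\<^sup>+x. \<integral>\<^sup>+y. F y x \<partial>M \<partial>M)"
      by (intro P.Fubini') simp
  qed
qed

lemma integral_mixture:
  fixes f :: "'a \<Rightarrow> real"
  assumes fin: "finite I" and p: "\<And>i. i \<in> I \<Longrightarrow> 0 \<le> p i"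
    and mix: "\<And>g. g \<in> borel_measurable M \<Longrightarrow> (\<integral>\<^sup>+x. g x \<partial>K) = (\<Sum>i\<in>I. ennreal (p i) * (\<integral>\<^sup>+x. (g x :: ennreal) \<partial>N i))"
    and sets: "sets K = sets M" and f [measurable]: "f \<in> borel_measurable M"
    and int: "\<And>i. i \<in> I \<Longrightarrow> integrable (N i) f"
  shows "(\<integral>x. f x \<partial>K) = (\<Sum>i\<in>I. p i * (\<integral>x. f x \<partial>N i))"
proof -
  \<comment> \<open>\<open>h\<close> will be the absolute value, the identity and the negation:
    integrability first, then the positive and the negative part.\<close>
  have e: "(\<integral>\<^sup>+x. ennreal (h (f x)) \<partial>K) = ennreal (\<Sum>i\<in>I. p i * enn2real (\<integral>\<^sup>+x. ennreal (h (f x)) \<partial>N i))"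
    if [measurable]: "h \<in> borel_measurable borel" and h: "\<And>x. h x \<le> \<bar>x\<bar>" for h
  proof -
    have "(\<integral>\<^sup>+x. ennreal (h (f x)) \<partial>N i) < top" if "i \<in> I" for i
    proof -
      have "(\<integral>\<^sup>+x. ennreal (h (f x)) \<partial>N i) \<le> (\<integral>\<^sup>+x. ennreal (norm (f x)) \<partial>N i)"
        using h by (intro nn_integral_mono ennreal_leI) auto
      also have "\<dots> < top" using int[OF that] by (simp add: integrable_iff_bounded)
      finally show ?thesis .
    qed
    then have "(\<Sum>i\<in>I. ennreal (p i) * (\<integral>\<^sup>+x. ennreal (h (f x)) \<partial>N i))
      = (\<Sum>i\<in>I. ennreal (p i * enn2real (\<integral>\<^sup>+x. ennreal (h (f x)) \<partial>N i)))"
      using p by (intro sum.cong) (auto simp: ennreal_mult)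
    also have "\<dots> = ennreal (\<Sum>i\<in>I. p i * enn2real (\<integral>\<^sup>+x. ennreal (h (f x)) \<partial>N i))"
      using p by (intro sum_ennreal) auto
    finally show ?thesis by (subst mix) auto
  qed
  have fK: "f \<in> borel_measurable K" using sets by (simp cong: measurable_cong_sets)
  have "integrable K f"
    using e[of abs] fK by (simp add: integrable_iff_bounded)
  then have "(\<integral>x. f x \<partial>K) = enn2real (\<integral>\<^sup>+x. ennreal (f x) \<partial>K) - enn2real (\<integral>\<^sup>+x. ennreal (- f x) \<partial>K)"
    by (rule real_lebesgue_integral_def)
  also have "\<dots> = (\<Sum>i\<in>I. p i * enn2real (\<integral>\<^sup>+x. ennreal (f x) \<partial>N i)) - (\<Sum>i\<in>I. p i * enn2real (\<integral>\<^sup>+x. ennreal (- f x) \<partial>N i))"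
    using e[of "\<lambda>x. x"] e[of uminus] p by (simp add: sum_nonneg)
  also have "\<dots> = (\<Sum>i\<in>I. p i * (\<integral>x. f x \<partial>N i))"
    unfolding sum_subtractf[symmetric] using int
    by (intro sum.cong refl) (simp add: real_lebesgue_integral_def right_diff_distrib)
  finally show ?thesis .
qed

section \<open>Disintegration of the target along one coordinate\<close>

locale gibbs_target =
  fixes n :: nat and d :: "nat \<Rightarrow> nat" and \<xi> :: "(nat \<Rightarrow> nat \<Rightarrow> real) \<Rightarrow> real"
  assumes \<xi> [measurable]: "\<xi> \<in> borel_measurable (state_space n d)"
    and \<xi>_integrable: "integrable (state_space n d) (\<lambda>x. exp (- \<xi> x))"
begin

abbreviation S where "S \<equiv> state_space n d"

definition \<mu> where "\<mu> = gibbs_measure S \<xi>"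

definition Z\<^sub>0 where "Z\<^sub>0 = (\<integral>x. exp (- \<xi> x) \<partial>S)"

sublocale prod: product_sigma_finite "\<lambda>j. euclid (d j)"
  by standard

lemma emeasure_state_space: "emeasure S (space S) \<noteq> 0"
proof -
  have "emeasure S (PiE {1..n} (\<lambda>j. space (euclid (d j)))) = (\<Prod>j=1..n. emeasure (euclid (d j)) (space (euclid (d j))))"
    unfolding state_space_def by (rule prod.emeasure_PiM) auto
  then show ?thesis using emeasure_euclid_space by (simp add: state_space_def space_PiM)
qed

lemma Z\<^sub>0_pos: "0 < Z\<^sub>0"
  unfolding Z\<^sub>0_def by (rule gibbs_normalizer_pos[OF \<xi>_integrable emeasure_state_space])

lemma sets_\<mu> [simp, measurable_cong]: "sets \<mu> = sets S" and space_\<mu> [simp]: "space \<mu> = space S"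
  by (simp_all add: \<mu>_def gibbs_measure_def)

sublocale \<mu>: prob_space \<mu>
  unfolding \<mu>_def by (rule prob_space_gibbs_measure[OF \<xi> \<xi>_integrable emeasure_state_space])

context
  fixes i assumes i: "i \<in> {1..n}"
begin

abbreviation R where "R \<equiv> rest_space n d i"
abbreviation M where "M \<equiv> euclid (d i)"

lemma insert_index: "insert i ({1..n} - {i}) = {1..n}" using i by auto

lemma measurable_insert: "(\<lambda>(y, z). y(i := z)) \<in> R \<Otimes>\<^sub>M M \<rightarrow>\<^sub>M S"
  using measurable_add_dim[of i "{1..n} - {i}" "\<lambda>j. euclid (d j)"]
  unfolding insert_index by (simp add: rest_space_def state_space_def)

lemma measurable_drop: "drop_comp n i \<in> S \<rightarrow>\<^sub>M R"
  unfolding drop_comp_def[abs_def] state_space_def rest_space_def by (rule measurable_restrict_subset) auto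

lemma measurable_coord: "(\<lambda>x. x i) \<in> S \<rightarrow>\<^sub>M M"
  unfolding state_space_def by (rule measurable_component_singleton[OF i])

lemma drop_insert:
  assumes "y \<in> space R" "z \<in> space M"
  shows "drop_comp n i (y(i := z)) = y" "y(i := z) \<in> space S"
proof -
  show "drop_comp n i (y(i := z)) = y"
    using assms(1) by (auto simp: drop_comp_def rest_space_def space_PiM fun_eq_iff restrict_def PiE_def extensional_def)
  show "y(i := z) \<in> space S"
    using measurable_space[OF measurable_insert, of "(y, z)"] assms by (simp add: space_pair_measure)
qed

lemma insert_measurable:
  assumes "F \<in> S \<rightarrow>\<^sub>M N"
  shows "(\<lambda>(y, z). F (y(i := z))) \<in> R \<Otimes>\<^sub>M M \<rightarrow>\<^sub>M N"
    and "y \<in> space R \<Longrightarrow> (\<lambda>z. F (y(i := z))) \<in> M \<rightarrow>\<^sub>M N"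
proof -
  show 1: "(\<lambda>(y, z). F (y(i := z))) \<in> R \<Otimes>\<^sub>M M \<rightarrow>\<^sub>M N"
    using measurable_compose[OF measurable_insert assms] by (simp add: split_beta')
  show "y \<in> space R \<Longrightarrow> (\<lambda>z. F (y(i := z))) \<in> M \<rightarrow>\<^sub>M N"
    using measurable_compose[OF measurable_Pair1' 1] by simp
qed

lemma nn_integral_state:
  assumes F: "F \<in> borel_measurable S"
  shows "(\<integral>\<^sup>+x. F x \<partial>S) = (\<integral>\<^sup>+y. \<integral>\<^sup>+z. F (y(i := z)) \<partial>M \<partial>R)"
  using prod.product_nn_integral_insert[of "{1..n} - {i}" i F] F
  unfolding insert_index by (simp add: rest_space_def state_space_def)

text \<open>The unnormalised density of the remaining coordinates; it is infinite exactly at those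
  \<open>y\<close> for which \<open>cond_dist\<close> falls back on a point mass.\<close>

definition W where "W y = (\<integral>\<^sup>+z. ennreal (exp (- cond_pot \<xi> i y z)) \<partial>M)"

lemma cond_pot_measurable:
  "(\<lambda>(y, z). cond_pot \<xi> i y z) \<in> borel_measurable (R \<Otimes>\<^sub>M M)"
  "y \<in> space R \<Longrightarrow> cond_pot \<xi> i y \<in> borel_measurable M"
  using insert_measurable[OF \<xi>] by (simp_all add: cond_pot_def[abs_def])

lemma measurable_W [measurable]: "W \<in> borel_measurable R"
proof -
  note [measurable] = cond_pot_measurable(1)
  have "(\<lambda>(y, z). ennreal (exp (- cond_pot \<xi> i y z))) \<in> borel_measurable (R \<Otimes>\<^sub>M M)" by measurable
  then show ?thesis unfolding W_def[abs_def] by (rule euclid.borel_measurable_nn_integral)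
qed

lemma integrable_section_iff:
  assumes "y \<in> space R"
  shows "integrable M (\<lambda>z. exp (- cond_pot \<xi> i y z)) \<longleftrightarrow> W y < \<infinity>"
  using cond_pot_measurable(2)[OF assms] by (simp add: integrable_iff_bounded W_def)

lemma AE_integrable_section: "AE y in R. integrable M (\<lambda>z. exp (- cond_pot \<xi> i y z))"
proof -
  have "(\<integral>\<^sup>+y. W y \<partial>R) = (\<integral>\<^sup>+x. ennreal (exp (- \<xi> x)) \<partial>S)"
    by (subst nn_integral_state) (auto simp: W_def[abs_def] cond_pot_def)
  also have "\<dots> < \<infinity>" using \<xi>_integrable by (simp add: integrable_iff_bounded)
  finally have "AE y in R. W y \<noteq> \<infinity>" by (intro nn_integral_PInf_AE) auto
  with AE_space show ?thesis by eventually_elim (simp add: integrable_section_iff less_top)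
qed

lemma W_eq:
  assumes "integrable M (\<lambda>z. exp (- cond_pot \<xi> i y z))"
  shows "W y = ennreal (\<integral>z. exp (- cond_pot \<xi> i y z) \<partial>M)" "0 < (\<integral>z. exp (- cond_pot \<xi> i y z) \<partial>M)"
  using assms nn_integral_eq_integral[OF assms] gibbs_normalizer_pos[OF assms emeasure_euclid_space]
  by (auto simp: W_def)

lemma sets_cond_dist [simp, measurable_cong]: "sets (cond_dist d \<xi> i y) = sets M"
  and space_cond_dist [simp]: "space (cond_dist d \<xi> i y) = space M"
  by (simp_all add: cond_dist_def gibbs_measure_def)

lemma prob_space_cond_dist: "y \<in> space R \<Longrightarrow> prob_space (cond_dist d \<xi> i y)"
  unfolding cond_dist_def using cond_pot_measurable(2) emeasure_euclid_space
  by (auto intro!: prob_space_gibbs_measure prob_space_return simp: space_euclid)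

lemma nn_integral_cond_dist:
  assumes y: "y \<in> space R" and int: "integrable M (\<lambda>z. exp (- cond_pot \<xi> i y z))"
    and F [measurable]: "F \<in> borel_measurable M"
  shows "W y * (\<integral>\<^sup>+z. F z \<partial>cond_dist d \<xi> i y) = (\<integral>\<^sup>+z. ennreal (exp (- cond_pot \<xi> i y z)) * F z \<partial>M)"
proof -
  note [measurable] = cond_pot_measurable(2)[OF y]
  let ?Z = "\<integral>z. exp (- cond_pot \<xi> i y z) \<partial>M"
  note Z = W_eq[OF int]
  have "W y * (\<integral>\<^sup>+z. F z \<partial>cond_dist d \<xi> i y) = ennreal ?Z * (\<integral>\<^sup>+z. ennreal (exp (- cond_pot \<xi> i y z) / ?Z) * F z \<partial>M)"
    using int by (simp add: cond_dist_def gibbs_measure_def nn_integral_density Z)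
  also have "\<dots> = (\<integral>\<^sup>+z. ennreal ?Z * (ennreal (exp (- cond_pot \<xi> i y z) / ?Z) * F z) \<partial>M)"
    by (rule nn_integral_cmult[symmetric]) measurable
  also have "\<dots> = (\<integral>\<^sup>+z. ennreal (exp (- cond_pot \<xi> i y z)) * F z \<partial>M)"
    using Z(2) by (intro nn_integral_cong) (simp add: mult.assoc[symmetric] ennreal_mult'[symmetric])
  finally show ?thesis .
qed

text \<open>Measurability is required on all of \<open>R\<close>, including the null set of
  non-integrable sections, so the measurable formula distinguishes by
  \<open>W y < \<infinity>\<close> and reproduces the point mass there.\<close>

lemma cond_dist_kernel: "cond_dist d \<xi> i \<in> R \<rightarrow>\<^sub>M prob_algebra M"
proof (rule measurable_prob_kernelI)
  fix A assume A [measurable]: "A \<in> sets M"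
  note [measurable] = cond_pot_measurable(1)
  have "(\<lambda>y. \<integral>\<^sup>+z. ennreal (exp (- cond_pot \<xi> i y z)) * indicator A z \<partial>M) \<in> borel_measurable R"
    by measurable
  then have "(\<lambda>y. if W y < \<infinity> then (\<integral>\<^sup>+z. ennreal (exp (- cond_pot \<xi> i y z)) * indicator A z \<partial>M) / W y
      else indicator A (\<lambda>j\<in>{..<d i}. 0)) \<in> borel_measurable R"
    by measurable
  also have "?this \<longleftrightarrow> (\<lambda>y. emeasure (cond_dist d \<xi> i y) A) \<in> borel_measurable R"
  proof (rule measurable_cong)
    fix y assume y: "y \<in> space R"
    show "(if W y < \<infinity> then (\<integral>\<^sup>+z. ennreal (exp (- cond_pot \<xi> i y z)) * indicator A z \<partial>M) / W y
      else indicator A (\<lambda>j\<in>{..<d i}. 0)) = emeasure (cond_dist d \<xi> i y) A"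
    proof (cases "W y < \<infinity>")
      case True
      then have int: "integrable M (\<lambda>z. exp (- cond_pot \<xi> i y z))" by (simp add: integrable_section_iff[OF y])
      have e: "W y * emeasure (cond_dist d \<xi> i y) A = (\<integral>\<^sup>+z. ennreal (exp (- cond_pot \<xi> i y z)) * indicator A z \<partial>M)"
        using nn_integral_cond_dist[OF y int, of "indicator A"] by simp
      have "W y \<noteq> 0" "W y \<noteq> top" using W_eq[OF int] True by auto
      then show ?thesis using True by (simp add: e[symmetric] mult.commute[of "W y"] ennreal_mult_divide_eq)
    next
      case False
      then have "\<not> integrable M (\<lambda>z. exp (- cond_pot \<xi> i y z))" by (simp add: integrable_section_iff[OF y])
      then show ?thesis using False by (simp add: cond_dist_def)
    qed
  qed
  finally show "(\<lambda>y. emeasure (cond_dist d \<xi> i y) A) \<in> borel_measurable R" .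
qed (auto simp: prob_space_cond_dist)

definition marg where "marg = density R (\<lambda>y. W y / ennreal Z\<^sub>0)"

lemma sets_marg [simp, measurable_cong]: "sets marg = sets R" and space_marg [simp]: "space marg = space R"
  by (simp_all add: marg_def)

lemma AE_marg: "AE y in R. P y \<Longrightarrow> AE y in marg. P y"
  unfolding marg_def by (subst AE_density) (auto elim: eventually_mono)

text \<open>The density \<open>W\<close> of the marginal cancels the normaliser of the conditional
  distribution, and the exceptional sections form a null set by Tonelli.\<close>

lemma disintegration:
  assumes F [measurable]: "F \<in> borel_measurable S"
  shows "(\<integral>\<^sup>+x. F x \<partial>\<mu>) = (\<integral>\<^sup>+y. \<integral>\<^sup>+z. F (y(i := z)) \<partial>cond_dist d \<xi> i y \<partial>marg)"
proof -
  have m: "(\<lambda>y. \<integral>\<^sup>+z. F (y(i := z)) \<partial>cond_dist d \<xi> i y) \<in> borel_measurable R"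
    using nn_integral_measurable_subprob_algebra2[OF insert_measurable(1)[OF F] measurable_prob_algebraD[OF cond_dist_kernel]] .
  have "(\<integral>\<^sup>+y. \<integral>\<^sup>+z. F (y(i := z)) \<partial>cond_dist d \<xi> i y \<partial>marg)
    = (\<integral>\<^sup>+y. W y / ennreal Z\<^sub>0 * (\<integral>\<^sup>+z. F (y(i := z)) \<partial>cond_dist d \<xi> i y) \<partial>R)"
    unfolding marg_def using m by (intro nn_integral_density) auto
  also have "\<dots> = (\<integral>\<^sup>+y. \<integral>\<^sup>+z. ennreal (exp (- \<xi> (y(i := z))) / Z\<^sub>0) * F (y(i := z)) \<partial>M \<partial>R)"
  proof (rule nn_integral_cong_AE, use AE_space AE_integrable_section in eventually_elim)
    fix y assume y: "y \<in> space R" and int: "integrable M (\<lambda>z. exp (- cond_pot \<xi> i y z))"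
    note [measurable] = insert_measurable(2)[OF F y] insert_measurable(2)[OF \<xi> y]
    have "W y / ennreal Z\<^sub>0 * (\<integral>\<^sup>+z. F (y(i := z)) \<partial>cond_dist d \<xi> i y) = inverse (ennreal Z\<^sub>0) * (W y * (\<integral>\<^sup>+z. F (y(i := z)) \<partial>cond_dist d \<xi> i y))"
      by (simp add: divide_ennreal_def mult_ac)
    also have "W y * (\<integral>\<^sup>+z. F (y(i := z)) \<partial>cond_dist d \<xi> i y) = (\<integral>\<^sup>+z. ennreal (exp (- cond_pot \<xi> i y z)) * F (y(i := z)) \<partial>M)"
      by (rule nn_integral_cond_dist[OF y int]) measurable
    also have "inverse (ennreal Z\<^sub>0) * \<dots> = (\<integral>\<^sup>+z. inverse (ennreal Z\<^sub>0) * (ennreal (exp (- \<xi> (y(i := z)))) * F (y(i := z))) \<partial>M)"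
      unfolding cond_pot_def by (rule nn_integral_cmult[symmetric]) measurable
    also have "\<dots> = (\<integral>\<^sup>+z. ennreal (exp (- \<xi> (y(i := z))) / Z\<^sub>0) * F (y(i := z)) \<partial>M)"
      using Z\<^sub>0_pos by (intro nn_integral_cong) (simp add: divide_ennreal[symmetric] divide_ennreal_def mult_ac)
    finally show "W y / ennreal Z\<^sub>0 * (\<integral>\<^sup>+z. F (y(i := z)) \<partial>cond_dist d \<xi> i y) =
      (\<integral>\<^sup>+z. ennreal (exp (- \<xi> (y(i := z))) / Z\<^sub>0) * F (y(i := z)) \<partial>M)" .
  qed
  also have "\<dots> = (\<integral>\<^sup>+x. ennreal (exp (- \<xi> x) / Z\<^sub>0) * F x \<partial>S)"
    by (subst nn_integral_state) auto
  also have "\<dots> = (\<integral>\<^sup>+x. F x \<partial>\<mu>)"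
    unfolding \<mu>_def gibbs_measure_def Z\<^sub>0_def[symmetric] by (rule nn_integral_density[symmetric]) auto
  finally show ?thesis by simp
qed

lemma
  fixes F :: "_ \<Rightarrow> real"
  assumes F: "integrable \<mu> F"
  shows AE_integrable_cond: "AE y in marg. integrable (cond_dist d \<xi> i y) (\<lambda>z. F (y(i := z)))"
    and integrable_marg: "integrable marg (\<lambda>y. \<integral>z. F (y(i := z)) \<partial>cond_dist d \<xi> i y)"
    and integral_disintegration: "(\<integral>x. F x \<partial>\<mu>) = (\<integral>y. \<integral>z. F (y(i := z)) \<partial>cond_dist d \<xi> i y \<partial>marg)"
proof -
  have Fm [measurable]: "F \<in> borel_measurable S" using borel_measurable_integrable[OF F] by simp
  have k: "cond_dist d \<xi> i \<in> marg \<rightarrow>\<^sub>M prob_algebra M"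
    using cond_dist_kernel by (simp add: measurable_cong_sets[OF sets_marg refl])
  have m: "(\<lambda>(y, z). F (y(i := z))) \<in> borel_measurable (marg \<Otimes>\<^sub>M M)"
    using insert_measurable(1)[OF Fm] by (simp add: measurable_cong_sets[OF sets_pair_measure_cong[OF sets_marg refl] refl])
  have fin: "(\<integral>\<^sup>+y. \<integral>\<^sup>+z. ennreal \<bar>F (y(i := z))\<bar> \<partial>cond_dist d \<xi> i y \<partial>marg) < \<infinity>"
    using F disintegration[of "\<lambda>x. ennreal \<bar>F x\<bar>"] by (simp add: integrable_iff_bounded)
  note kf = kernel_fubini[OF k m fin]
  show "AE y in marg. integrable (cond_dist d \<xi> i y) (\<lambda>z. F (y(i := z)))"
    "integrable marg (\<lambda>y. \<integral>z. F (y(i := z)) \<partial>cond_dist d \<xi> i y)" by (fact kf)+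
  show "(\<integral>x. F x \<partial>\<mu>) = (\<integral>y. \<integral>z. F (y(i := z)) \<partial>cond_dist d \<xi> i y \<partial>marg)"
    unfolding kf(3) real_lebesgue_integral_def[OF F]
    using disintegration[of "\<lambda>x. ennreal (F x)"] disintegration[of "\<lambda>x. ennreal (- F x)"] by simp
qed

section \<open>Lifting a kernel on one coordinate to the full state space\<close>

context
  fixes K :: "(nat \<Rightarrow> nat \<Rightarrow> real) \<Rightarrow> (nat \<Rightarrow> real) \<Rightarrow> (nat \<Rightarrow> real) measure"
  assumes K_kernel: "(\<lambda>x. K (drop_comp n i x) (x i)) \<in> S \<rightarrow>\<^sub>M prob_algebra M"
    and K_reversible: "AE y in R. reversible_kernel (cond_dist d \<xi> i y) (K y)"
begin

text \<open>The update of coordinate \<open>i\<close> as a pushforward from that coordinate alone.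
  It only involves \<open>K\<close> along pairs \<open>drop_comp n i x\<close> and
  \<open>x i\<close>, which is where its measurability is assumed.\<close>

definition lift where "lift x = distr (K (drop_comp n i x) (x i)) S (\<lambda>z. (drop_comp n i x)(i := z))"

lemma lift_kernel: "lift \<in> S \<rightarrow>\<^sub>M prob_algebra S"
  unfolding lift_def[abs_def]
proof (rule measurable_distr_prob_space2[OF K_kernel])
  have "(\<lambda>(x, z). (drop_comp n i x, z)) \<in> S \<Otimes>\<^sub>M M \<rightarrow>\<^sub>M R \<Otimes>\<^sub>M M"
    using measurable_drop by measurable
  from measurable_compose[OF this measurable_insert]
  show "(\<lambda>(x, z). (drop_comp n i x)(i := z)) \<in> S \<Otimes>\<^sub>M M \<rightarrow>\<^sub>M S" by (simp add: split_beta')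
qed

lemma KD:
  assumes "x \<in> space S"
  shows "prob_space (K (drop_comp n i x) (x i))" "sets (K (drop_comp n i x) (x i)) = sets M"
    "space (K (drop_comp n i x) (x i)) = space M"
  using prob_algebra_kernelD[OF K_kernel assms] by auto

lemma measurable_insert_K:
  assumes x: "x \<in> space S"
  shows "(\<lambda>z. (drop_comp n i x)(i := z)) \<in> K (drop_comp n i x) (x i) \<rightarrow>\<^sub>M S"
  using insert_measurable(2)[OF measurable_ident, of "drop_comp n i x"] measurable_space[OF measurable_drop x]
  by (simp add: measurable_cong_sets[OF KD(2)[OF x] refl] id_def)

lemma nn_integral_lift:
  assumes x: "x \<in> space S" and g: "g \<in> borel_measurable S"
  shows "(\<integral>\<^sup>+x'. g x' \<partial>lift x) = (\<integral>\<^sup>+z. g ((drop_comp n i x)(i := z)) \<partial>K (drop_comp n i x) (x i))"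
  unfolding lift_def using nn_integral_distr[OF measurable_insert_K[OF x], of g] g by simp

lemma integral_lift:
  fixes g :: "_ \<Rightarrow> real"
  assumes x: "x \<in> space S" and g: "g \<in> borel_measurable S"
  shows "(\<integral>x'. g x' \<partial>lift x) = (\<integral>z. g ((drop_comp n i x)(i := z)) \<partial>K (drop_comp n i x) (x i))"
  unfolding lift_def by (rule integral_distr[OF measurable_insert_K[OF x] g])

text \<open>A product with a point mass is concentrated on one section, so the measure used in
  \<open>random_scan\<close> is the pushforward \<open>lift\<close>.\<close>

lemma emeasure_distr_return:
  assumes x: "x \<in> space S" and A: "A \<in> sets S"
  shows "emeasure (distr (return R (drop_comp n i x) \<Otimes>\<^sub>M K (drop_comp n i x) (x i)) S (\<lambda>(y, z). y(i := z))) A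
    = emeasure (lift x) A"
proof -
  interpret K: prob_space "K (drop_comp n i x) (x i)" by (rule KD(1)[OF x])
  let ?y = "drop_comp n i x"
  have y: "?y \<in> space R" by (rule measurable_space[OF measurable_drop x])
  let ?P = "return R ?y \<Otimes>\<^sub>M K ?y (x i)"
  have sP: "sets ?P = sets (R \<Otimes>\<^sub>M M)" using KD(2)[OF x] by (intro sets_pair_measure_cong) auto
  have m: "(\<lambda>(y, z). y(i := z)) \<in> ?P \<rightarrow>\<^sub>M S"
    using measurable_insert by (simp add: measurable_cong_sets[OF sP refl])
  have B: "(\<lambda>(y, z). y(i := z)) -` A \<inter> space ?P \<in> sets ?P" by (rule measurable_sets[OF m A])
  have "emeasure (distr ?P S (\<lambda>(y, z). y(i := z))) A = emeasure ?P ((\<lambda>(y, z). y(i := z)) -` A \<inter> space ?P)"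
    by (rule emeasure_distr[OF m A])
  also have "\<dots> = (\<integral>\<^sup>+y. emeasure (K ?y (x i)) (Pair y -` ((\<lambda>(y, z). y(i := z)) -` A \<inter> space ?P)) \<partial>return R ?y)"
    by (rule K.emeasure_pair_measure_alt[OF B])
  also have "\<dots> = emeasure (K ?y (x i)) (Pair ?y -` ((\<lambda>(y, z). y(i := z)) -` A \<inter> space ?P))"
    using K.measurable_emeasure_Pair[OF B] y by (intro nn_integral_return) auto
  also have "Pair ?y -` ((\<lambda>(y, z). y(i := z)) -` A \<inter> space ?P) = (\<lambda>z. ?y(i := z)) -` A \<inter> space (K ?y (x i))"
    using y by (auto simp: space_pair_measure)
  also have "emeasure (K ?y (x i)) \<dots> = emeasure (lift x) A"
    unfolding lift_def by (rule emeasure_distr[OF measurable_insert_K[OF x] A, symmetric])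
  finally show ?thesis .
qed

text \<open>The update leaves \<open>y\<close> fixed, so after disintegration both sides are
  averages over \<open>y\<close>, and for almost every \<open>y\<close> the inner integrals agree by
  reversibility of \<open>K y\<close>.\<close>

lemma lift_reversible: "reversible_kernel \<mu> lift"
proof
  show "lift \<in> \<mu> \<rightarrow>\<^sub>M prob_algebra \<mu>"
    using lift_kernel subprob_algebra_cong[OF sets_\<mu>] by (simp add: prob_algebra_def measurable_cong_sets[OF sets_\<mu> refl])
  have e: "(\<integral>\<^sup>+x. \<integral>\<^sup>+x'. G x x' \<partial>lift x \<partial>\<mu>)
      = (\<integral>\<^sup>+y. \<integral>\<^sup>+z. \<integral>\<^sup>+z'. G (y(i := z)) (y(i := z')) \<partial>K y z \<partial>cond_dist d \<xi> i y \<partial>marg)"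
    if G [measurable]: "(\<lambda>(x, x'). G x x') \<in> borel_measurable (S \<Otimes>\<^sub>M S)" for G :: "_ \<Rightarrow> _ \<Rightarrow> ennreal"
  proof -
    have m: "(\<lambda>x. \<integral>\<^sup>+x'. G x x' \<partial>lift x) \<in> borel_measurable S"
      by (rule nn_integral_measurable_subprob_algebra2[OF G measurable_prob_algebraD[OF lift_kernel]])
    have "(\<integral>\<^sup>+x. \<integral>\<^sup>+x'. G x x' \<partial>lift x \<partial>\<mu>) = (\<integral>\<^sup>+y. \<integral>\<^sup>+z. \<integral>\<^sup>+x'. G (y(i := z)) x' \<partial>lift (y(i := z)) \<partial>cond_dist d \<xi> i y \<partial>marg)"
      by (rule disintegration[OF m])
    also have "\<dots> = (\<integral>\<^sup>+y. \<integral>\<^sup>+z. \<integral>\<^sup>+z'. G (y(i := z)) (y(i := z')) \<partial>K y z \<partial>cond_dist d \<xi> i y \<partial>marg)"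
    proof (intro nn_integral_cong)
      fix y z assume "y \<in> space marg" "z \<in> space (cond_dist d \<xi> i y)"
      then have yz: "y \<in> space R" "z \<in> space M" by auto
      note s = drop_insert[OF yz]
      have "G (y(i := z)) \<in> borel_measurable S" using measurable_compose[OF measurable_Pair1'[OF s(2)] G] by simp
      from nn_integral_lift[OF s(2) this] show "(\<integral>\<^sup>+x'. G (y(i := z)) x' \<partial>lift (y(i := z))) = (\<integral>\<^sup>+z'. G (y(i := z)) (y(i := z')) \<partial>K y z)"
        by (simp add: s)
    qed
    finally show ?thesis .
  qed
  fix F :: "_ \<Rightarrow> _ \<Rightarrow> ennreal" assume "(\<lambda>(x, y). F x y) \<in> borel_measurable (\<mu> \<Otimes>\<^sub>M \<mu>)"
  then have F: "(\<lambda>(x, y). F x y) \<in> borel_measurable (S \<Otimes>\<^sub>M S)"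
    using measurable_cong_sets[OF sets_pair_measure_cong[OF sets_\<mu> sets_\<mu>] refl] by blast
  have F': "(\<lambda>(x, y). F y x) \<in> borel_measurable (S \<Otimes>\<^sub>M S)"
    using measurable_compose[OF measurable_pair_swap' F] by (simp add: split_beta')
  show "(\<integral>\<^sup>+x. \<integral>\<^sup>+y. F x y \<partial>lift x \<partial>\<mu>) = (\<integral>\<^sup>+x. \<integral>\<^sup>+y. F y x \<partial>lift x \<partial>\<mu>)"
    unfolding e[OF F] e[OF F']
  proof (rule nn_integral_cong_AE, use AE_space AE_marg[OF K_reversible] in eventually_elim)
    fix y assume "y \<in> space marg" and r: "reversible_kernel (cond_dist d \<xi> i y) (K y)"
    then have y: "y \<in> space R" by simp
    have "(\<lambda>(z, z'). (y(i := z), y(i := z'))) \<in> M \<Otimes>\<^sub>M M \<rightarrow>\<^sub>M S \<Otimes>\<^sub>M S"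
      using insert_measurable(2)[OF measurable_ident y] by (simp add: id_def) measurable
    from measurable_compose[OF this F]
    have "(\<lambda>(z, z'). F (y(i := z)) (y(i := z'))) \<in> borel_measurable (M \<Otimes>\<^sub>M M)" by (simp add: split_beta')
    then have "(\<lambda>(z, z'). F (y(i := z)) (y(i := z'))) \<in> borel_measurable (cond_dist d \<xi> i y \<Otimes>\<^sub>M cond_dist d \<xi> i y)"
      using measurable_cong_sets[OF sets_pair_measure_cong[OF sets_cond_dist sets_cond_dist] refl] by blast
    from reversible_kernel.reversible[OF r this]
    show "(\<integral>\<^sup>+z. \<integral>\<^sup>+z'. F (y(i := z)) (y(i := z')) \<partial>K y z \<partial>cond_dist d \<xi> i y) =
      (\<integral>\<^sup>+z. \<integral>\<^sup>+z'. F (y(i := z')) (y(i := z)) \<partial>K y z \<partial>cond_dist d \<xi> i y)" .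
  qed
qed

lemma
  assumes f: "square_integrable \<mu> f"
  shows lift_form: "(\<integral>x. f x * (\<integral>x'. f x' \<partial>lift x) \<partial>\<mu>) =
      (\<integral>y. \<integral>z. f (y(i := z)) * (\<integral>z'. f (y(i := z')) \<partial>K y z) \<partial>cond_dist d \<xi> i y \<partial>marg)"
    and integrable_lift_form:
      "integrable marg (\<lambda>y. \<integral>z. f (y(i := z)) * (\<integral>z'. f (y(i := z')) \<partial>K y z) \<partial>cond_dist d \<xi> i y)"
proof -
  interpret L: reversible_kernel \<mu> lift by (rule lift_reversible)
  have fm: "f \<in> borel_measurable S" using f by (simp add: square_integrable_def measurable_cong_sets[OF sets_\<mu> refl])
  have int: "integrable \<mu> (\<lambda>x. f x * (\<integral>x'. f x' \<partial>lift x))"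
    using square_integrable_mult[OF f L.square_integrable_apply_kernel[OF f]] by (simp add: L.apply_kernel_def)
  have e: "(\<integral>z. f (y(i := z)) * (\<integral>x'. f x' \<partial>lift (y(i := z))) \<partial>cond_dist d \<xi> i y) =
    (\<integral>z. f (y(i := z)) * (\<integral>z'. f (y(i := z')) \<partial>K y z) \<partial>cond_dist d \<xi> i y)" if y: "y \<in> space R" for y
  proof (rule Bochner_Integration.integral_cong)
    fix z assume "z \<in> space (cond_dist d \<xi> i y)"
    then have z: "z \<in> space M" by simp
    note s = drop_insert[OF y z]
    show "f (y(i := z)) * (\<integral>x'. f x' \<partial>lift (y(i := z))) = f (y(i := z)) * (\<integral>z'. f (y(i := z')) \<partial>K y z)"
      using integral_lift[OF s(2) fm] by (simp add: s)
  qed simp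
  show "(\<integral>x. f x * (\<integral>x'. f x' \<partial>lift x) \<partial>\<mu>) =
      (\<integral>y. \<integral>z. f (y(i := z)) * (\<integral>z'. f (y(i := z')) \<partial>K y z) \<partial>cond_dist d \<xi> i y \<partial>marg)"
    unfolding integral_disintegration[OF int] by (rule Bochner_Integration.integral_cong) (auto simp: e)
  show "integrable marg (\<lambda>y. \<integral>z. f (y(i := z)) * (\<integral>z'. f (y(i := z')) \<partial>K y z) \<partial>cond_dist d \<xi> i y)"
    using integrable_marg[OF int] by (rule Bochner_Integration.integrable_cong[THEN iffD1, rotated -1]) (auto simp: e)
qed

end

end

end

lemma strongly_convex_smoothD:
  assumes f: "strongly_convex_smooth d m L f" and x: "x \<in> extensional {..<d}" and y: "y \<in> extensional {..<d}"
  shows "m / 2 * sq_dist d x y \<le> f y - f x - (\<Sum>j<d. grad d f x j * (y j - x j))"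
    and "f y - f x - (\<Sum>j<d. grad d f x j * (y j - x j)) \<le> L / 2 * sq_dist d x y"
proof -
  define u where "u = (\<lambda>j\<in>{..<d}. y j - x j)"
  have "vec_add d x u = y" using y by (auto simp: vec_add_def u_def fun_eq_iff restrict_def extensional_def)
  moreover have "(vec_norm d u)\<^sup>2 = sq_dist d x y"
    by (simp add: vec_norm_def L2_set_def sq_dist_def u_def sum_nonneg)
  moreover have "vec_inner d (grad d f x) u = (\<Sum>j<d. grad d f x j * (y j - x j))"
    by (simp add: vec_inner_def u_def)
  moreover have "u \<in> space (euclid d)" "x \<in> space (euclid d)" using x by (auto simp: space_euclid u_def)
  ultimately show "m / 2 * sq_dist d x y \<le> f y - f x - (\<Sum>j<d. grad d f x j * (y j - x j))"
    "f y - f x - (\<Sum>j<d. grad d f x j * (y j - x j)) \<le> L / 2 * sq_dist d x y"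
    using f unfolding strongly_convex_smooth_def by metis+
qed

lemma strongly_convex_smooth_le:
  assumes "strongly_convex_smooth d m L f" "1 \<le> d"
  shows "m \<le> L"
proof -
  define z e where "z = (\<lambda>j\<in>{..<d}. 0 :: real)" and "e = (\<lambda>j\<in>{..<d}. 1 :: real)"
  have "sq_dist d z e = d" by (simp add: sq_dist_def z_def e_def)
  moreover have "m / 2 * sq_dist d z e \<le> L / 2 * sq_dist d z e"
    by (rule order_trans[OF strongly_convex_smoothD[OF assms(1)]]) (auto simp: z_def e_def)
  ultimately show ?thesis using assms(2) by simp
qed

section \<open>From single coordinates to the random scan\<close>

context gibbs_target
begin

context
  fixes p :: "nat \<Rightarrow> real" and K :: "nat \<Rightarrow> (nat \<Rightarrow> nat \<Rightarrow> real) \<Rightarrow> (nat \<Rightarrow> real) \<Rightarrow> (nat \<Rightarrow> real) measure"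
  assumes p: "\<And>i. i \<in> {1..n} \<Longrightarrow> 0 \<le> p i" "(\<Sum>i=1..n. p i) = 1"
    and K: "\<And>i. i \<in> {1..n} \<Longrightarrow> (\<lambda>x. K i (drop_comp n i x) (x i)) \<in> S \<rightarrow>\<^sub>M prob_algebra (euclid (d i))"
    and rev: "\<And>i. i \<in> {1..n} \<Longrightarrow> AE y in rest_space n d i. reversible_kernel (cond_dist d \<xi> i y) (K i y)"
begin

lemma
  assumes x: "x \<in> space S"
  shows emeasure_random_scan: "A \<in> sets S \<Longrightarrow>
      emeasure (random_scan n d p K x) A = (\<Sum>i=1..n. ennreal (p i) * emeasure (lift i (K i) x) A)"
    and nn_integral_random_scan: "g \<in> borel_measurable S \<Longrightarrow>
      (\<integral>\<^sup>+x'. g x' \<partial>random_scan n d p K x) = (\<Sum>i=1..n. ennreal (p i) * (\<integral>\<^sup>+x'. g x' \<partial>lift i (K i) x))"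
    and sets_random_scan: "sets (random_scan n d p K x) = sets S"
proof -
  have s: "sets (lift i (K i) x) = sets S" if "i \<in> {1..n}" for i
    by (simp add: lift_def[OF that K[OF that] rev[OF that]])
  have F: "(\<Sum>i=1..n. ennreal (p i) *
        emeasure (distr (return (rest_space n d i) (drop_comp n i x) \<Otimes>\<^sub>M K i (drop_comp n i x) (x i))
                        S (\<lambda>(y, z). y(i := z))) A) = (\<Sum>i=1..n. ennreal (p i) * emeasure (lift i (K i) x) A)"
    if "A \<in> sets S" for A
    using emeasure_distr_return[OF _ K rev x that] by (intro sum.cong) auto
  show "A \<in> sets S \<Longrightarrow>
      emeasure (random_scan n d p K x) A = (\<Sum>i=1..n. ennreal (p i) * emeasure (lift i (K i) x) A)"
    unfolding random_scan_def by (rule emeasure_mixture[OF _ s F]) auto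
  show "g \<in> borel_measurable S \<Longrightarrow>
      (\<integral>\<^sup>+x'. g x' \<partial>random_scan n d p K x) = (\<Sum>i=1..n. ennreal (p i) * (\<integral>\<^sup>+x'. g x' \<partial>lift i (K i) x))"
    unfolding random_scan_def by (rule nn_integral_mixture[OF _ s F]) auto
  show "sets (random_scan n d p K x) = sets S"
    unfolding random_scan_def by (rule sets.sets_measure_of_eq)
qed

lemma random_scan_kernel: "random_scan n d p K \<in> S \<rightarrow>\<^sub>M prob_algebra S"
proof (rule measurable_prob_kernelI)
  note lk = lift_kernel[OF _ K rev]
  fix x assume x: "x \<in> space S"
  show "sets (random_scan n d p K x) = sets S" by (rule sets_random_scan[OF x])
  show "prob_space (random_scan n d p K x)"
  proof
    have "emeasure (random_scan n d p K x) (space (random_scan n d p K x)) = emeasure (random_scan n d p K x) (space S)"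
      using sets_eq_imp_space_eq[OF sets_random_scan[OF x]] by simp
    also have "\<dots> = (\<Sum>i=1..n. ennreal (p i) * emeasure (lift i (K i) x) (space S))"
      by (rule emeasure_random_scan[OF x]) simp
    also have "\<dots> = (\<Sum>i=1..n. ennreal (p i))"
      using prob_space.emeasure_space_1[OF prob_algebra_kernelD(1)[OF lk x]] prob_algebra_kernelD(3)[OF lk x]
      by (intro sum.cong) auto
    also have "\<dots> = ennreal (\<Sum>i=1..n. p i)" using p(1) by (rule sum_ennreal)
    also have "\<dots> = 1" unfolding p(2) by simp
    finally show "emeasure (random_scan n d p K x) (space (random_scan n d p K x)) = 1" .
  qed
next
  fix A assume A: "A \<in> sets S"
  have "(\<lambda>x. \<Sum>i=1..n. ennreal (p i) * emeasure (lift i (K i) x) A) \<in> borel_measurable S"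
    using measurable_compose[OF measurable_prob_algebraD[OF lift_kernel[OF _ K rev]] measurable_emeasure_subprob_algebra[OF A]]
    by (intro borel_measurable_sum borel_measurable_times_ennreal) auto
  also have "?this \<longleftrightarrow> (\<lambda>x. emeasure (random_scan n d p K x) A) \<in> borel_measurable S"
    by (rule measurable_cong) (simp add: emeasure_random_scan[OF _ A])
  finally show "(\<lambda>x. emeasure (random_scan n d p K x) A) \<in> borel_measurable S" .
qed

lemma random_scan_reversible: "reversible_kernel \<mu> (random_scan n d p K)"
proof
  show "random_scan n d p K \<in> \<mu> \<rightarrow>\<^sub>M prob_algebra \<mu>"
    using random_scan_kernel subprob_algebra_cong[OF sets_\<mu>]
    by (simp add: prob_algebra_def measurable_cong_sets[OF sets_\<mu> refl])
  have e: "(\<integral>\<^sup>+x. \<integral>\<^sup>+y. G x y \<partial>random_scan n d p K x \<partial>\<mu>) = (\<Sum>i=1..n. ennreal (p i) * (\<integral>\<^sup>+x. \<integral>\<^sup>+y. G x y \<partial>lift i (K i) x \<partial>\<mu>))"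
    if G: "(\<lambda>(x, y). G x y) \<in> borel_measurable (S \<Otimes>\<^sub>M S)" for G :: "_ \<Rightarrow> _ \<Rightarrow> ennreal"
  proof -
    have m: "(\<lambda>x. \<integral>\<^sup>+y. G x y \<partial>lift i (K i) x) \<in> borel_measurable \<mu>" if i: "i \<in> {1..n}" for i
      using nn_integral_measurable_subprob_algebra2[OF G measurable_prob_algebraD[OF lift_kernel[OF i K[OF i] rev[OF i]]]]
      by (simp add: measurable_cong_sets[OF sets_\<mu> refl])
    have "(\<integral>\<^sup>+x. \<integral>\<^sup>+y. G x y \<partial>random_scan n d p K x \<partial>\<mu>) = (\<integral>\<^sup>+x. (\<Sum>i=1..n. ennreal (p i) * (\<integral>\<^sup>+y. G x y \<partial>lift i (K i) x)) \<partial>\<mu>)"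
      using measurable_compose[OF measurable_Pair1' G]
      by (intro nn_integral_cong nn_integral_random_scan) auto
    also have "\<dots> = (\<Sum>i=1..n. \<integral>\<^sup>+x. ennreal (p i) * (\<integral>\<^sup>+y. G x y \<partial>lift i (K i) x) \<partial>\<mu>)"
      using m by (intro nn_integral_sum borel_measurable_times_ennreal) auto
    also have "\<dots> = (\<Sum>i=1..n. ennreal (p i) * (\<integral>\<^sup>+x. \<integral>\<^sup>+y. G x y \<partial>lift i (K i) x \<partial>\<mu>))"
      using m by (intro sum.cong nn_integral_cmult) auto
    finally show ?thesis .
  qed
  fix F :: "_ \<Rightarrow> _ \<Rightarrow> ennreal" assume F\<mu>: "(\<lambda>(x, y). F x y) \<in> borel_measurable (\<mu> \<Otimes>\<^sub>M \<mu>)"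
  then have F: "(\<lambda>(x, y). F x y) \<in> borel_measurable (S \<Otimes>\<^sub>M S)"
    using measurable_cong_sets[OF sets_pair_measure_cong[OF sets_\<mu> sets_\<mu>] refl] by blast
  have F': "(\<lambda>(x, y). F y x) \<in> borel_measurable (S \<Otimes>\<^sub>M S)"
    using measurable_compose[OF measurable_pair_swap' F] by (simp add: split_beta')
  show "(\<integral>\<^sup>+x. \<integral>\<^sup>+y. F x y \<partial>random_scan n d p K x \<partial>\<mu>) = (\<integral>\<^sup>+x. \<integral>\<^sup>+y. F y x \<partial>random_scan n d p K x \<partial>\<mu>)"
    unfolding e[OF F] e[OF F']
    using reversible_kernel.reversible[OF lift_reversible[OF _ K rev] F\<mu>] by (intro sum.cong) auto
qed

text \<open>The integral under the mixture is the mixture of the integrals only where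
  \<open>f\<close> is integrable under every lifted kernel, which holds for almost every
  \<open>x\<close> as there are finitely many coordinates.\<close>

lemma random_scan_form:
  assumes f: "square_integrable \<mu> f"
  shows "(\<integral>x. f x * (\<integral>y. f y \<partial>random_scan n d p K x) \<partial>\<mu>) = (\<Sum>i=1..n. p i * (\<integral>x. f x * (\<integral>y. f y \<partial>lift i (K i) x) \<partial>\<mu>))"
proof -
  have fm: "f \<in> borel_measurable S" using f by (simp add: square_integrable_def measurable_cong_sets[OF sets_\<mu> refl])
  note lr = lift_reversible[OF _ K rev]
  interpret T: reversible_kernel \<mu> "random_scan n d p K" by (rule random_scan_reversible)
  have int: "integrable \<mu> (\<lambda>x. f x * (\<integral>y. f y \<partial>lift i (K i) x))" if i: "i \<in> {1..n}" for i
  proof -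
    interpret L: reversible_kernel \<mu> "lift i (K i)" by (rule lr[OF i i i])
    show ?thesis
      using square_integrable_mult[OF f L.square_integrable_apply_kernel[OF f]] by (simp add: L.apply_kernel_def)
  qed
  have "AE x in \<mu>. \<forall>i\<in>{1..n}. integrable (lift i (K i) x) f"
  proof (rule AE_finite_allI)
    fix i assume i: "i \<in> {1..n}"
    interpret L: reversible_kernel \<mu> "lift i (K i)" by (rule lr[OF i i i])
    show "AE x in \<mu>. integrable (lift i (K i) x) f"
      using AE_space L.AE_square_integrable_kernel[OF f]
    proof eventually_elim
      fix x assume x: "x \<in> space \<mu>" and s: "square_integrable (lift i (K i) x) f"
      interpret Lx: prob_space "lift i (K i) x" by (rule L.kernelD(1)[OF x])
      show "integrable (lift i (K i) x) f" by (rule Lx.square_integrable_imp_integrable[OF s])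
    qed
  qed simp
  then have ae: "AE x in \<mu>. f x * (\<integral>y. f y \<partial>random_scan n d p K x) = (\<Sum>i=1..n. p i * (f x * (\<integral>y. f y \<partial>lift i (K i) x)))"
    using AE_space
  proof eventually_elim
    fix x assume "\<forall>i\<in>{1..n}. integrable (lift i (K i) x) f" and "x \<in> space \<mu>"
    then have "(\<integral>y. f y \<partial>random_scan n d p K x) = (\<Sum>i=1..n. p i * (\<integral>y. f y \<partial>lift i (K i) x))"
      using p by (intro integral_mixture[OF _ _ nn_integral_random_scan sets_random_scan fm]) auto
    then show "f x * (\<integral>y. f y \<partial>random_scan n d p K x) = (\<Sum>i=1..n. p i * (f x * (\<integral>y. f y \<partial>lift i (K i) x)))"
      by (simp add: sum_distrib_left mult_ac)
  qed
  have "(\<integral>x. f x * (\<integral>y. f y \<partial>random_scan n d p K x) \<partial>\<mu>) = (\<integral>x. (\<Sum>i=1..n. p i * (f x * (\<integral>y. f y \<partial>lift i (K i) x))) \<partial>\<mu>)"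
  proof (rule integral_cong_AE[OF _ _ ae])
    show "(\<lambda>x. f x * (\<integral>y. f y \<partial>random_scan n d p K x)) \<in> borel_measurable \<mu>"
      using borel_measurable_integrable[OF square_integrable_mult[OF f T.square_integrable_apply_kernel[OF f]]]
      by (simp add: T.apply_kernel_def)
    show "(\<lambda>x. \<Sum>i=1..n. p i * (f x * (\<integral>y. f y \<partial>lift i (K i) x))) \<in> borel_measurable \<mu>"
      using int by (intro borel_measurable_integrable Bochner_Integration.integrable_sum integrable_mult_right) auto
  qed
  also have "\<dots> = (\<Sum>i=1..n. p i * (\<integral>x. f x * (\<integral>y. f y \<partial>lift i (K i) x) \<partial>\<mu>))"
    using int by (subst Bochner_Integration.integral_sum) auto
  finally show ?thesis .
qed

end

lemma cond_dist_section_kernel: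
  assumes i: "i \<in> {1..n}"
  shows "(\<lambda>x. cond_dist d \<xi> i (drop_comp n i x)) \<in> S \<rightarrow>\<^sub>M prob_algebra (euclid (d i))"
    and "AE y in rest_space n d i. reversible_kernel (cond_dist d \<xi> i y) (\<lambda>_. cond_dist d \<xi> i y)"
proof -
  show "(\<lambda>x. cond_dist d \<xi> i (drop_comp n i x)) \<in> S \<rightarrow>\<^sub>M prob_algebra (euclid (d i))"
    by (rule measurable_compose[OF measurable_drop[OF i] cond_dist_kernel[OF i]])
  show "AE y in rest_space n d i. reversible_kernel (cond_dist d \<xi> i y) (\<lambda>_. cond_dist d \<xi> i y)"
    by (intro AE_I2 reversible_kernel_const prob_space_cond_dist[OF i])
qed

text \<open>For the exact kernel the form on a section is the squared conditional mean. Hence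
  \<open>low\<close> compares the forms of the two kernels section by section, \<open>gap\<close> is
  a bound on the conditional variance, and averaging over the marginal transfers both to the full
  space.\<close>

lemma lift_comparison:
  assumes i: "i \<in> {1..n}"
    and K: "(\<lambda>x. K (drop_comp n i x) (x i)) \<in> S \<rightarrow>\<^sub>M prob_algebra (euclid (d i))"
    and rev: "AE y in rest_space n d i. reversible_kernel (cond_dist d \<xi> i y) (K y)"
    and low: "AE y in rest_space n d i. \<forall>g. square_integrable (cond_dist d \<xi> i y) g \<longrightarrow>
       (\<integral>z. g z \<partial>cond_dist d \<xi> i y)\<^sup>2 \<le> (\<integral>z. g z * (\<integral>z'. g z' \<partial>K y z) \<partial>cond_dist d \<xi> i y)"
    and gap: "AE y in rest_space n d i. \<forall>g. square_integrable (cond_dist d \<xi> i y) g \<longrightarrow>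
       c * ((\<integral>z. (g z)\<^sup>2 \<partial>cond_dist d \<xi> i y) - (\<integral>z. g z \<partial>cond_dist d \<xi> i y)\<^sup>2) \<le>
       (\<integral>z. (g z)\<^sup>2 \<partial>cond_dist d \<xi> i y) - (\<integral>z. g z * (\<integral>z'. g z' \<partial>K y z) \<partial>cond_dist d \<xi> i y)"
    and f: "square_integrable \<mu> f"
  defines "E \<equiv> \<integral>x. f x * (\<integral>x'. f x' \<partial>lift i (\<lambda>y z. cond_dist d \<xi> i y) x) \<partial>\<mu>"
    and "P \<equiv> \<integral>x. f x * (\<integral>x'. f x' \<partial>lift i K x) \<partial>\<mu>"
  shows "0 \<le> E" "E \<le> P" "c * ((\<integral>x. (f x)\<^sup>2 \<partial>\<mu>) - E) \<le> (\<integral>x. (f x)\<^sup>2 \<partial>\<mu>) - P"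
proof -
  have fm: "f \<in> borel_measurable S" using f by (simp add: square_integrable_def measurable_cong_sets[OF sets_\<mu> refl])
  have f2: "integrable \<mu> (\<lambda>x. (f x)\<^sup>2)" using f by (simp add: square_integrable_def)
  let ?c = "cond_dist d \<xi> i"
  let ?e = "\<lambda>y. (\<integral>z. f (y(i := z)) \<partial>?c y)\<^sup>2"
  let ?q = "\<lambda>y. \<integral>z. f (y(i := z)) * (\<integral>z'. f (y(i := z')) \<partial>K y z) \<partial>?c y"
  let ?s = "\<lambda>y. \<integral>z. (f (y(i := z)))\<^sup>2 \<partial>?c y"
  have E: "E = (\<integral>y. ?e y \<partial>marg i)" "integrable (marg i) ?e"
    using lift_form[OF i cond_dist_section_kernel[OF i] f] integrable_lift_form[OF i cond_dist_section_kernel[OF i] f]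
    by (simp_all add: E_def power2_eq_square)
  have P: "P = (\<integral>y. ?q y \<partial>marg i)" "integrable (marg i) ?q"
    using lift_form[OF i K rev f] integrable_lift_form[OF i K rev f] by (simp_all add: P_def)
  have N: "(\<integral>x. (f x)\<^sup>2 \<partial>\<mu>) = (\<integral>y. ?s y \<partial>marg i)" "integrable (marg i) ?s"
    using integral_disintegration[OF i f2] integrable_marg[OF i f2] by simp_all
  show "0 \<le> E" unfolding E(1) by simp
  have sq: "AE y in marg i. square_integrable (?c y) (\<lambda>z. f (y(i := z)))"
    using AE_space AE_integrable_cond[OF i f2]
  proof eventually_elim
    fix y assume "y \<in> space (marg i)" "integrable (?c y) (\<lambda>z. (f (y(i := z)))\<^sup>2)"
    then show "square_integrable (?c y) (\<lambda>z. f (y(i := z)))"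
      using insert_measurable(2)[OF i fm, of y]
      by (simp add: square_integrable_def space_marg[OF i] measurable_cong_sets[OF sets_cond_dist[OF i] refl])
  qed
  show "E \<le> P" unfolding E(1) P(1)
  proof (rule integral_mono_AE[OF E(2) P(2)])
    show "AE y in marg i. ?e y \<le> ?q y" using sq AE_marg[OF i low] by eventually_elim blast
  qed
  have "c * ((\<integral>y. ?s y \<partial>marg i) - (\<integral>y. ?e y \<partial>marg i)) = (\<integral>y. c * (?s y - ?e y) \<partial>marg i)"
    using E(2) N(2) by simp
  also have "\<dots> \<le> (\<integral>y. ?s y - ?q y \<partial>marg i)"
  proof (rule integral_mono_AE)
    show "AE y in marg i. c * (?s y - ?e y) \<le> ?s y - ?q y" using sq AE_marg[OF i gap] by eventually_elim blast
  qed (use E P N in auto)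
  also have "\<dots> = (\<integral>y. ?s y \<partial>marg i) - (\<integral>y. ?q y \<partial>marg i)" using N P by simp
  finally show "c * ((\<integral>x. (f x)\<^sup>2 \<partial>\<mu>) - E) \<le> (\<integral>x. (f x)\<^sup>2 \<partial>\<mu>) - P" unfolding N(1) E(1) P(1) .
qed

end

section \<open>Assembly of the comparison of spectral gaps\<close>

theorem proposition17:
  "\<exists>C\<^sub>0::real. C\<^sub>0 > 0 \<and>
    (\<forall>(n::nat) (d::nat \<Rightarrow> nat) (\<xi>::(nat \<Rightarrow> nat \<Rightarrow> real) \<Rightarrow> real) (p::nat \<Rightarrow> real) (k::nat)
       (m::nat \<Rightarrow> (nat \<Rightarrow> nat \<Rightarrow> real) \<Rightarrow> real) (L::nat \<Rightarrow> (nat \<Rightarrow> nat \<Rightarrow> real) \<Rightarrow> real).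
      (\<forall>i\<in>{1..n}. d i \<ge> 1) \<longrightarrow>
      \<xi> \<in> borel_measurable (state_space n d) \<longrightarrow>
      integrable (state_space n d) (\<lambda>x. exp (- \<xi> x)) \<longrightarrow>
      (\<forall>i\<in>{1..n}. p i \<ge> 0) \<longrightarrow>
      (\<Sum>i=1..n. p i) = 1 \<longrightarrow>
      k \<in> {1..n} \<longrightarrow>
      (\<forall>i\<in>{1..k}. \<forall>y\<in>space (rest_space n d i).
         m i y > 0 \<and> L i y > 0 \<and> strongly_convex_smooth (d i) (m i y) (L i y) (cond_pot \<xi> i y)) \<longrightarrow>
      (\<forall>i\<in>{1..n}. \<forall>A\<in>sets (euclid (d i)).
         (\<lambda>x. emeasure (hybrid_cond_kernel k d \<xi> L i (drop_comp n i x) (x i)) A)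
           \<in> borel_measurable (state_space n d)) \<longrightarrow>
      (let \<mu> = gibbs_measure (state_space n d) \<xi>;
           T = exact_gibbs n d p \<xi>;
           T' = hybrid_gibbs n k d p \<xi> L
       in (MIN i\<in>{1..k}. INF y\<in>space (rest_space n d i). C\<^sub>0 * m i y / (real (d i) * L i y))
            * (1 - kernel_norm \<mu> T) \<le> 1 - kernel_norm \<mu> T' \<and>
          1 - kernel_norm \<mu> T' \<le> 1 - kernel_norm \<mu> T))"
proof (rule exI[of _ gap_const], intro conjI allI impI)
  show "gap_const > 0" by (rule gap_const)
  fix n :: nat and d :: "nat \<Rightarrow> nat" and \<xi> :: "(nat \<Rightarrow> nat \<Rightarrow> real) \<Rightarrow> real" and p :: "nat \<Rightarrow> real" and k :: nat
    and m L :: "nat \<Rightarrow> (nat \<Rightarrow> nat \<Rightarrow> real) \<Rightarrow> real"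
  assume d: "\<forall>i\<in>{1..n}. d i \<ge> 1"
    and \<xi>: "\<xi> \<in> borel_measurable (state_space n d)" "integrable (state_space n d) (\<lambda>x. exp (- \<xi> x))"
    and p: "\<forall>i\<in>{1..n}. p i \<ge> 0" "(\<Sum>i=1..n. p i) = 1"
    and k: "k \<in> {1..n}"
    and convex: "\<forall>i\<in>{1..k}. \<forall>y\<in>space (rest_space n d i).
         m i y > 0 \<and> L i y > 0 \<and> strongly_convex_smooth (d i) (m i y) (L i y) (cond_pot \<xi> i y)"
    and meas: "\<forall>i\<in>{1..n}. \<forall>A\<in>sets (euclid (d i)).
         (\<lambda>x. emeasure (hybrid_cond_kernel k d \<xi> L i (drop_comp n i x) (x i)) A)
           \<in> borel_measurable (state_space n d)"
  interpret G: gibbs_target n d \<xi> by standard (rule \<xi>)+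
  let ?H = "hybrid_cond_kernel k d \<xi> L" and ?C = "\<lambda>i y (z :: nat \<Rightarrow> real). cond_dist d \<xi> i y"
  define c where "c = (MIN i\<in>{1..k}. INF y\<in>space (rest_space n d i). gap_const * m i y / (real (d i) * L i y))"
  have nonempty: "space (rest_space n d i) \<noteq> {}" if "i \<in> {1..n}" for i
    using measurable_space[OF G.measurable_drop[OF that]] G.\<mu>.not_empty by auto
  have nonneg: "0 \<le> gap_const * m i y / (real (d i) * L i y)" if "i \<in> {1..k}" "y \<in> space (rest_space n d i)" for i y
  proof -
    have "0 < m i y" "0 < L i y" using convex that by blast+
    then show ?thesis using gap_const by simp
  qed
  \<comment> \<open>A real infimum is a lower bound only for a set that is bounded below; the bound
    0 comes from positivity of \<open>m\<close> and \<open>L\<close>.\<close>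
  have c_le: "c \<le> gap_const * m i y / (real (d i) * L i y)" if i: "i \<in> {1..k}" and y: "y \<in> space (rest_space n d i)" for i y
  proof -
    have "c \<le> (INF y\<in>space (rest_space n d i). gap_const * m i y / (real (d i) * L i y))"
      unfolding c_def using i by (intro Min_le) auto
    also have "\<dots> \<le> gap_const * m i y / (real (d i) * L i y)"
      using nonneg[OF i] y by (intro cINF_lower) (auto intro!: bdd_belowI[of _ 0])
    finally show ?thesis .
  qed
  have c0: "0 \<le> c"
  proof -
    have "c \<in> (\<lambda>i. INF y\<in>space (rest_space n d i). gap_const * m i y / (real (d i) * L i y)) ` {1..k}"
      unfolding c_def using k by (intro Min_in) auto
    then obtain i where i: "i \<in> {1..k}" "c = (INF y\<in>space (rest_space n d i). gap_const * m i y / (real (d i) * L i y))"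
      by auto
    have "i \<in> {1..n}" using i k by auto
    then show ?thesis unfolding i(2) using nonneg[OF i(1)] nonempty by (intro cINF_greatest) auto
  qed
  \<comment> \<open>Coordinate 1 always belongs to the Metropolis block, and there
    \<open>m \<le> L\<close>, \<open>1 \<le> d 1\<close> and
    \<open>gap_const \<le> 1\<close>.\<close>
  have c1: "c \<le> 1"
  proof -
    have 1: "1 \<in> {1..k}" "1 \<in> {1..n}" using k by auto
    obtain y where y: "y \<in> space (rest_space n d 1)" using nonempty[OF 1(2)] by auto
    have mL: "0 < m 1 y" "0 < L 1 y" "m 1 y \<le> L 1 y"
      using convex 1 y d strongly_convex_smooth_le by blast+
    have "gap_const * m 1 y \<le> 1 * L 1 y" using gap_const mL by (intro mult_mono) auto
    also have "\<dots> \<le> real (d 1) * L 1 y" using d 1 mL by (intro mult_right_mono) auto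
    finally have le: "gap_const * m 1 y \<le> real (d 1) * L 1 y" .
    have "0 < real (d 1) * L 1 y" using d[rule_format, OF 1(2)] mL by simp
    with le have "gap_const * m 1 y / (real (d 1) * L 1 y) \<le> 1" by (subst divide_le_eq_1_pos)
    then show ?thesis using c_le[OF 1(1) y] by simp
  qed
  have potential: "convex_potential (d i) (cond_pot \<xi> i y) (grad (d i) (cond_pot \<xi> i y)) (m i y) (L i y)"
    if i: "i \<in> {1..n}" "i \<le> k" and y: "y \<in> space (rest_space n d i)" and int: "integrable (euclid (d i)) (\<lambda>z. exp (- cond_pot \<xi> i y z))"
    for i y
  proof -
    have "i \<in> {1..k}" using i by auto
    then have c: "0 < m i y" "0 < L i y" "strongly_convex_smooth (d i) (m i y) (L i y) (cond_pot \<xi> i y)"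
      using convex y by blast+
    show ?thesis
    proof
      show "1 \<le> d i" "0 < m i y" "0 < L i y" using c d i by auto
      show "cond_pot \<xi> i y \<in> borel_measurable (euclid (d i))" by (rule G.cond_pot_measurable(2)[OF i(1) y])
      show "integrable (euclid (d i)) (\<lambda>z. exp (- cond_pot \<xi> i y z))" by fact
    qed (rule strongly_convex_smoothD[OF c(3)]; assumption)+
  qed
  have H_kernel: "(\<lambda>x. ?H i (drop_comp n i x) (x i)) \<in> state_space n d \<rightarrow>\<^sub>M prob_algebra (euclid (d i))"
    if i: "i \<in> {1..n}" for i
  proof (rule measurable_prob_kernelI)
    show "(\<lambda>x. emeasure (?H i (drop_comp n i x) (x i)) A) \<in> borel_measurable (state_space n d)"
      if "A \<in> sets (euclid (d i))" for A using meas i that by blast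
    fix x assume x: "x \<in> space (state_space n d)"
    let ?y = "drop_comp n i x"
    have y: "?y \<in> space (rest_space n d i)" by (rule measurable_space[OF G.measurable_drop[OF i] x])
    have z: "x i \<in> space (euclid (d i))" by (rule measurable_space[OF G.measurable_coord[OF i] x])
    have "prob_space (?H i ?y (x i)) \<and> sets (?H i ?y (x i)) = sets (euclid (d i))"
    proof (cases "i \<le> k")
      case True
      then have "i \<in> {1..k}" using i by auto
      then have "0 < L i ?y" using convex y by blast
      moreover have "0 < real (d i)" using d i by (auto simp: Suc_le_eq)
      ultimately have "0 < sqrt (1 / (2 * L i ?y * real (d i)))" by simp
      then show ?thesis
        using True prob_space_rw_metropolis[OF z G.cond_pot_measurable(2)[OF i y]]
          sets_rw_metropolis[OF z G.cond_pot_measurable(2)[OF i y]]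
        by (simp add: hybrid_cond_kernel_def)
    next
      case False
      then show ?thesis using G.prob_space_cond_dist[OF i y] G.sets_cond_dist[OF i]
        by (simp add: hybrid_cond_kernel_def)
    qed
    then show "prob_space (?H i ?y (x i))" "sets (?H i ?y (x i)) = sets (euclid (d i))" by auto
  qed
  \<comment> \<open>The claim is restricted to those \<open>y\<close> whose section is integrable:
    there \<open>cond_dist\<close> is the Gibbs measure of \<open>cond_pot\<close>, and for
    \<open>i \<le> k\<close> it coincides with the measure of the locale
    \<open>convex_potential\<close>.\<close>
  have sections: "AE y in rest_space n d i. reversible_kernel (cond_dist d \<xi> i y) (?H i y) \<and>
      (\<forall>g. square_integrable (cond_dist d \<xi> i y) g \<longrightarrow>
        (\<integral>z. g z \<partial>cond_dist d \<xi> i y)\<^sup>2 \<le> (\<integral>z. g z * (\<integral>z'. g z' \<partial>?H i y z) \<partial>cond_dist d \<xi> i y) \<and>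
        c * ((\<integral>z. (g z)\<^sup>2 \<partial>cond_dist d \<xi> i y) - (\<integral>z. g z \<partial>cond_dist d \<xi> i y)\<^sup>2) \<le>
          (\<integral>z. (g z)\<^sup>2 \<partial>cond_dist d \<xi> i y) - (\<integral>z. g z * (\<integral>z'. g z' \<partial>?H i y z) \<partial>cond_dist d \<xi> i y))"
    if i: "i \<in> {1..n}" for i
    using AE_space G.AE_integrable_section[OF i]
  proof eventually_elim
    fix y assume y: "y \<in> space (rest_space n d i)" and int: "integrable (euclid (d i)) (\<lambda>z. exp (- cond_pot \<xi> i y z))"
    let ?\<nu> = "cond_dist d \<xi> i y"
    interpret \<nu>: prob_space ?\<nu> by (rule G.prob_space_cond_dist[OF i y])
    show "reversible_kernel ?\<nu> (?H i y) \<and>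
      (\<forall>g. square_integrable ?\<nu> g \<longrightarrow>
        (\<integral>z. g z \<partial>?\<nu>)\<^sup>2 \<le> (\<integral>z. g z * (\<integral>z'. g z' \<partial>?H i y z) \<partial>?\<nu>) \<and>
        c * ((\<integral>z. (g z)\<^sup>2 \<partial>?\<nu>) - (\<integral>z. g z \<partial>?\<nu>)\<^sup>2) \<le> (\<integral>z. (g z)\<^sup>2 \<partial>?\<nu>) - (\<integral>z. g z * (\<integral>z'. g z' \<partial>?H i y z) \<partial>?\<nu>))"
    proof (cases "i \<le> k")
      case True
      interpret V: convex_potential "d i" "cond_pot \<xi> i y" "grad (d i) (cond_pot \<xi> i y)" "m i y" "L i y"
        by (rule potential[OF i True y int])
      have \<nu>: "V.\<nu> = ?\<nu>" using int by (simp add: V.\<nu>_def cond_dist_def)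
      have Q: "V.Q = ?H i y" using True by (simp add: V.Q_def V.\<sigma>_def hybrid_cond_kernel_def fun_eq_iff)
      have rev: "reversible_kernel ?\<nu> (?H i y)" using V.reversible_Q unfolding \<nu> Q .
      have "(\<integral>z. g z \<partial>?\<nu>)\<^sup>2 \<le> (\<integral>z. g z * (\<integral>z'. g z' \<partial>?H i y z) \<partial>?\<nu>)" if g: "square_integrable ?\<nu> g" for g
        by (rule reversible_kernel.mean_square_le[OF rev V.Q_positive[unfolded \<nu> Q] g])
      moreover have "c * ((\<integral>z. (g z)\<^sup>2 \<partial>?\<nu>) - (\<integral>z. g z \<partial>?\<nu>)\<^sup>2) \<le> (\<integral>z. (g z)\<^sup>2 \<partial>?\<nu>) - (\<integral>z. g z * (\<integral>z'. g z' \<partial>?H i y z) \<partial>?\<nu>)"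
        if g: "square_integrable ?\<nu> g" for g
      proof -
        have "i \<in> {1..k}" using i True by auto
        then have "c * ((\<integral>z. (g z)\<^sup>2 \<partial>?\<nu>) - (\<integral>z. g z \<partial>?\<nu>)\<^sup>2) \<le>
          gap_const * m i y / (real (d i) * L i y) * ((\<integral>z. (g z)\<^sup>2 \<partial>?\<nu>) - (\<integral>z. g z \<partial>?\<nu>)\<^sup>2)"
          using c_le y \<nu>.integral_square_le[OF g] by (intro mult_right_mono) auto
        also have "\<dots> \<le> (\<integral>z. (g z)\<^sup>2 \<partial>?\<nu>) - (\<integral>z. g z * (\<integral>z'. g z' \<partial>?H i y z) \<partial>?\<nu>)"
          by (rule V.Q_gap[unfolded \<nu> Q, OF g])
        finally show ?thesis .
      qed
      ultimately show ?thesis using rev by blast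
    next
      case False
      then have H: "?H i y = (\<lambda>_. ?\<nu>)" by (simp add: hybrid_cond_kernel_def fun_eq_iff)
      \<comment> \<open>For an exactly sampled coordinate the energy is the full variance, so the
        gap inequality only says \<open>c \<le> 1\<close>.\<close>
      have "c * ((\<integral>z. (g z)\<^sup>2 \<partial>?\<nu>) - (\<integral>z. g z \<partial>?\<nu>)\<^sup>2) \<le> (\<integral>z. (g z)\<^sup>2 \<partial>?\<nu>) - (\<integral>z. g z \<partial>?\<nu>)\<^sup>2"
        if g: "square_integrable ?\<nu> g" for g
        using mult_right_mono[OF c1, of "(\<integral>z. (g z)\<^sup>2 \<partial>?\<nu>) - (\<integral>z. g z \<partial>?\<nu>)\<^sup>2"] \<nu>.integral_square_le[OF g] by simp
      then show ?thesis unfolding H using reversible_kernel_const[OF \<nu>.prob_space_axioms]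
        by (simp add: power2_eq_square)
    qed
  qed
  have H_rev: "AE y in rest_space n d i. reversible_kernel (cond_dist d \<xi> i y) (?H i y)" if "i \<in> {1..n}" for i
    using sections[OF that] by eventually_elim blast
  have p0: "\<And>i. i \<in> {1..n} \<Longrightarrow> 0 \<le> p i" using p by blast
  note C = G.cond_dist_section_kernel
  let ?E = "\<lambda>f i. \<integral>x. f x * (\<integral>x'. f x' \<partial>G.lift i (?C i) x) \<partial>G.\<mu>"
    and ?P = "\<lambda>f i. \<integral>x. f x * (\<integral>x'. f x' \<partial>G.lift i (?H i) x) \<partial>G.\<mu>"
    and ?N = "\<lambda>f. \<integral>x. (f x)\<^sup>2 \<partial>G.\<mu>"
  have comp: "0 \<le> ?E f i" "?E f i \<le> ?P f i" "c * (?N f - ?E f i) \<le> ?N f - ?P f i"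
    if i: "i \<in> {1..n}" and f: "square_integrable G.\<mu> f" for i f
  proof -
    have "AE y in rest_space n d i. \<forall>g. square_integrable (cond_dist d \<xi> i y) g \<longrightarrow>
       (\<integral>z. g z \<partial>cond_dist d \<xi> i y)\<^sup>2 \<le> (\<integral>z. g z * (\<integral>z'. g z' \<partial>?H i y z) \<partial>cond_dist d \<xi> i y)"
      using sections[OF i] by eventually_elim blast
    moreover have "AE y in rest_space n d i. \<forall>g. square_integrable (cond_dist d \<xi> i y) g \<longrightarrow>
       c * ((\<integral>z. (g z)\<^sup>2 \<partial>cond_dist d \<xi> i y) - (\<integral>z. g z \<partial>cond_dist d \<xi> i y)\<^sup>2) \<le>
       (\<integral>z. (g z)\<^sup>2 \<partial>cond_dist d \<xi> i y) - (\<integral>z. g z * (\<integral>z'. g z' \<partial>?H i y z) \<partial>cond_dist d \<xi> i y)"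
      using sections[OF i] by eventually_elim blast
    ultimately show "0 \<le> ?E f i" "?E f i \<le> ?P f i" "c * (?N f - ?E f i) \<le> ?N f - ?P f i"
      using G.lift_comparison[OF i H_kernel[OF i] H_rev[OF i] _ _ f] by blast+
  qed
  have T_rev: "reversible_kernel G.\<mu> (exact_gibbs n d p \<xi>)"
    unfolding exact_gibbs_def by (rule G.random_scan_reversible[OF p0 p(2) C])
  have T'_rev: "reversible_kernel G.\<mu> (hybrid_gibbs n k d p \<xi> L)"
    unfolding hybrid_gibbs_def by (rule G.random_scan_reversible[OF p0 p(2) H_kernel H_rev])
  have T_form: "(\<integral>x. f x * (\<integral>y. f y \<partial>exact_gibbs n d p \<xi> x) \<partial>G.\<mu>) = (\<Sum>i=1..n. p i * ?E f i)"
    if "square_integrable G.\<mu> f" for f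
    unfolding exact_gibbs_def by (rule G.random_scan_form[OF p0 p(2) C that])
  have T'_form: "(\<integral>x. f x * (\<integral>y. f y \<partial>hybrid_gibbs n k d p \<xi> L x) \<partial>G.\<mu>) = (\<Sum>i=1..n. p i * ?P f i)"
    if "square_integrable G.\<mu> f" for f
    unfolding hybrid_gibbs_def by (rule G.random_scan_form[OF p0 p(2) H_kernel H_rev that])
  have form1: "0 \<le> (\<integral>x. f x * (\<integral>y. f y \<partial>exact_gibbs n d p \<xi> x) \<partial>G.\<mu>)"
    if f: "square_integrable G.\<mu> f" for f
    unfolding T_form[OF f] using comp(1)[OF _ f] p0 by (intro sum_nonneg mult_nonneg_nonneg)
  have form2: "(\<integral>x. f x * (\<integral>y. f y \<partial>exact_gibbs n d p \<xi> x) \<partial>G.\<mu>) \<le> (\<integral>x. f x * (\<integral>y. f y \<partial>hybrid_gibbs n k d p \<xi> L x) \<partial>G.\<mu>)"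
    if f: "square_integrable G.\<mu> f" for f
    unfolding T_form[OF f] T'_form[OF f] using comp(2)[OF _ f] p0 by (intro sum_mono mult_left_mono)
  have form3: "c * (?N f - (\<integral>x. f x * (\<integral>y. f y \<partial>exact_gibbs n d p \<xi> x) \<partial>G.\<mu>)) \<le>
      ?N f - (\<integral>x. f x * (\<integral>y. f y \<partial>hybrid_gibbs n k d p \<xi> L x) \<partial>G.\<mu>)"
    if f: "square_integrable G.\<mu> f" for f
  proof -
    \<comment> \<open>The weights sum to 1, so the squared norm can be distributed over the
      coordinates and the inequality checked one coordinate at a time.\<close>
    have mix: "?N f - (\<Sum>i=1..n. p i * h i) = (\<Sum>i=1..n. p i * (?N f - h i))" for h
      using p(2) by (simp add: right_diff_distrib sum_subtractf sum_distrib_right[symmetric])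
    have "c * (?N f - (\<Sum>i=1..n. p i * ?E f i)) = (\<Sum>i=1..n. p i * (c * (?N f - ?E f i)))"
      unfolding mix by (simp add: sum_distrib_left mult_ac)
    also have "\<dots> \<le> (\<Sum>i=1..n. p i * (?N f - ?P f i))"
      using comp(3)[OF _ f] p0 by (intro sum_mono mult_left_mono)
    finally show ?thesis unfolding T_form[OF f] T'_form[OF f] mix .
  qed
  note kernel_norm_comparison[OF T_rev T'_rev form1 form2 form3 c0 c1]
  then show "let \<mu> = gibbs_measure (state_space n d) \<xi>;
           T = exact_gibbs n d p \<xi>;
           T' = hybrid_gibbs n k d p \<xi> L
       in (MIN i\<in>{1..k}. INF y\<in>space (rest_space n d i). gap_const * m i y / (real (d i) * L i y))
            * (1 - kernel_norm \<mu> T) \<le> 1 - kernel_norm \<mu> T' \<and>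
          1 - kernel_norm \<mu> T' \<le> 1 - kernel_norm \<mu> T"
    unfolding Let_def c_def[symmetric] G.\<mu>_def[symmetric] by blast
qed

end
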